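(* Let $(X,T^*_{X,-})$ be a model. For any $\ell\ge1$ the boundary map $$\delta_{2\ell+2}:H^0(X,\mathcal A_{T^*_{X,-},2\ell+1})\longrightarrow\check H^1(X,\mathrm G_{T^*_{X,-},2\ell+2})$$ is constant and sends every global section in $H^0(X,\mathcal A_{T^*_{X,-},2\ell+1})$ to the base-point of $\check H^1(X,\mathrm G_{T^*_{X,-},2\ell+2})$.
   Context: A model $(X,T^*_{X,-})$ is a complex manifold $X$ with a holomorphic vector bundle $T^*_{X,-}$ (identified with its locally free sheaf of sections). Let $J=\bigoplus_{j>0}\wedge^jT^*_{X,-}\subset\wedge^\bullet T^*_{X,-}$ and $J^k=\bigoplus_{j\ge k}\wedge^jT^*_{X,-}$. For $k\ge2$ let $\mathrm G_{T^*_{X,-},k}$ be the sheaf of groups of automorphisms $\alpha$ of $\wedge^\bullet T^*_{X,-}$ (as a sheaf of $\mathbb C$-algebras, preserving the $\mathbb Z_2$-grading) with $\alpha(u)-u\in J^k$ for all $u$. These form a descending series of sheaves of normal subgroups of $\mathrm G_{T^*_{X,-},2}$ with abelian quotients $\mathcal A_{T^*_{X,-},k}=\mathrm G_{T^*_{X,-},k}/\mathrm G_{T^*_{X,-},k+1}$. $\check H^1(X,-)$ denotes the non-abelian Čech cohomology pointed set. The map $\delta_{j+1}:H^0(X,\mathcal A_{T^*_{X,-},j})\to\check H^1(X,\mathrm G_{T^*_{X,-},j+1})$ is the connecting map of the short exact sequence of sheaves of groups $\{e\}\to\mathrm G_{T^*_{X,-},j+1}\to\mathrm G_{T^*_{X,-},j}\to\mathcal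 A_{T^*_{X,-},j}\to\{e\}$. *)

theory Defs
  imports "HOL-Analysis.Analysis" "HOL-Algebra.QuotRing" "HOL-Library.Poly_Mapping"
begin

section \<open>Complex manifolds\<close>

text \<open>
  \<open>\<complex>\<^sup>n\<close> is realised as the sequences of complex numbers vanishing from index \<open>n\<close> on, with the
  product topology (compare \<^const>\<open>Euclidean_space\<close>). This includes \<open>n = 0\<close>.
\<close>

definition cspace :: "nat \<Rightarrow> (nat \<Rightarrow> complex) topology" where
  "cspace n = subtopology (product_topology (\<lambda>_. euclidean) UNIV) {z. \<forall>i\<ge>n. z i = 0}"

text \<open>
  A function on an open set \<open>D\<close> of \<open>\<complex>\<^sup>n\<close> is holomorphic if it is continuous and complex
  differentiable in each of the \<open>n\<close> variables separately.
\<close>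

definition holo_cspace :: "nat \<Rightarrow> (nat \<Rightarrow> complex) set \<Rightarrow> ((nat \<Rightarrow> complex) \<Rightarrow> complex) \<Rightarrow> bool" where
  "holo_cspace n D f \<longleftrightarrow>
     continuous_map (subtopology (cspace n) D) euclidean f \<and>
     (\<forall>z\<in>D. \<forall>i<n. (\<lambda>t. f (z(i := t))) field_differentiable at (z i))"

record 'x cmanifold =
  mtop :: "'x topology"
  mdim :: nat
  charts :: "('x set \<times> ('x \<Rightarrow> nat \<Rightarrow> complex)) set"

definition complex_manifold :: "'x cmanifold \<Rightarrow> bool" where
  "complex_manifold M \<longleftrightarrow>
     Hausdorff_space (mtop M) \<and> second_countable (mtop M) \<and>
     (\<Union>(U, \<phi>)\<in>charts M. U) = topspace (mtop M) \<and>
     (\<forall>(U, \<phi>)\<in>charts M.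
        openin (mtop M) U \<and> openin (cspace (mdim M)) (\<phi> ` U) \<and>
        homeomorphic_map (subtopology (mtop M) U) (subtopology (cspace (mdim M)) (\<phi> ` U)) \<phi>) \<and>
     (\<forall>(U, \<phi>)\<in>charts M. \<forall>(V, \<psi>)\<in>charts M. \<forall>i<mdim M.
        holo_cspace (mdim M) (\<phi> ` (U \<inter> V)) (\<lambda>z. \<psi> (inv_into U \<phi> z) i))"

definition holo_fun :: "'x cmanifold \<Rightarrow> 'x set \<Rightarrow> ('x \<Rightarrow> complex) \<Rightarrow> bool" where
  "holo_fun M W f \<longleftrightarrow>
     (\<forall>(U, \<phi>)\<in>charts M. holo_cspace (mdim M) (\<phi> ` (W \<inter> U)) (\<lambda>z. f (inv_into U \<phi> z)))"

definition opens :: "'x topology \<Rightarrow> 'x set \<Rightarrow> 'x set set" where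
  "opens X U = {V. openin X V \<and> V \<subseteq> U}"


section \<open>Holomorphic vector bundles\<close>

text \<open>
  A holomorphic vector bundle of rank \<open>r\<close> is given by its set of points with the projection to the
  base, the addition and scalar multiplication of the fibres, and local trivialisations \<open>(U, h)\<close>:
  on each fibre over \<open>U\<close> the map \<open>h\<close> is a linear bijection to \<open>\<complex>\<^sup>r\<close> (so that every fibre is a complex
  vector space), and the matrix entries of the transition functions are holomorphic. The topology
  and the complex structure of the total space are determined by these data.
\<close>

record ('x, 'e) vbundle =
  total :: "'e set"
  proj :: "'e \<Rightarrow> 'x"
  vadd :: "'e \<Rightarrow> 'e \<Rightarrow> 'e"
  vscale :: "complex \<Rightarrow> 'e \<Rightarrow> 'e"
  vrank :: nat
  trivs :: "('x set \<times> ('e \<Rightarrow> nat \<Rightarrow> complex)) set"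

definition fibre :: "('x, 'e) vbundle \<Rightarrow> 'x \<Rightarrow> 'e set" where
  "fibre E x = {v \<in> total E. proj E v = x}"

definition unit_vec :: "nat \<Rightarrow> nat \<Rightarrow> complex" where
  "unit_vec a = (\<lambda>i. if i = a then 1 else 0)"

definition holomorphic_vector_bundle :: "'x cmanifold \<Rightarrow> ('x, 'e) vbundle \<Rightarrow> bool" where
  "holomorphic_vector_bundle M E \<longleftrightarrow>
     proj E ` total E \<subseteq> topspace (mtop M) \<and>
     (\<Union>(U, h)\<in>trivs E. U) = topspace (mtop M) \<and>
     (\<forall>x\<in>topspace (mtop M). \<forall>u\<in>fibre E x.
        (\<forall>v\<in>fibre E x. vadd E u v \<in> fibre E x) \<and> (\<forall>c. vscale E c u \<in> fibre E x)) \<and>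
     (\<forall>(U, h)\<in>trivs E. openin (mtop M) U \<and>
        (\<forall>x\<in>U. bij_betw h (fibre E x) (topspace (cspace (vrank E))) \<and>
           (\<forall>u\<in>fibre E x. \<forall>v\<in>fibre E x. h (vadd E u v) = (\<lambda>i. h u i + h v i)) \<and>
           (\<forall>c. \<forall>u\<in>fibre E x. h (vscale E c u) = (\<lambda>i. c * h u i)))) \<and>
     (\<forall>(U, h)\<in>trivs E. \<forall>(V, k)\<in>trivs E. \<forall>a<vrank E. \<forall>b<vrank E.
        holo_fun M (U \<inter> V) (\<lambda>x. k (inv_into (fibre E x) h (unit_vec a)) b))"

definition holo_section ::
  "'x cmanifold \<Rightarrow> ('x, 'e) vbundle \<Rightarrow> 'x set \<Rightarrow> ('x \<Rightarrow> 'e) \<Rightarrow> bool" where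
  "holo_section M E W u \<longleftrightarrow>
     (\<forall>x\<in>W. u x \<in> fibre E x) \<and>
     (\<forall>(U, h)\<in>trivs E. \<forall>a<vrank E. holo_fun M (W \<inter> U) (\<lambda>x. h (u x) a))"


section \<open>The exterior algebra of a fibre\<close>

instantiation list :: (type) monoid_add
begin
definition zero_list :: "'a list" where "zero_list = []"
definition plus_list :: "'a list \<Rightarrow> 'a list \<Rightarrow> 'a list" where "plus_list = (@)"
instance by standard (simp_all add: zero_list_def plus_list_def)
end

text \<open>
  With concatenation as addition of lists, the multiplication of \<^typ>\<open>'e list \<Rightarrow>\<^sub>0 complex\<close> is
  that of the free associative algebra over the complex numbers on \<^typ>\<open>'e\<close>. The exterior algebra of a vector
  space \<open>V\<close> is the free algebra on the set \<open>V\<close> modulo linearity of the generators and \<open>v \<cdot> v = 0\<close>.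
\<close>

definition free_algebra :: "'e set \<Rightarrow> ('e list \<Rightarrow>\<^sub>0 complex) ring" where
  "free_algebra V =
     \<lparr>carrier = {a. \<forall>w\<in>Poly_Mapping.keys a. set w \<subseteq> V}, mult = (*), one = 1, zero = 0, add = (+)\<rparr>"

definition ext_relations ::
  "('x, 'e) vbundle \<Rightarrow> 'x \<Rightarrow> ('e list \<Rightarrow>\<^sub>0 complex) set" where
  "ext_relations E x =
     {Poly_Mapping.single [vadd E u v] 1 - Poly_Mapping.single [u] 1 - Poly_Mapping.single [v] 1
        | u v. u \<in> fibre E x \<and> v \<in> fibre E x} \<union>
     {Poly_Mapping.single [vscale E c u] 1 - Poly_Mapping.single [u] c | c u. u \<in> fibre E x} \<union>
     {Poly_Mapping.single [u, u] 1 | u. u \<in> fibre E x}"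

definition ext_ideal :: "('x, 'e) vbundle \<Rightarrow> 'x \<Rightarrow> ('e list \<Rightarrow>\<^sub>0 complex) set" where
  "ext_ideal E x = genideal (free_algebra (fibre E x)) (ext_relations E x)"

definition ext_algebra :: "('x, 'e) vbundle \<Rightarrow> 'x \<Rightarrow> ('e list \<Rightarrow>\<^sub>0 complex) set ring" where
  "ext_algebra E x = FactRing (free_algebra (fibre E x)) (ext_ideal E x)"

definition ext_class ::
  "('x, 'e) vbundle \<Rightarrow> 'x \<Rightarrow> ('e list \<Rightarrow>\<^sub>0 complex) \<Rightarrow> ('e list \<Rightarrow>\<^sub>0 complex) set" where
  "ext_class E x a = a_r_coset (free_algebra (fibre E x)) (ext_ideal E x) a"

text \<open>The direct sum of the exterior powers of the fibre whose degree satisfies \<open>P\<close>.\<close>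

definition ext_part ::
  "('x, 'e) vbundle \<Rightarrow> 'x \<Rightarrow> (nat \<Rightarrow> bool) \<Rightarrow> ('e list \<Rightarrow>\<^sub>0 complex) set set" where
  "ext_part E x P =
     ext_class E x ` {a \<in> carrier (free_algebra (fibre E x)). \<forall>w\<in>Poly_Mapping.keys a. P (length w)}"


section \<open>The sheaf of sections of the exterior algebra bundle\<close>

type_synonym ('x, 'e) ext_section = "'x \<Rightarrow> ('e list \<Rightarrow>\<^sub>0 complex) set"

text \<open>
  A section is holomorphic if locally it is a finite linear combination, with holomorphic
  coefficients, of products of holomorphic sections of the bundle; such a combination is
  represented by the list of its terms \<open>(f, [u\<^sub>1, \<dots>, u\<^sub>k])\<close>.
\<close>

definition ext_sections ::
  "'x cmanifold \<Rightarrow> ('x, 'e) vbundle \<Rightarrow> 'x set \<Rightarrow> ('x, 'e) ext_section set" where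
  "ext_sections M E U =
     {s \<in> (\<Pi>\<^sub>E x\<in>U. carrier (ext_algebra E x)).
        \<forall>x\<in>U. \<exists>W\<in>opens (mtop M) U. x \<in> W \<and>
          (\<exists>terms :: (('x \<Rightarrow> complex) \<times> ('x \<Rightarrow> 'e) list) list.
             (\<forall>(f, us)\<in>set terms. holo_fun M W f \<and> (\<forall>u\<in>set us. holo_section M E W u)) \<and>
             (\<forall>y\<in>W. s y = ext_class E y
                (\<Sum>(f, us)\<leftarrow>terms. Poly_Mapping.single (map (\<lambda>u. u y) us) (f y))))}"

definition ext_section_ring ::
  "'x cmanifold \<Rightarrow> ('x, 'e) vbundle \<Rightarrow> 'x set \<Rightarrow> ('x, 'e) ext_section ring" where
  "ext_section_ring M E U =
     \<lparr>carrier = ext_sections M E U,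
      mult = (\<lambda>s t. \<lambda>x\<in>U. s x \<otimes>\<^bsub>ext_algebra E x\<^esub> t x),
      one = (\<lambda>x\<in>U. \<one>\<^bsub>ext_algebra E x\<^esub>),
      zero = (\<lambda>x\<in>U. \<zero>\<^bsub>ext_algebra E x\<^esub>),
      add = (\<lambda>s t. \<lambda>x\<in>U. s x \<oplus>\<^bsub>ext_algebra E x\<^esub> t x)\<rparr>"

definition const_section ::
  "('x, 'e) vbundle \<Rightarrow> 'x set \<Rightarrow> complex \<Rightarrow> ('x, 'e) ext_section" where
  "const_section E U c = (\<lambda>x\<in>U. ext_class E x (Poly_Mapping.single [] c))"

definition ext_sections_part ::
  "'x cmanifold \<Rightarrow> ('x, 'e) vbundle \<Rightarrow> 'x set \<Rightarrow> (nat \<Rightarrow> bool) \<Rightarrow> ('x, 'e) ext_section set" where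
  "ext_sections_part M E U P = {s \<in> ext_sections M E U. \<forall>x\<in>U. s x \<in> ext_part E x P}"


section \<open>Sheaves of automorphisms\<close>

text \<open>
  An automorphism over \<open>U\<close> is a family of automorphisms of the algebras of sections over the open
  subsets of \<open>U\<close>, compatible with restriction. A ring homomorphism is complex linear iff it fixes
  the constants.
\<close>

type_synonym ('x, 'e) ext_aut = "'x set \<Rightarrow> ('x, 'e) ext_section \<Rightarrow> ('x, 'e) ext_section"

definition ext_auts ::
  "'x cmanifold \<Rightarrow> ('x, 'e) vbundle \<Rightarrow> 'x set \<Rightarrow> ('x, 'e) ext_aut set" where
  "ext_auts M E U =
     {\<alpha> \<in> (\<Pi>\<^sub>E V\<in>opens (mtop M) U. ext_sections M E V \<rightarrow>\<^sub>E ext_sections M E V).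
        (\<forall>V\<in>opens (mtop M) U.
           \<alpha> V \<in> ring_hom (ext_section_ring M E V) (ext_section_ring M E V) \<and>
           bij_betw (\<alpha> V) (ext_sections M E V) (ext_sections M E V) \<and>
           (\<forall>c. \<alpha> V (const_section E V c) = const_section E V c) \<and>
           \<alpha> V ` ext_sections_part M E V even \<subseteq> ext_sections_part M E V even \<and>
           \<alpha> V ` ext_sections_part M E V odd \<subseteq> ext_sections_part M E V odd) \<and>
        (\<forall>V\<in>opens (mtop M) U. \<forall>W\<in>opens (mtop M) V. \<forall>s\<in>ext_sections M E V.
           \<alpha> W (restrict s W) = restrict (\<alpha> V s) W)}"

record ('x, 'g) group_presheaf =
  sections :: "'x set \<Rightarrow> 'g monoid"
  restr :: "'x set \<Rightarrow> 'x set \<Rightarrow> 'g \<Rightarrow> 'g"  \<comment> \<open>\<open>restr U V\<close> restricts from \<open>U\<close> to \<open>V \<subseteq> U\<close>\<close>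

definition G_sheaf ::
  "'x cmanifold \<Rightarrow> ('x, 'e) vbundle \<Rightarrow> nat \<Rightarrow> ('x, ('x, 'e) ext_aut) group_presheaf" where
  "G_sheaf M E k =
     \<lparr>sections = (\<lambda>U.
        \<lparr>carrier = {\<alpha> \<in> ext_auts M E U. \<forall>V\<in>opens (mtop M) U. \<forall>s\<in>ext_sections M E V. \<forall>x\<in>V.
                      \<alpha> V s x \<ominus>\<^bsub>ext_algebra E x\<^esub> s x \<in> ext_part E x (\<lambda>j. k \<le> j)},
         mult = (\<lambda>\<alpha> \<beta>. \<lambda>V\<in>opens (mtop M) U. compose (ext_sections M E V) (\<alpha> V) (\<beta> V)),
         one = (\<lambda>V\<in>opens (mtop M) U. \<lambda>s\<in>ext_sections M E V. s)\<rparr>),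
      restr = (\<lambda>U V \<alpha>. restrict \<alpha> (opens (mtop M) V))\<rparr>"


section \<open>Quotient sheaves, non-abelian Cech cohomology and the connecting map\<close>

text \<open>
  In this section \<open>F\<close> and \<open>N\<close> are sheaves of groups on the space \<open>X\<close>, and \<open>N\<close> is a sheaf of normal
  subgroups of \<open>F\<close>. Sections of the quotient sheaf \<open>F / N\<close> (the sheafification of
  \<open>U \<mapsto> F(U) / N(U)\<close>) are functions to its stalks that are locally induced by sections of \<open>F\<close>.
\<close>

definition quot_germ ::
  "'x topology \<Rightarrow> ('x, 'g) group_presheaf \<Rightarrow> ('x, 'g) group_presheaf \<Rightarrow>
   'x \<Rightarrow> 'x set \<Rightarrow> 'g \<Rightarrow> ('x set \<times> 'g) set" where
  "quot_germ X F N x U \<alpha> =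
     {(V, \<beta>). openin X V \<and> x \<in> V \<and> \<beta> \<in> carrier (sections F V) \<and>
        (\<exists>W\<in>opens X (U \<inter> V). x \<in> W \<and>
           inv\<^bsub>sections F W\<^esub> (restr F U W \<alpha>) \<otimes>\<^bsub>sections F W\<^esub> restr F V W \<beta>
             \<in> carrier (sections N W))}"

definition quot_sections ::
  "'x topology \<Rightarrow> ('x, 'g) group_presheaf \<Rightarrow> ('x, 'g) group_presheaf \<Rightarrow>
   'x set \<Rightarrow> ('x \<Rightarrow> ('x set \<times> 'g) set) set" where
  "quot_sections X F N U =
     {a \<in> extensional U. \<forall>x\<in>U. \<exists>V\<in>opens X U. x \<in> V \<and>
        (\<exists>\<alpha>\<in>carrier (sections F V). \<forall>y\<in>V. a y = quot_germ X F N y V \<alpha>)}"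

text \<open>An open cover is a set of open sets, indexed by itself.\<close>

definition open_cover :: "'x topology \<Rightarrow> 'x set set \<Rightarrow> bool" where
  "open_cover X \<U> \<longleftrightarrow> (\<forall>U\<in>\<U>. openin X U) \<and> \<Union>\<U> = topspace X"

type_synonym ('x, 'g) cochain = "'x set set \<times> ('x set \<Rightarrow> 'x set \<Rightarrow> 'g)"

definition cocycles :: "'x topology \<Rightarrow> ('x, 'g) group_presheaf \<Rightarrow> ('x, 'g) cochain set" where
  "cocycles X F =
     {(\<U>, g). open_cover X \<U> \<and>
        (\<forall>U\<in>\<U>. \<forall>V\<in>\<U>. g U V \<in> carrier (sections F (U \<inter> V))) \<and>
        (\<forall>U\<in>\<U>. \<forall>V\<in>\<U>. \<forall>W\<in>\<U>.
           restr F (U \<inter> V) (U \<inter> V \<inter> W) (g U V) \<otimes>\<^bsub>sections F (U \<inter> V \<inter> W)\<^esub>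
           restr F (V \<inter> W) (U \<inter> V \<inter> W) (g V W) =
           restr F (U \<inter> W) (U \<inter> V \<inter> W) (g U W))}"

definition cohomologous_on ::
  "('x, 'g) group_presheaf \<Rightarrow> 'x set set \<Rightarrow>
   ('x set \<Rightarrow> 'x set \<Rightarrow> 'g) \<Rightarrow> ('x set \<Rightarrow> 'x set \<Rightarrow> 'g) \<Rightarrow> bool" where
  "cohomologous_on F \<U> g g' \<longleftrightarrow>
     (\<exists>h. (\<forall>U\<in>\<U>. h U \<in> carrier (sections F U)) \<and>
        (\<forall>U\<in>\<U>. \<forall>V\<in>\<U>.
           g' U V = inv\<^bsub>sections F (U \<inter> V)\<^esub> (restr F U (U \<inter> V) (h U)) \<otimes>\<^bsub>sections F (U \<inter> V)\<^esub>
             g U V \<otimes>\<^bsub>sections F (U \<inter> V)\<^esub> restr F V (U \<inter> V) (h V)))"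

definition refines :: "'x set set \<Rightarrow> ('x set \<Rightarrow> 'x set) \<Rightarrow> 'x set set \<Rightarrow> bool" where
  "refines \<W> \<tau> \<U> \<longleftrightarrow> (\<forall>W\<in>\<W>. \<tau> W \<in> \<U> \<and> W \<subseteq> \<tau> W)"

definition pullback ::
  "('x, 'g) group_presheaf \<Rightarrow> ('x set \<Rightarrow> 'x set) \<Rightarrow> ('x set \<Rightarrow> 'x set \<Rightarrow> 'g) \<Rightarrow>
   'x set \<Rightarrow> 'x set \<Rightarrow> 'g" where
  "pullback F \<tau> g V W = restr F (\<tau> V \<inter> \<tau> W) (V \<inter> W) (g (\<tau> V) (\<tau> W))"

text \<open>
  The Cech cohomology set is the direct limit over all open covers of the sets of cocycles up to
  coboundaries: two cocycles are identified if they become cohomologous on a common refinement.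
\<close>

definition cech_rel ::
  "'x topology \<Rightarrow> ('x, 'g) group_presheaf \<Rightarrow> (('x, 'g) cochain \<times> ('x, 'g) cochain) set" where
  "cech_rel X F =
     {((\<U>, g), (\<V>, h)). (\<U>, g) \<in> cocycles X F \<and> (\<V>, h) \<in> cocycles X F \<and>
        (\<exists>\<W> \<tau> \<sigma>. open_cover X \<W> \<and> refines \<W> \<tau> \<U> \<and> refines \<W> \<sigma> \<V> \<and>
           cohomologous_on F \<W> (pullback F \<tau> g) (pullback F \<sigma> h))}"

definition cech_H1 :: "'x topology \<Rightarrow> ('x, 'g) group_presheaf \<Rightarrow> ('x, 'g) cochain set set" where
  "cech_H1 X F = cocycles X F // cech_rel X F"

definition cech_base :: "'x topology \<Rightarrow> ('x, 'g) group_presheaf \<Rightarrow> ('x, 'g) cochain set" where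
  "cech_base X F = cech_rel X F `` {({topspace X}, \<lambda>U V. \<one>\<^bsub>sections F (U \<inter> V)\<^esub>)}"

text \<open>
  The connecting map: \<open>local_lift X F N a \<U> \<alpha>\<close> says that the sections \<open>\<alpha> U\<close> of \<open>F\<close> lift the
  restrictions of the global section \<open>a\<close> of \<open>F / N\<close> to the members \<open>U\<close> of the cover. The image of
  \<open>a\<close> is the class of the cocycle \<open>\<alpha>\<^sub>U\<^sup>-\<^sup>1 \<alpha>\<^sub>V\<close>, which does not depend on the choice of the lifts.
\<close>

definition local_lift ::
  "'x topology \<Rightarrow> ('x, 'g) group_presheaf \<Rightarrow> ('x, 'g) group_presheaf \<Rightarrow>
   ('x \<Rightarrow> ('x set \<times> 'g) set) \<Rightarrow> 'x set set \<Rightarrow> ('x set \<Rightarrow> 'g) \<Rightarrow> bool" where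
  "local_lift X F N a \<U> \<alpha> \<longleftrightarrow> open_cover X \<U> \<and>
     (\<forall>U\<in>\<U>. \<alpha> U \<in> carrier (sections F U) \<and> (\<forall>x\<in>U. a x = quot_germ X F N x U (\<alpha> U)))"

definition lift_cocycle ::
  "('x, 'g) group_presheaf \<Rightarrow> ('x set \<Rightarrow> 'g) \<Rightarrow> 'x set \<Rightarrow> 'x set \<Rightarrow> 'g" where
  "lift_cocycle F \<alpha> U V =
     inv\<^bsub>sections F (U \<inter> V)\<^esub> (restr F U (U \<inter> V) (\<alpha> U)) \<otimes>\<^bsub>sections F (U \<inter> V)\<^esub>
     restr F V (U \<inter> V) (\<alpha> V)"

definition connecting_map ::
  "'x topology \<Rightarrow> ('x, 'g) group_presheaf \<Rightarrow> ('x, 'g) group_presheaf \<Rightarrow>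
   ('x \<Rightarrow> ('x set \<times> 'g) set) \<Rightarrow> ('x, 'g) cochain set" where
  "connecting_map X F N a =
     (THE c. \<exists>\<U> \<alpha>. local_lift X F N a \<U> \<alpha> \<and> c = cech_rel X N `` {(\<U>, lift_cocycle F \<alpha>)})"


section \<open>The boundary maps of a model\<close>

definition H0_A ::
  "'x cmanifold \<Rightarrow> ('x, 'e) vbundle \<Rightarrow> nat \<Rightarrow> ('x \<Rightarrow> ('x set \<times> ('x, 'e) ext_aut) set) set" where
  "H0_A M E k = quot_sections (mtop M) (G_sheaf M E k) (G_sheaf M E (k + 1)) (topspace (mtop M))"

definition H1_G ::
  "'x cmanifold \<Rightarrow> ('x, 'e) vbundle \<Rightarrow> nat \<Rightarrow> ('x, ('x, 'e) ext_aut) cochain set set" where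
  "H1_G M E k = cech_H1 (mtop M) (G_sheaf M E k)"

definition H1_G_base ::
  "'x cmanifold \<Rightarrow> ('x, 'e) vbundle \<Rightarrow> nat \<Rightarrow> ('x, ('x, 'e) ext_aut) cochain set" where
  "H1_G_base M E k = cech_base (mtop M) (G_sheaf M E k)"

text \<open>\<open>\<delta> M E k\<close> is the boundary map with values in \<^term>\<open>H1_G M E k\<close>, defined on
  \<^term>\<open>H0_A M E (k - 1)\<close>.\<close>

definition \<delta> ::
  "'x cmanifold \<Rightarrow> ('x, 'e) vbundle \<Rightarrow> nat \<Rightarrow>
   ('x \<Rightarrow> ('x set \<times> ('x, 'e) ext_aut) set) \<Rightarrow> ('x, ('x, 'e) ext_aut) cochain set" where
  "\<delta> M E k = connecting_map (mtop M) (G_sheaf M E (k - 1)) (G_sheaf M E k)"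

end

theory Submission
  imports Defs
begin

text \<open>
  Let \<open>k = 2l + 1\<close>. A section \<open>a\<close> of the quotient \<open>G\<^sub>k / G\<^sub>k\<^sub>+\<^sub>1\<close> lies in the kernel of the connecting
  map as soon as it has a global lift to \<open>G\<^sub>k\<close>: the difference to the global lift trivialises the
  cocycle of any family of local lifts (\<open>connecting_map_global_lift\<close>). For odd \<open>k\<close> every \<open>a\<close> has
  a canonical global lift.

  Let \<open>\<alpha> \<in> G\<^sub>k\<close> be a local lift of \<open>a\<close>. For a function \<open>f\<close> the difference \<open>\<alpha>(f) - f\<close> is even and lies in
  \<open>J\<^sup>k\<close>, hence in \<open>J\<^sup>k\<^sup>+\<^sup>1\<close> (\<open>aut_fun\<close>). For a section \<open>u\<close> of the bundle write
  \<open>\<alpha>(u) = u + \<phi>(u)\<close> modulo \<open>J\<^sup>k\<^sup>+\<^sup>1\<close> with \<open>\<phi>(u)\<close> of degree \<open>k\<close>. Since \<open>\<alpha>\<close> is linear over functions modulo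
  \<open>J\<^sup>k\<^sup>+\<^sup>1\<close>, the map \<open>\<phi>\<close> is given by linear maps \<open>\<phi>\<^sub>x\<close> from the fibre at \<open>x\<close> to its \<open>k\<close>-th exterior power
  (\<open>aut_vec_pointwise\<close>, \<open>gen_image_linear\<close>), and these depend on \<open>a\<close> only (\<open>gen_image_lift\<close>): two local
  lifts are congruent modulo \<open>J\<^sup>k\<^sup>+\<^sup>1\<close> (\<open>quotient_congruent\<close>).

  The element \<open>v + \<phi>\<^sub>x(v)\<close> of the exterior algebra is odd, so its square is zero (\<open>odd_square\<close>). By the universal
  property of the exterior algebra, \<open>v \<mapsto> v + \<phi>\<^sub>x(v)\<close> extends to an endomorphism of the algebra of the fibre
  (\<open>fibre_lift_cl\<close>). It differs from the identity by a map that raises the filtration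
  (\<open>fibre_lift_raises\<close>), and the filtration is finite (\<open>high_powers_vanish\<close>), so it is bijective.
  Acting fibre by fibre, these endomorphisms preserve holomorphy, because on generators they truncate
  a local lift (\<open>fibre_lift_vec_section\<close>). So they form a global section \<open>\<beta>\<close> of
  \<open>G\<^sub>k\<close> (\<open>global_lift_G\<close>). On functions and on sections of the bundle \<open>\<beta>\<close> agrees with each local lift \<open>\<alpha>\<close>
  modulo \<open>J\<^sup>k\<^sup>+\<^sup>1\<close>. These generate the algebra, so \<open>\<alpha>\<^sup>-\<^sup>1 \<beta>\<close> is in \<open>G\<^sub>k\<^sub>+\<^sub>1\<close> and \<open>\<beta>\<close> lifts \<open>a\<close>
  (\<open>aut_congruence\<close>, \<open>global_lift_germ\<close>).
\<close>

section \<open>Presheaves of groups and the connecting map\<close>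

lemma opens_trans: "V \<in> opens X U \<Longrightarrow> W \<in> opens X V \<Longrightarrow> W \<in> opens X U"
  by (auto simp: opens_def)

lemma opens_refl: "openin X U \<Longrightarrow> U \<in> opens X U"
  by (auto simp: opens_def)

locale presheaf_of_groups =
  fixes X :: "'x topology" and F :: "('x, 'g) group_presheaf"
  assumes group_sections: "openin X U \<Longrightarrow> group (sections F U)"
    and restr_hom: "\<lbrakk>openin X U; V \<in> opens X U\<rbrakk> \<Longrightarrow> restr F U V \<in> hom (sections F U) (sections F V)"
    and restr_id: "\<lbrakk>openin X U; g \<in> carrier (sections F U)\<rbrakk> \<Longrightarrow> restr F U U g = g"
    and restr_restr: "\<lbrakk>openin X U; V \<in> opens X U; W \<in> opens X V; g \<in> carrier (sections F U)\<rbrakk>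
      \<Longrightarrow> restr F V W (restr F U V g) = restr F U W g"
begin

lemma restr_closed:
  "\<lbrakk>openin X U; V \<in> opens X U; g \<in> carrier (sections F U)\<rbrakk> \<Longrightarrow> restr F U V g \<in> carrier (sections F V)"
  using restr_hom by (auto simp: hom_def)

lemma restr_mult:
  "\<lbrakk>openin X U; V \<in> opens X U; g \<in> carrier (sections F U); h \<in> carrier (sections F U)\<rbrakk> \<Longrightarrow>
    restr F U V (g \<otimes>\<^bsub>sections F U\<^esub> h) = restr F U V g \<otimes>\<^bsub>sections F V\<^esub> restr F U V h"
  using restr_hom by (auto simp: hom_def)

lemma restr_group_hom:
  "\<lbrakk>openin X U; V \<in> opens X U\<rbrakk> \<Longrightarrow> group_hom (sections F U) (sections F V) (restr F U V)"
  by (intro group_hom.intro group_hom_axioms.intro group_sections restr_hom)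
    (auto simp: opens_def)

lemma restr_one:
  "\<lbrakk>openin X U; V \<in> opens X U\<rbrakk> \<Longrightarrow> restr F U V \<one>\<^bsub>sections F U\<^esub> = \<one>\<^bsub>sections F V\<^esub>"
  by (rule group_hom.hom_one[OF restr_group_hom])

lemma restr_inv:
  "\<lbrakk>openin X U; V \<in> opens X U; g \<in> carrier (sections F U)\<rbrakk> \<Longrightarrow>
    restr F U V (inv\<^bsub>sections F U\<^esub> g) = inv\<^bsub>sections F V\<^esub> (restr F U V g)"
  by (rule group_hom.hom_inv[OF restr_group_hom])

lemma cocyclesD:
  assumes "(\<U>, g) \<in> cocycles X F"
  shows "open_cover X \<U>" and "\<lbrakk>U \<in> \<U>; V \<in> \<U>\<rbrakk> \<Longrightarrow> g U V \<in> carrier (sections F (U \<inter> V))"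
    and "\<lbrakk>U \<in> \<U>; V \<in> \<U>; W \<in> \<U>\<rbrakk> \<Longrightarrow>
      restr F (U \<inter> V) (U \<inter> V \<inter> W) (g U V) \<otimes>\<^bsub>sections F (U \<inter> V \<inter> W)\<^esub>
      restr F (V \<inter> W) (U \<inter> V \<inter> W) (g V W) = restr F (U \<inter> W) (U \<inter> V \<inter> W) (g U W)"
  using assms unfolding cocycles_def by auto

text \<open>Refinements produce open sets that are merely contained in a triple intersection of the
  cover, and the cocycle identity is needed there.\<close>

lemma cocycle_restr:
  assumes g: "(\<U>, g) \<in> cocycles X F" and UVW: "U \<in> \<U>" "V \<in> \<U>" "W \<in> \<U>"
    and D: "openin X D" "D \<subseteq> U \<inter> V \<inter> W"
  shows "restr F (U \<inter> V) D (g U V) \<otimes>\<^bsub>sections F D\<^esub> restr F (V \<inter> W) D (g V W)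
    = restr F (U \<inter> W) D (g U W)"
proof -
  let ?T = "U \<inter> V \<inter> W"
  have op: "openin X U" "openin X V" "openin X W"
    using cocyclesD(1)[OF g] UVW by (auto simp: open_cover_def)
  have T: "openin X ?T" "?T \<in> opens X (U \<inter> V)" "?T \<in> opens X (V \<inter> W)" "?T \<in> opens X (U \<inter> W)"
      "D \<in> opens X ?T"
    using op D by (auto simp: opens_def)
  have o2: "openin X (U \<inter> V)" "openin X (V \<inter> W)" "openin X (U \<inter> W)"
    using op by auto
  note c = cocyclesD(2)[OF g UVW(1,2)] cocyclesD(2)[OF g UVW(2,3)] cocyclesD(2)[OF g UVW(1,3)]
  have "restr F ?T D (restr F (U \<inter> V) ?T (g U V) \<otimes>\<^bsub>sections F ?T\<^esub> restr F (V \<inter> W) ?T (g V W))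
      = restr F ?T D (restr F (U \<inter> W) ?T (g U W))"
    using cocyclesD(3)[OF g UVW] by simp
  then show ?thesis
    using restr_mult[OF T(1,5) restr_closed[OF o2(1) T(2) c(1)] restr_closed[OF o2(2) T(3) c(2)]]
      restr_restr[OF o2(1) T(2,5) c(1)] restr_restr[OF o2(2) T(3,5) c(2)]
      restr_restr[OF o2(3) T(4,5) c(3)] by simp
qed

lemma refines_sub: "refines \<W> \<tau> \<U> \<Longrightarrow> W \<in> \<W> \<Longrightarrow> \<tau> W \<in> \<U> \<and> W \<subseteq> \<tau> W"
  by (auto simp: refines_def)

lemma pullback_closed:
  assumes g: "(\<U>, g) \<in> cocycles X F" and r: "refines \<W> \<tau> \<U>" and W: "open_cover X \<W>"
    and AB: "A \<in> \<W>" "B \<in> \<W>"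
  shows "pullback F \<tau> g A B \<in> carrier (sections F (A \<inter> B))"
  unfolding pullback_def
proof (rule restr_closed)
  show "g (\<tau> A) (\<tau> B) \<in> carrier (sections F (\<tau> A \<inter> \<tau> B))"
    using cocyclesD(2)[OF g] refines_sub[OF r] AB by blast
  show "openin X (\<tau> A \<inter> \<tau> B)"
    using cocyclesD(1)[OF g] refines_sub[OF r] AB by (auto simp: open_cover_def)
  show "A \<inter> B \<in> opens X (\<tau> A \<inter> \<tau> B)"
    using W refines_sub[OF r] AB by (auto simp: opens_def open_cover_def)
qed

lemma cohomologous_sym:
  assumes W: "open_cover X \<W>"
    and g: "\<And>A B. A \<in> \<W> \<Longrightarrow> B \<in> \<W> \<Longrightarrow> g A B \<in> carrier (sections F (A \<inter> B))"
    and c: "cohomologous_on F \<W> g g'"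
  shows "cohomologous_on F \<W> g' g"
proof -
  obtain h where h: "\<And>A. A \<in> \<W> \<Longrightarrow> h A \<in> carrier (sections F A)"
    and eq: "\<And>A B. A \<in> \<W> \<Longrightarrow> B \<in> \<W> \<Longrightarrow> g' A B =
      inv\<^bsub>sections F (A \<inter> B)\<^esub> (restr F A (A \<inter> B) (h A)) \<otimes>\<^bsub>sections F (A \<inter> B)\<^esub> g A B
        \<otimes>\<^bsub>sections F (A \<inter> B)\<^esub> restr F B (A \<inter> B) (h B)"
    using c unfolding cohomologous_on_def by blast
  show ?thesis
    unfolding cohomologous_on_def
  proof (intro exI[of _ "\<lambda>A. inv\<^bsub>sections F A\<^esub> h A"] conjI ballI)
    fix A assume A: "A \<in> \<W>"
    then have "openin X A" using W by (auto simp: open_cover_def)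
    then show "inv\<^bsub>sections F A\<^esub> h A \<in> carrier (sections F A)"
      using group.inv_closed[OF group_sections h[OF A]] by blast
  next
    fix A B assume A: "A \<in> \<W>" and B: "B \<in> \<W>"
    have o: "openin X A" "openin X B" "openin X (A \<inter> B)" using W A B by (auto simp: open_cover_def)
    have s: "A \<inter> B \<in> opens X A" "A \<inter> B \<in> opens X B" using o by (auto simp: opens_def)
    interpret G: group "sections F (A \<inter> B)" by (rule group_sections[OF o(3)])
    note m = restr_closed[OF o(1) s(1) h[OF A]] restr_closed[OF o(2) s(2) h[OF B]] g[OF A B]
    show "g A B = inv\<^bsub>sections F (A \<inter> B)\<^esub> (restr F A (A \<inter> B) (inv\<^bsub>sections F A\<^esub> h A))
        \<otimes>\<^bsub>sections F (A \<inter> B)\<^esub> g' A B \<otimes>\<^bsub>sections F (A \<inter> B)\<^esub> restr F B (A \<inter> B) (inv\<^bsub>sections F B\<^esub> h B)"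
      using m by (simp add: restr_inv[OF o(1) s(1) h[OF A]] restr_inv[OF o(2) s(2) h[OF B]]
          eq[OF A B] G.m_assoc[symmetric]) (simp add: G.m_assoc)
  qed
qed

lemma cohomologous_trans:
  assumes W: "open_cover X \<W>"
    and g: "\<And>A B. A \<in> \<W> \<Longrightarrow> B \<in> \<W> \<Longrightarrow> g A B \<in> carrier (sections F (A \<inter> B))"
    and c: "cohomologous_on F \<W> g g'" and d: "cohomologous_on F \<W> g' g''"
  shows "cohomologous_on F \<W> g g''"
proof -
  obtain h where h: "\<And>A. A \<in> \<W> \<Longrightarrow> h A \<in> carrier (sections F A)"
    and eq: "\<And>A B. A \<in> \<W> \<Longrightarrow> B \<in> \<W> \<Longrightarrow> g' A B =
      inv\<^bsub>sections F (A \<inter> B)\<^esub> (restr F A (A \<inter> B) (h A)) \<otimes>\<^bsub>sections F (A \<inter> B)\<^esub> g A B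
        \<otimes>\<^bsub>sections F (A \<inter> B)\<^esub> restr F B (A \<inter> B) (h B)"
    using c unfolding cohomologous_on_def by blast
  obtain h' where h': "\<And>A. A \<in> \<W> \<Longrightarrow> h' A \<in> carrier (sections F A)"
    and eq': "\<And>A B. A \<in> \<W> \<Longrightarrow> B \<in> \<W> \<Longrightarrow> g'' A B =
      inv\<^bsub>sections F (A \<inter> B)\<^esub> (restr F A (A \<inter> B) (h' A)) \<otimes>\<^bsub>sections F (A \<inter> B)\<^esub> g' A B
        \<otimes>\<^bsub>sections F (A \<inter> B)\<^esub> restr F B (A \<inter> B) (h' B)"
    using d unfolding cohomologous_on_def by blast
  show ?thesis
    unfolding cohomologous_on_def
  proof (intro exI[of _ "\<lambda>A. h A \<otimes>\<^bsub>sections F A\<^esub> h' A"] conjI ballI)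
    fix A assume A: "A \<in> \<W>"
    then have o: "openin X A" using W by (auto simp: open_cover_def)
    interpret G: group "sections F A" by (rule group_sections[OF o])
    show "h A \<otimes>\<^bsub>sections F A\<^esub> h' A \<in> carrier (sections F A)"
      using h[OF A] h'[OF A] by simp
  next
    fix A B assume A: "A \<in> \<W>" and B: "B \<in> \<W>"
    have o: "openin X A" "openin X B" "openin X (A \<inter> B)" using W A B by (auto simp: open_cover_def)
    have s: "A \<inter> B \<in> opens X A" "A \<inter> B \<in> opens X B" using o by (auto simp: opens_def)
    interpret G: group "sections F (A \<inter> B)" by (rule group_sections[OF o(3)])
    note m = restr_closed[OF o(1) s(1) h[OF A]] restr_closed[OF o(2) s(2) h[OF B]]
      restr_closed[OF o(1) s(1) h'[OF A]] restr_closed[OF o(2) s(2) h'[OF B]] g[OF A B]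
    show "g'' A B = inv\<^bsub>sections F (A \<inter> B)\<^esub> (restr F A (A \<inter> B) (h A \<otimes>\<^bsub>sections F A\<^esub> h' A))
        \<otimes>\<^bsub>sections F (A \<inter> B)\<^esub> g A B \<otimes>\<^bsub>sections F (A \<inter> B)\<^esub> restr F B (A \<inter> B) (h B \<otimes>\<^bsub>sections F B\<^esub> h' B)"
      using m by (simp add: restr_mult[OF o(1) s(1) h[OF A] h'[OF A]]
          restr_mult[OF o(2) s(2) h[OF B] h'[OF B]] eq[OF A B] eq'[OF A B] G.inv_mult_group G.m_assoc)
  qed
qed

text \<open>Two refinement maps into the cover of a cocycle give cohomologous pullbacks: the cocycle
  itself, evaluated at the two images of a member of the finer cover, is the coboundary between
  them.\<close>

lemma pullback_cohomologous:
  assumes g: "(\<U>, g) \<in> cocycles X F" and W: "open_cover X \<W>"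
    and r: "refines \<W> \<tau> \<U>" and r': "refines \<W> \<sigma> \<U>"
  shows "cohomologous_on F \<W> (pullback F \<tau> g) (pullback F \<sigma> g)"
  unfolding cohomologous_on_def
proof (intro exI[of _ "\<lambda>A. restr F (\<tau> A \<inter> \<sigma> A) A (g (\<tau> A) (\<sigma> A))"] conjI ballI)
  have U: "\<And>U. U \<in> \<U> \<Longrightarrow> openin X U" using cocyclesD(1)[OF g] by (auto simp: open_cover_def)
  have oW: "\<And>A. A \<in> \<W> \<Longrightarrow> openin X A" using W by (auto simp: open_cover_def)
  have sub: "\<tau> A \<in> \<U>" "\<sigma> A \<in> \<U>" "A \<in> opens X (\<tau> A \<inter> \<sigma> A)" if "A \<in> \<W>" for A
    using that refines_sub[OF r] refines_sub[OF r'] oW by (auto simp: opens_def)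
  show "restr F (\<tau> A \<inter> \<sigma> A) A (g (\<tau> A) (\<sigma> A)) \<in> carrier (sections F A)" if A: "A \<in> \<W>" for A
    using sub[OF A] U by (intro restr_closed cocyclesD(2)[OF g]) auto
  fix A B assume A: "A \<in> \<W>" and B: "B \<in> \<W>"
  let ?D = "A \<inter> B" and ?G = "sections F (A \<inter> B)"
  have o: "openin X A" "openin X B" "openin X ?D" using oW A B by auto
  interpret G: group ?G by (rule group_sections[OF o(3)])
  define r2 where "r2 P Q = restr F (P \<inter> Q) ?D (g P Q)" for P Q
  have T: "\<tau> A \<in> \<U>" "\<tau> B \<in> \<U>" "\<sigma> A \<in> \<U>" "\<sigma> B \<in> \<U>" using sub A B by auto
  have D: "?D \<subseteq> \<tau> A" "?D \<subseteq> \<tau> B" "?D \<subseteq> \<sigma> A" "?D \<subseteq> \<sigma> B"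
    using refines_sub[OF r] refines_sub[OF r'] A B by blast+
  have cl: "r2 P Q \<in> carrier ?G" if "P \<in> \<U>" "Q \<in> \<U>" "?D \<subseteq> P" "?D \<subseteq> Q" for P Q
    unfolding r2_def using that U o by (intro restr_closed cocyclesD(2)[OF g]) (auto simp: opens_def)
  have co: "r2 P Q \<otimes>\<^bsub>?G\<^esub> r2 Q R = r2 P R"
    if "P \<in> \<U>" "Q \<in> \<U>" "R \<in> \<U>" "?D \<subseteq> P" "?D \<subseteq> Q" "?D \<subseteq> R" for P Q R
    unfolding r2_def using cocycle_restr[OF g that(1-3) o(3)] that by blast
  have hA: "restr F A ?D (restr F (\<tau> A \<inter> \<sigma> A) A (g (\<tau> A) (\<sigma> A))) = r2 (\<tau> A) (\<sigma> A)"
    unfolding r2_def using sub[OF A] U o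
    by (intro restr_restr cocyclesD(2)[OF g]) (auto simp: opens_def)
  have hB: "restr F B ?D (restr F (\<tau> B \<inter> \<sigma> B) B (g (\<tau> B) (\<sigma> B))) = r2 (\<tau> B) (\<sigma> B)"
    unfolding r2_def using sub[OF B] U o
    by (intro restr_restr cocyclesD(2)[OF g]) (auto simp: opens_def)
  have "r2 (\<tau> A) (\<tau> B) \<otimes>\<^bsub>?G\<^esub> r2 (\<tau> B) (\<sigma> B) = r2 (\<tau> A) (\<sigma> A) \<otimes>\<^bsub>?G\<^esub> r2 (\<sigma> A) (\<sigma> B)"
    using co T D by simp
  then have "r2 (\<sigma> A) (\<sigma> B) = inv\<^bsub>?G\<^esub> r2 (\<tau> A) (\<sigma> A) \<otimes>\<^bsub>?G\<^esub> r2 (\<tau> A) (\<tau> B) \<otimes>\<^bsub>?G\<^esub> r2 (\<tau> B) (\<sigma> B)"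
    using cl T D by (simp add: G.m_assoc G.inv_solve_left)
  then show "pullback F \<sigma> g A B =
      inv\<^bsub>?G\<^esub> (restr F A ?D (restr F (\<tau> A \<inter> \<sigma> A) A (g (\<tau> A) (\<sigma> A)))) \<otimes>\<^bsub>?G\<^esub> pullback F \<tau> g A B
        \<otimes>\<^bsub>?G\<^esub> restr F B ?D (restr F (\<tau> B \<inter> \<sigma> B) B (g (\<tau> B) (\<sigma> B)))"
    unfolding hA hB by (simp add: pullback_def r2_def)
qed

lemma pullback_pullback:
  assumes g: "(\<U>, g) \<in> cocycles X F" and W: "open_cover X \<W>" and W': "open_cover X \<W>'"
    and r: "refines \<W> \<tau> \<U>" and r': "refines \<W>' \<rho> \<W>" and AB: "A \<in> \<W>'" "B \<in> \<W>'"
  shows "pullback F \<rho> (pullback F \<tau> g) A B = pullback F (\<tau> \<circ> \<rho>) g A B"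
proof -
  note \<rho> = refines_sub[OF r' AB(1)] refines_sub[OF r' AB(2)]
  note \<tau> = refines_sub[OF r \<rho>(1)[THEN conjunct1]] refines_sub[OF r \<rho>(2)[THEN conjunct1]]
  have "openin X (\<tau> (\<rho> A) \<inter> \<tau> (\<rho> B))"
    using cocyclesD(1)[OF g] \<tau> by (auto simp: open_cover_def)
  moreover have "\<rho> A \<inter> \<rho> B \<in> opens X (\<tau> (\<rho> A) \<inter> \<tau> (\<rho> B))"
    using W \<rho> \<tau> by (auto simp: opens_def open_cover_def)
  moreover have "A \<inter> B \<in> opens X (\<rho> A \<inter> \<rho> B)"
    using W' \<rho> AB by (auto simp: opens_def open_cover_def)
  moreover have "g (\<tau> (\<rho> A)) (\<tau> (\<rho> B)) \<in> carrier (sections F (\<tau> (\<rho> A) \<inter> \<tau> (\<rho> B)))"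
    using cocyclesD(2)[OF g] \<tau> by blast
  ultimately show ?thesis
    unfolding pullback_def o_def by (rule restr_restr)
qed

lemma cohomologous_pullback:
  assumes W: "open_cover X \<W>" and W': "open_cover X \<W>'" and r: "refines \<W>' \<rho> \<W>"
    and g: "\<And>A B. A \<in> \<W> \<Longrightarrow> B \<in> \<W> \<Longrightarrow> g A B \<in> carrier (sections F (A \<inter> B))"
    and c: "cohomologous_on F \<W> g g'"
  shows "cohomologous_on F \<W>' (pullback F \<rho> g) (pullback F \<rho> g')"
proof -
  obtain h where h: "\<And>A. A \<in> \<W> \<Longrightarrow> h A \<in> carrier (sections F A)"
    and eq: "\<And>A B. A \<in> \<W> \<Longrightarrow> B \<in> \<W> \<Longrightarrow> g' A B =
      inv\<^bsub>sections F (A \<inter> B)\<^esub> (restr F A (A \<inter> B) (h A)) \<otimes>\<^bsub>sections F (A \<inter> B)\<^esub> g A B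
        \<otimes>\<^bsub>sections F (A \<inter> B)\<^esub> restr F B (A \<inter> B) (h B)"
    using c unfolding cohomologous_on_def by blast
  have oW: "\<And>A. A \<in> \<W> \<Longrightarrow> openin X A" "\<And>A. A \<in> \<W>' \<Longrightarrow> openin X A"
    using W W' by (auto simp: open_cover_def)
  have sub: "\<rho> A \<in> \<W>" "A \<in> opens X (\<rho> A)" if "A \<in> \<W>'" for A
    using that refines_sub[OF r] oW by (auto simp: opens_def)
  show ?thesis
    unfolding cohomologous_on_def
  proof (intro exI[of _ "\<lambda>A. restr F (\<rho> A) A (h (\<rho> A))"] conjI ballI)
    show "restr F (\<rho> A) A (h (\<rho> A)) \<in> carrier (sections F A)" if "A \<in> \<W>'" for A
      using sub[OF that] oW by (intro restr_closed h) auto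
    fix A B assume A: "A \<in> \<W>'" and B: "B \<in> \<W>'"
    let ?D = "A \<inter> B" and ?R = "\<rho> A \<inter> \<rho> B"
    have o: "openin X (\<rho> A)" "openin X (\<rho> B)" "openin X ?R" "openin X A" "openin X B" "openin X ?D"
      using sub A B oW by auto
    have s: "?R \<in> opens X (\<rho> A)" "?R \<in> opens X (\<rho> B)" "?D \<in> opens X ?R" "?D \<in> opens X A" "?D \<in> opens X B"
      using sub[OF A] sub[OF B] o by (auto simp: opens_def)
    interpret R: group "sections F ?R" by (rule group_sections[OF o(3)])
    note hc = h[OF sub(1)[OF A]] h[OF sub(1)[OF B]]
    note gc = g[OF sub(1)[OF A] sub(1)[OF B]]
    note m = restr_closed[OF o(1) s(1) hc(1)] restr_closed[OF o(2) s(2) hc(2)]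
    have "pullback F \<rho> g' A B = restr F ?R ?D (inv\<^bsub>sections F ?R\<^esub> (restr F (\<rho> A) ?R (h (\<rho> A)))
        \<otimes>\<^bsub>sections F ?R\<^esub> g (\<rho> A) (\<rho> B) \<otimes>\<^bsub>sections F ?R\<^esub> restr F (\<rho> B) ?R (h (\<rho> B)))"
      unfolding pullback_def using eq[OF sub(1)[OF A] sub(1)[OF B]] by simp
    also have "\<dots> = inv\<^bsub>sections F ?D\<^esub> (restr F (\<rho> A) ?D (h (\<rho> A))) \<otimes>\<^bsub>sections F ?D\<^esub>
        pullback F \<rho> g A B \<otimes>\<^bsub>sections F ?D\<^esub> restr F (\<rho> B) ?D (h (\<rho> B))"
      unfolding pullback_def using m gc
      by (simp add: restr_mult[OF o(3) s(3)] restr_inv[OF o(3) s(3)]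
          restr_restr[OF o(1) s(1) s(3) hc(1)] restr_restr[OF o(2) s(2) s(3) hc(2)])
    finally show "pullback F \<rho> g' A B = inv\<^bsub>sections F ?D\<^esub> (restr F A ?D (restr F (\<rho> A) A (h (\<rho> A))))
        \<otimes>\<^bsub>sections F ?D\<^esub> pullback F \<rho> g A B \<otimes>\<^bsub>sections F ?D\<^esub> restr F B ?D (restr F (\<rho> B) B (h (\<rho> B)))"
      by (simp add: restr_restr[OF o(1) sub(2)[OF A] s(4) hc(1)]
          restr_restr[OF o(2) sub(2)[OF B] s(5) hc(2)])
  qed
qed

lemma cohomologous_cong:
  assumes "\<And>A B. A \<in> \<W> \<Longrightarrow> B \<in> \<W> \<Longrightarrow> g A B = f A B" "\<And>A B. A \<in> \<W> \<Longrightarrow> B \<in> \<W> \<Longrightarrow> g' A B = f' A B"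
    and "cohomologous_on F \<W> g g'"
  shows "cohomologous_on F \<W> f f'"
  using assms unfolding cohomologous_on_def by simp

lemma sym_cech_rel: "sym (cech_rel X F)"
proof (rule symI)
  fix c d assume cd: "(c, d) \<in> cech_rel X F"
  obtain \<U> g \<V> h where [simp]: "c = (\<U>, g)" "d = (\<V>, h)" by (cases c, cases d)
  obtain \<W> \<tau> \<sigma> where *: "(\<U>, g) \<in> cocycles X F" "(\<V>, h) \<in> cocycles X F" "open_cover X \<W>"
      "refines \<W> \<tau> \<U>" "refines \<W> \<sigma> \<V>" "cohomologous_on F \<W> (pullback F \<tau> g) (pullback F \<sigma> h)"
    using cd by (auto simp: cech_rel_def)
  have "cohomologous_on F \<W> (pullback F \<sigma> h) (pullback F \<tau> g)"
    by (rule cohomologous_sym[OF *(3) pullback_closed[OF *(1,4,3)] *(6)])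
  with * show "(d, c) \<in> cech_rel X F" by (auto simp: cech_rel_def)
qed

text \<open>Two refinements of the middle cover have a common refinement, on which the two pullbacks of
  the middle cocycle are cohomologous.\<close>

lemma trans_cech_rel: "trans (cech_rel X F)"
proof (rule transI)
  fix c d e assume cd: "(c, d) \<in> cech_rel X F" and de: "(d, e) \<in> cech_rel X F"
  obtain \<U> g \<V> h \<S> k where [simp]: "c = (\<U>, g)" "d = (\<V>, h)" "e = (\<S>, k)"
    by (cases c, cases d, cases e)
  obtain \<W> \<tau> \<sigma> where 1: "(\<U>, g) \<in> cocycles X F" "(\<V>, h) \<in> cocycles X F" "open_cover X \<W>"
      "refines \<W> \<tau> \<U>" "refines \<W> \<sigma> \<V>" "cohomologous_on F \<W> (pullback F \<tau> g) (pullback F \<sigma> h)"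
    using cd by (auto simp: cech_rel_def)
  obtain \<W>' \<tau>' \<sigma>' where 2: "(\<S>, k) \<in> cocycles X F" "open_cover X \<W>'"
      "refines \<W>' \<tau>' \<V>" "refines \<W>' \<sigma>' \<S>" "cohomologous_on F \<W>' (pullback F \<tau>' h) (pullback F \<sigma>' k)"
    using de by (auto simp: cech_rel_def)
  define \<D> where "\<D> = {A \<inter> B | A B. A \<in> \<W> \<and> B \<in> \<W>'}"
  have "\<exists>p. fst p \<in> \<W> \<and> D \<subseteq> fst p \<and> snd p \<in> \<W>' \<and> D \<subseteq> snd p" if D: "D \<in> \<D>" for D
  proof -
    obtain A B where "D = A \<inter> B" "A \<in> \<W>" "B \<in> \<W>'" using D unfolding \<D>_def by blast
    then show ?thesis by (intro exI[of _ "(A, B)"]) simp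
  qed
  then obtain p where p: "\<And>D. D \<in> \<D> \<Longrightarrow> fst (p D) \<in> \<W> \<and> D \<subseteq> fst (p D) \<and> snd (p D) \<in> \<W>' \<and> D \<subseteq> snd (p D)"
    by metis
  define \<rho> \<rho>' where "\<rho> = fst \<circ> p" and "\<rho>' = snd \<circ> p"
  have r: "refines \<D> \<rho> \<W>" "refines \<D> \<rho>' \<W>'"
    using p by (auto simp: refines_def \<rho>_def \<rho>'_def)
  have D: "open_cover X \<D>"
  proof -
    have "\<Union>\<D> = \<Union>\<W> \<inter> \<Union>\<W>'" unfolding \<D>_def by blast
    moreover have "openin X D" if "D \<in> \<D>" for D
      using that 1(3) 2(2) unfolding open_cover_def \<D>_def by blast
    ultimately show ?thesis using 1(3) 2(2) unfolding open_cover_def by simp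
  qed
  have rr: "refines \<D> (\<tau> \<circ> \<rho>) \<U>" "refines \<D> (\<sigma> \<circ> \<rho>) \<V>" "refines \<D> (\<tau>' \<circ> \<rho>') \<V>" "refines \<D> (\<sigma>' \<circ> \<rho>') \<S>"
    using r 1(4,5) 2(3,4) unfolding refines_def o_def by (meson order_trans)+
  have "cohomologous_on F \<D> (pullback F \<rho> (pullback F \<tau> g)) (pullback F \<rho> (pullback F \<sigma> h))"
    by (rule cohomologous_pullback[OF 1(3) D r(1) pullback_closed[OF 1(1,4,3)] 1(6)])
  then have a: "cohomologous_on F \<D> (pullback F (\<tau> \<circ> \<rho>) g) (pullback F (\<sigma> \<circ> \<rho>) h)"
    by (rule cohomologous_cong[rotated 2])
      (rule pullback_pullback[OF 1(1,3) D 1(4) r(1)] pullback_pullback[OF 1(2,3) D 1(5) r(1)]; assumption)+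
  have "cohomologous_on F \<D> (pullback F \<rho>' (pullback F \<tau>' h)) (pullback F \<rho>' (pullback F \<sigma>' k))"
    by (rule cohomologous_pullback[OF 2(2) D r(2) pullback_closed[OF 1(2) 2(3,2)] 2(5)])
  then have b: "cohomologous_on F \<D> (pullback F (\<tau>' \<circ> \<rho>') h) (pullback F (\<sigma>' \<circ> \<rho>') k)"
    by (rule cohomologous_cong[rotated 2])
      (rule pullback_pullback[OF 1(2) 2(2) D 2(3) r(2)] pullback_pullback[OF 2(1,2) D 2(4) r(2)]; assumption)+
  have m: "cohomologous_on F \<D> (pullback F (\<sigma> \<circ> \<rho>) h) (pullback F (\<tau>' \<circ> \<rho>') h)"
    by (rule pullback_cohomologous[OF 1(2) D rr(2,3)])
  have "cohomologous_on F \<D> (pullback F (\<tau> \<circ> \<rho>) g) (pullback F (\<sigma>' \<circ> \<rho>') k)"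
    using cohomologous_trans[OF D pullback_closed[OF 1(1) rr(1) D]
        cohomologous_trans[OF D pullback_closed[OF 1(1) rr(1) D] a m] b] by simp
  then have "\<exists>\<W> \<tau> \<sigma>. open_cover X \<W> \<and> refines \<W> \<tau> \<U> \<and> refines \<W> \<sigma> \<S> \<and>
      cohomologous_on F \<W> (pullback F \<tau> g) (pullback F \<sigma> k)"
    using D rr(1,4) by meson
  then show "(c, e) \<in> cech_rel X F"
    unfolding cech_rel_def using 1(1) 2(1) by simp
qed

lemma base_cocycle: "({topspace X}, \<lambda>U V. \<one>\<^bsub>sections F (U \<inter> V)\<^esub>) \<in> cocycles X F"
proof -
  have o: "openin X (topspace X)" by simp
  interpret G: group "sections F (topspace X)" by (rule group_sections[OF o])
  show ?thesis
    using restr_one[OF o opens_refl[OF o]] by (auto simp: cocycles_def open_cover_def)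
qed

lemma cech_base_in_H1: "cech_base X F \<in> cech_H1 X F"
  unfolding cech_base_def cech_H1_def by (rule quotientI[OF base_cocycle])

end

text \<open>The assumption \<open>local_N\<close> is the sheaf property behind the connecting map: it makes two sections of
  \<open>F\<close> with the same germs in \<open>F / N\<close> differ by a section of \<open>N\<close>.\<close>

locale subpresheaf_of_groups = F: presheaf_of_groups X F
  for X :: "'x topology" and F :: "('x, 'g) group_presheaf" +
  fixes N :: "('x, 'g) group_presheaf"
  assumes subgroup_N: "openin X U \<Longrightarrow> subgroup (carrier (sections N U)) (sections F U)"
    and sections_N: "openin X U \<Longrightarrow> sections N U = (sections F U)\<lparr>carrier := carrier (sections N U)\<rparr>"
    and restr_N: "restr N = restr F"
    and restr_closed_N: "\<lbrakk>openin X U; V \<in> opens X U; g \<in> carrier (sections N U)\<rbrakk>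
      \<Longrightarrow> restr F U V g \<in> carrier (sections N V)"
    and local_N: "\<lbrakk>openin X U; g \<in> carrier (sections F U);
      \<And>x. x \<in> U \<Longrightarrow> \<exists>W\<in>opens X U. x \<in> W \<and> restr F U W g \<in> carrier (sections N W)\<rbrakk>
      \<Longrightarrow> g \<in> carrier (sections N U)"
begin

lemma N_sub: "openin X U \<Longrightarrow> g \<in> carrier (sections N U) \<Longrightarrow> g \<in> carrier (sections F U)"
  using subgroup.subset[OF subgroup_N] by blast

lemma mult_N: "openin X U \<Longrightarrow> mult (sections N U) = mult (sections F U)"
  by (subst sections_N) auto

lemma one_N: "openin X U \<Longrightarrow> one (sections N U) = one (sections F U)"
  by (subst sections_N) auto

lemma inv_N:
  assumes "openin X U" "g \<in> carrier (sections N U)"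
  shows "inv\<^bsub>sections N U\<^esub> g = inv\<^bsub>sections F U\<^esub> g"
  by (subst sections_N[OF assms(1)])
    (rule group.m_inv_consistent[OF F.group_sections[OF assms(1)] subgroup_N[OF assms(1)] assms(2)])

sublocale N: presheaf_of_groups X N
proof (rule presheaf_of_groups.intro, goal_cases)
  case (1 U)
  then show ?case
    using subgroup.subgroup_is_group[OF subgroup_N[OF 1] F.group_sections[OF 1]]
      sections_N[OF 1] by simp
next
  case (2 U V)
  then have "openin X V" by (simp add: opens_def)
  with 2 show ?case
    using restr_closed_N[OF 2] F.restr_mult[OF 2 N_sub N_sub]
    by (auto simp: hom_def restr_N mult_N)
next
  case (3 U g)
  then show ?case using F.restr_id[OF 3(1) N_sub] by (simp add: restr_N)
next
  case (4 U V W g)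
  then show ?case using F.restr_restr[OF 4(1-3) N_sub] by (simp add: restr_N)
qed

lemma quot_germ_self:
  assumes U: "openin X U" and a: "\<alpha> \<in> carrier (sections F U)" and x: "x \<in> U"
  shows "(U, \<alpha>) \<in> quot_germ X F N x U \<alpha>"
proof -
  interpret G: group "sections F U" by (rule F.group_sections[OF U])
  have "\<one>\<^bsub>sections F U\<^esub> \<in> carrier (sections N U)"
    by (rule subgroup.one_closed[OF subgroup_N[OF U]])
  then show ?thesis
    using a x U F.restr_id[OF U a] by (auto simp: quot_germ_def intro!: bexI[of _ U] opens_refl)
qed

text \<open>If \<open>\<alpha>\<^sup>-\<^sup>1 \<beta>\<close> and \<open>\<beta>\<^sup>-\<^sup>1 \<gamma>\<close> are in \<open>N\<close> near \<open>x\<close>, then so is their product \<open>\<alpha>\<^sup>-\<^sup>1 \<gamma>\<close>.\<close>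

lemma quot_germ_subset:
  assumes U: "openin X U" and V: "openin X V"
    and a: "\<alpha> \<in> carrier (sections F U)" and b: "\<beta> \<in> carrier (sections F V)"
    and W: "W \<in> opens X (U \<inter> V)" "x \<in> W"
    and N: "inv\<^bsub>sections F W\<^esub> (restr F U W \<alpha>) \<otimes>\<^bsub>sections F W\<^esub> restr F V W \<beta> \<in> carrier (sections N W)"
  shows "quot_germ X F N x V \<beta> \<subseteq> quot_germ X F N x U \<alpha>"
proof (clarsimp simp: quot_germ_def, goal_cases)
  case (1 S \<gamma> T)
  define D where "D = W \<inter> T"
  have o: "openin X W" "openin X T" "openin X D"
    using W 1 by (auto simp: opens_def D_def)
  have s: "W \<in> opens X U" "W \<in> opens X V" "T \<in> opens X V" "T \<in> opens X S"
      "D \<in> opens X W" "D \<in> opens X T" "D \<in> opens X (U \<inter> S)"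
    using W(1) 1 by (auto simp: opens_def D_def)
  interpret GW: group "sections F W" by (rule F.group_sections[OF o(1)])
  interpret GT: group "sections F T" by (rule F.group_sections[OF o(2)])
  interpret GD: group "sections F D" by (rule F.group_sections[OF o(3)])
  note c = F.restr_closed[OF U s(1) a] F.restr_closed[OF V s(2) b] F.restr_closed[OF V s(3) b]
    F.restr_closed[OF 1(1) s(4) 1(3)]
  have 2: "inv\<^bsub>sections F D\<^esub> (restr F U D \<alpha>) \<otimes>\<^bsub>sections F D\<^esub> restr F V D \<beta> \<in> carrier (sections N D)"
    using restr_closed_N[OF o(1) s(5) N] c
    by (simp add: F.restr_mult[OF o(1) s(5)] F.restr_inv[OF o(1) s(5)]
        F.restr_restr[OF U s(1,5) a] F.restr_restr[OF V s(2,5) b])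
  have 3: "inv\<^bsub>sections F D\<^esub> (restr F V D \<beta>) \<otimes>\<^bsub>sections F D\<^esub> restr F S D \<gamma> \<in> carrier (sections N D)"
    using restr_closed_N[OF o(2) s(6) 1(6)] c
    by (simp add: F.restr_mult[OF o(2) s(6)] F.restr_inv[OF o(2) s(6)]
        F.restr_restr[OF V s(3,6) b] F.restr_restr[OF 1(1) s(4,6) 1(3)])
  have d: "restr F U D \<alpha> \<in> carrier (sections F D)" "restr F V D \<beta> \<in> carrier (sections F D)"
      "restr F S D \<gamma> \<in> carrier (sections F D)"
    using F.restr_closed[OF U opens_trans[OF s(1,5)] a] F.restr_closed[OF V opens_trans[OF s(2,5)] b]
      F.restr_closed[OF 1(1) opens_trans[OF s(4,6)] 1(3)] by auto
  have "inv\<^bsub>sections F D\<^esub> (restr F U D \<alpha>) \<otimes>\<^bsub>sections F D\<^esub> restr F S D \<gamma> \<in> carrier (sections N D)"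
    using subgroup.m_closed[OF subgroup_N[OF o(3)] 2 3] d by (simp add: GD.m_assoc GD.inv_solve_left
        GD.m_assoc[of "restr F V D \<beta>", symmetric])
  moreover have "x \<in> D" using W(2) 1 by (simp add: D_def)
  ultimately show ?case using s(7) by blast
qed

lemma quot_germ_eqI:
  assumes U: "openin X U" and V: "openin X V"
    and a: "\<alpha> \<in> carrier (sections F U)" and b: "\<beta> \<in> carrier (sections F V)"
    and W: "W \<in> opens X (U \<inter> V)" "x \<in> W"
    and N: "inv\<^bsub>sections F W\<^esub> (restr F U W \<alpha>) \<otimes>\<^bsub>sections F W\<^esub> restr F V W \<beta> \<in> carrier (sections N W)"
  shows "quot_germ X F N x U \<alpha> = quot_germ X F N x V \<beta>"
proof
  have o: "openin X W" "W \<in> opens X U" "W \<in> opens X V" "W \<in> opens X (V \<inter> U)"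
    using W by (auto simp: opens_def)
  interpret GW: group "sections F W" by (rule F.group_sections[OF o(1)])
  have "inv\<^bsub>sections F W\<^esub> (restr F V W \<beta>) \<otimes>\<^bsub>sections F W\<^esub> restr F U W \<alpha> \<in> carrier (sections N W)"
    using subgroup.m_inv_closed[OF subgroup_N[OF o(1)] N] F.restr_closed[OF U o(2) a]
      F.restr_closed[OF V o(3) b] by (simp add: GW.inv_mult_group)
  then show "quot_germ X F N x U \<alpha> \<subseteq> quot_germ X F N x V \<beta>"
    by (rule quot_germ_subset[OF V U b a o(4) W(2)])
qed (rule quot_germ_subset[OF assms])

lemma quot_germ_eqD:
  assumes U: "openin X U" and V: "openin X V"
    and b: "\<beta> \<in> carrier (sections F V)" and x: "x \<in> V"
    and eq: "quot_germ X F N x U \<alpha> = quot_germ X F N x V \<beta>"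
  shows "\<exists>W\<in>opens X (U \<inter> V). x \<in> W \<and>
    inv\<^bsub>sections F W\<^esub> (restr F U W \<alpha>) \<otimes>\<^bsub>sections F W\<^esub> restr F V W \<beta> \<in> carrier (sections N W)"
  using quot_germ_self[OF V b x] unfolding eq[symmetric] by (simp add: quot_germ_def)

lemma same_germs_diff:
  assumes U: "openin X U" and V: "openin X V"
    and a: "\<alpha> \<in> carrier (sections F U)" and b: "\<beta> \<in> carrier (sections F V)"
    and eq: "\<And>x. x \<in> U \<inter> V \<Longrightarrow> quot_germ X F N x U \<alpha> = quot_germ X F N x V \<beta>"
  shows "inv\<^bsub>sections F (U \<inter> V)\<^esub> (restr F U (U \<inter> V) \<alpha>) \<otimes>\<^bsub>sections F (U \<inter> V)\<^esub> restr F V (U \<inter> V) \<beta>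
    \<in> carrier (sections N (U \<inter> V))"
proof (rule local_N)
  have o: "openin X (U \<inter> V)" and s: "U \<inter> V \<in> opens X U" "U \<inter> V \<in> opens X V"
    using U V by (auto simp: opens_def)
  show "openin X (U \<inter> V)" by (rule o)
  interpret G: group "sections F (U \<inter> V)" by (rule F.group_sections[OF o])
  note c = F.restr_closed[OF U s(1) a] F.restr_closed[OF V s(2) b]
  show "inv\<^bsub>sections F (U \<inter> V)\<^esub> (restr F U (U \<inter> V) \<alpha>) \<otimes>\<^bsub>sections F (U \<inter> V)\<^esub> restr F V (U \<inter> V) \<beta>
      \<in> carrier (sections F (U \<inter> V))"
    using c by simp
  fix x assume x: "x \<in> U \<inter> V"
  obtain W where W: "W \<in> opens X (U \<inter> V)" "x \<in> W"
      "inv\<^bsub>sections F W\<^esub> (restr F U W \<alpha>) \<otimes>\<^bsub>sections F W\<^esub> restr F V W \<beta> \<in> carrier (sections N W)"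
    using quot_germ_eqD[OF U V b _ eq[OF x]] x by blast
  then show "\<exists>W\<in>opens X (U \<inter> V). x \<in> W \<and> restr F (U \<inter> V) W (inv\<^bsub>sections F (U \<inter> V)\<^esub>
      (restr F U (U \<inter> V) \<alpha>) \<otimes>\<^bsub>sections F (U \<inter> V)\<^esub> restr F V (U \<inter> V) \<beta>) \<in> carrier (sections N W)"
    using c by (intro bexI[of _ W]) (simp_all add: F.restr_mult[OF o W(1)] F.restr_inv[OF o W(1)]
        F.restr_restr[OF U s(1) W(1) a] F.restr_restr[OF V s(2) W(1) b])
qed

text \<open>Given a global lift \<open>\<beta>\<close> of \<open>a\<close>, every family of local lifts \<open>\<alpha>\<^sub>U\<close> differs from it by the
  sections \<open>\<alpha>\<^sub>U\<^sup>-\<^sup>1 \<beta>\<close> of \<open>N\<close>, and these trivialise the cocycle \<open>\<alpha>\<^sub>U\<^sup>-\<^sup>1 \<alpha>\<^sub>V\<close>.\<close>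

lemma lift_cocycle_base:
  assumes b: "\<beta> \<in> carrier (sections F (topspace X))"
    and germ: "\<And>x. x \<in> topspace X \<Longrightarrow> a x = quot_germ X F N x (topspace X) \<beta>"
    and lift: "local_lift X F N a \<U> \<alpha>"
  shows "((\<U>, lift_cocycle F \<alpha>), ({topspace X}, \<lambda>U V. \<one>\<^bsub>sections N (U \<inter> V)\<^esub>)) \<in> cech_rel X N"
proof -
  let ?X = "topspace X"
  have cov: "open_cover X \<U>" and al: "\<And>U. U \<in> \<U> \<Longrightarrow> \<alpha> U \<in> carrier (sections F U)"
    and ag: "\<And>U x. U \<in> \<U> \<Longrightarrow> x \<in> U \<Longrightarrow> a x = quot_germ X F N x U (\<alpha> U)"
    using lift by (auto simp: local_lift_def)
  have o: "openin X U" "U \<in> opens X ?X" "U \<subseteq> ?X" if "U \<in> \<U>" for U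
    using cov that by (auto simp: open_cover_def opens_def dest: openin_subset)
  have oX: "openin X ?X" by simp
  have c_N: "lift_cocycle F \<alpha> U V \<in> carrier (sections N (U \<inter> V))" if U: "U \<in> \<U>" and V: "V \<in> \<U>" for U V
    unfolding lift_cocycle_def using ag[OF U] ag[OF V]
    by (intro same_germs_diff o(1) al U V) auto
  have co: "(\<U>, lift_cocycle F \<alpha>) \<in> cocycles X N"
    unfolding cocycles_def
  proof (clarsimp simp: cov c_N restr_N)
    fix U V W assume U: "U \<in> \<U>" and V: "V \<in> \<U>" and W: "W \<in> \<U>"
    let ?T = "U \<inter> V \<inter> W"
    have oT: "openin X ?T" using o(1) U V W by blast
    interpret T: group "sections F ?T" by (rule F.group_sections[OF oT])
    have restr_c: "restr F (P \<inter> Q) ?T (lift_cocycle F \<alpha> P Q) =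
        inv\<^bsub>sections F ?T\<^esub> (restr F P ?T (\<alpha> P)) \<otimes>\<^bsub>sections F ?T\<^esub> restr F Q ?T (\<alpha> Q)"
      if P: "P \<in> \<U>" and Q: "Q \<in> \<U>" and s: "?T \<subseteq> P \<inter> Q" for P Q
    proof -
      have s: "P \<inter> Q \<in> opens X P" "P \<inter> Q \<in> opens X Q" "?T \<in> opens X (P \<inter> Q)" and oPQ: "openin X (P \<inter> Q)"
        using o(1)[OF P] o(1)[OF Q] oT s by (auto simp: opens_def)
      interpret PQ: group "sections F (P \<inter> Q)" by (rule F.group_sections[OF oPQ])
      show ?thesis
        unfolding lift_cocycle_def
        using F.restr_closed[OF o(1)[OF P] s(1) al[OF P]] F.restr_closed[OF o(1)[OF Q] s(2) al[OF Q]]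
        by (simp add: F.restr_mult[OF oPQ s(3)] F.restr_inv[OF oPQ s(3)]
            F.restr_restr[OF o(1)[OF P] s(1,3) al[OF P]] F.restr_restr[OF o(1)[OF Q] s(2,3) al[OF Q]])
    qed
    have m: "restr F U ?T (\<alpha> U) \<in> carrier (sections F ?T)" "restr F V ?T (\<alpha> V) \<in> carrier (sections F ?T)"
        "restr F W ?T (\<alpha> W) \<in> carrier (sections F ?T)"
      using U V W oT by (auto intro!: F.restr_closed o(1) al simp: opens_def)
    have "restr F (U \<inter> V) ?T (lift_cocycle F \<alpha> U V) \<otimes>\<^bsub>sections F ?T\<^esub> restr F (V \<inter> W) ?T (lift_cocycle F \<alpha> V W)
        = restr F (U \<inter> W) ?T (lift_cocycle F \<alpha> U W)"
    proof -
      have s: "?T \<subseteq> U \<inter> V" "?T \<subseteq> V \<inter> W" "?T \<subseteq> U \<inter> W" by auto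
      show ?thesis
        unfolding restr_c[OF U V s(1)] restr_c[OF V W s(2)] restr_c[OF U W s(3)]
        using m by (simp add: T.m_assoc T.m_assoc[of "restr F V ?T (\<alpha> V)", symmetric])
    qed
    then show "restr F (U \<inter> V) ?T (lift_cocycle F \<alpha> U V) \<otimes>\<^bsub>sections N ?T\<^esub>
        restr F (V \<inter> W) ?T (lift_cocycle F \<alpha> V W) = restr F (U \<inter> W) ?T (lift_cocycle F \<alpha> U W)"
      by (simp add: mult_N[OF oT])
  qed
  define h where "h U = inv\<^bsub>sections F U\<^esub> (\<alpha> U) \<otimes>\<^bsub>sections F U\<^esub> restr F ?X U \<beta>" for U
  have h_N: "h U \<in> carrier (sections N U)" if U: "U \<in> \<U>" for U
  proof -
    have UX: "U \<inter> ?X = U" using o(3)[OF U] by blast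
    have "quot_germ X F N x U (\<alpha> U) = quot_germ X F N x ?X \<beta>" if "x \<in> U \<inter> ?X" for x
      using that ag[OF U, of x] germ[of x] by simp
    from same_germs_diff[OF o(1)[OF U] oX al[OF U] b this] show ?thesis
      using F.restr_id[OF o(1)[OF U] al[OF U]] by (simp add: h_def UX)
  qed
  have coh: "cohomologous_on N \<U> (pullback N (\<lambda>U. U) (lift_cocycle F \<alpha>))
      (pullback N (\<lambda>_. ?X) (\<lambda>U V. \<one>\<^bsub>sections N (U \<inter> V)\<^esub>))"
    unfolding cohomologous_on_def
  proof (intro exI[of _ h] conjI ballI h_N)
    fix U V assume U: "U \<in> \<U>" and V: "V \<in> \<U>"
    let ?D = "U \<inter> V"
    have oD: "openin X ?D" using o(1) U V by blast
    have s: "?D \<in> opens X U" "?D \<in> opens X V" "?D \<in> opens X ?X"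
      using oD o(3)[OF U] by (auto simp: opens_def)
    interpret D: group "sections F ?D" by (rule F.group_sections[OF oD])
    have restr_h: "restr F P ?D (h P) =
        inv\<^bsub>sections F ?D\<^esub> (restr F P ?D (\<alpha> P)) \<otimes>\<^bsub>sections F ?D\<^esub> restr F ?X ?D \<beta>"
      if P: "P \<in> \<U>" and s: "?D \<in> opens X P" for P
    proof -
      interpret P: group "sections F P" by (rule F.group_sections[OF o(1)[OF P]])
      show ?thesis
        unfolding h_def using al[OF P] F.restr_closed[OF oX o(2)[OF P] b]
        by (simp add: F.restr_mult[OF o(1)[OF P] s] F.restr_inv[OF o(1)[OF P] s]
            F.restr_restr[OF oX o(2)[OF P] s b])
    qed
    have m: "restr F U ?D (\<alpha> U) \<in> carrier (sections F ?D)" "restr F V ?D (\<alpha> V) \<in> carrier (sections F ?D)"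
        "restr F ?X ?D \<beta> \<in> carrier (sections F ?D)"
      using F.restr_closed[OF o(1)[OF U] s(1) al[OF U]] F.restr_closed[OF o(1)[OF V] s(2) al[OF V]]
        F.restr_closed[OF oX s(3) b] by auto
    have "\<one>\<^bsub>sections F ?D\<^esub> = inv\<^bsub>sections F ?D\<^esub> (restr F U ?D (h U)) \<otimes>\<^bsub>sections F ?D\<^esub>
        lift_cocycle F \<alpha> U V \<otimes>\<^bsub>sections F ?D\<^esub> restr F V ?D (h V)"
      unfolding restr_h[OF U s(1)] restr_h[OF V s(2)] lift_cocycle_def
      using m by (simp add: D.inv_mult_group D.m_assoc
          D.m_assoc[of "restr F V ?D (\<alpha> V)", symmetric] D.m_assoc[of "restr F U ?D (\<alpha> U)", symmetric])
    moreover have "restr N ?D ?D (lift_cocycle F \<alpha> U V) = lift_cocycle F \<alpha> U V"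
      by (rule N.restr_id[OF oD c_N[OF U V]])
    moreover have "restr N (?X \<inter> ?X) ?D \<one>\<^bsub>sections N (?X \<inter> ?X)\<^esub> = \<one>\<^bsub>sections N ?D\<^esub>"
      using N.restr_one[OF oX s(3)] by simp
    ultimately show "pullback N (\<lambda>_. ?X) (\<lambda>U V. \<one>\<^bsub>sections N (U \<inter> V)\<^esub>) U V =
        inv\<^bsub>sections N ?D\<^esub> (restr N U ?D (h U)) \<otimes>\<^bsub>sections N ?D\<^esub> pullback N (\<lambda>U. U) (lift_cocycle F \<alpha>) U V
          \<otimes>\<^bsub>sections N ?D\<^esub> restr N V ?D (h V)"
      using inv_N[OF oD restr_closed_N[OF o(1)[OF U] s(1) h_N[OF U]]]
      by (simp add: pullback_def mult_N[OF oD] one_N[OF oD] restr_N)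
  qed
  have "refines \<U> (\<lambda>U. U) \<U>" "refines \<U> (\<lambda>_. ?X) {?X}"
    using o(3) by (auto simp: refines_def)
  with co N.base_cocycle cov coh show ?thesis
    by (auto simp: cech_rel_def)
qed

text \<open>The global lift is itself a family of local lifts, for the cover by the whole space, so the
  class that defines the connecting map exists; it is unique because all local lifts give the base
  point.\<close>

lemma connecting_map_global_lift:
  assumes b: "\<beta> \<in> carrier (sections F (topspace X))"
    and germ: "\<And>x. x \<in> topspace X \<Longrightarrow> a x = quot_germ X F N x (topspace X) \<beta>"
  shows "connecting_map X F N a = cech_base X N"
proof -
  have eq: "cech_rel X N `` {(\<U>, lift_cocycle F \<alpha>)} = cech_base X N" if "local_lift X F N a \<U> \<alpha>" for \<U> \<alpha>
  proof -
    note r = lift_cocycle_base[OF b germ that]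
    show ?thesis
      using r symD[OF N.sym_cech_rel r] transD[OF N.trans_cech_rel]
      unfolding cech_base_def by blast
  qed
  have "local_lift X F N a {topspace X} (\<lambda>_. \<beta>)"
    using b germ by (auto simp: local_lift_def open_cover_def)
  then show ?thesis
    unfolding connecting_map_def using eq by (intro the_equality) metis+
qed

end

section \<open>The free algebra: grading and substitution\<close>

abbreviation word :: "'e list \<Rightarrow> complex \<Rightarrow> ('e list \<Rightarrow>\<^sub>0 complex)" where
  "word \<equiv> Poly_Mapping.single"

lemma word_mult: "word v a * word w b = word (v @ w) (a * b)"
  by (simp add: mult_single plus_list_def)

lemma word_Nil_one: "word [] 1 = 1"
  by (metis single_one zero_list_def)

lemma word_Cons: "word (v # w) c = word [v] 1 * word w c"
  by (simp add: word_mult)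

lemma free_induct [case_names zero word add]:
  assumes "P 0" and word: "\<And>w c. w \<in> Poly_Mapping.keys a \<Longrightarrow> c = Poly_Mapping.lookup a w \<Longrightarrow> P (word w c)"
    and add: "\<And>a b. P a \<Longrightarrow> P b \<Longrightarrow> P (a + b)"
  shows "P (a :: 'e list \<Rightarrow>\<^sub>0 complex)"
proof -
  have "a = (\<Sum>w\<in>Poly_Mapping.keys a. word w (Poly_Mapping.lookup a w))"
    by (rule poly_mapping_eqI)
      (auto simp: lookup_sum lookup_single when_def in_keys_iff)
  moreover have "finite S \<Longrightarrow> S \<subseteq> Poly_Mapping.keys a \<Longrightarrow> P (\<Sum>w\<in>S. word w (Poly_Mapping.lookup a w))" for S
    by (induction rule: finite_induct) (auto intro: assms)
  ultimately show ?thesis by (metis finite_keys subset_refl)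
qed

lemma scalar_comm: "word [] c * a = a * word [] c"
  by (induction a rule: free_induct) (auto simp: word_mult algebra_simps)

definition lengths :: "(nat \<Rightarrow> bool) \<Rightarrow> ('e list \<Rightarrow>\<^sub>0 complex) set" where
  "lengths P = {a. \<forall>w\<in>Poly_Mapping.keys a. P (length w)}"

definition len_part :: "(nat \<Rightarrow> bool) \<Rightarrow> ('e list \<Rightarrow>\<^sub>0 complex) \<Rightarrow> ('e list \<Rightarrow>\<^sub>0 complex)" where
  "len_part P a = Poly_Mapping.mapp (\<lambda>w c. if P (length w) then c else 0) a"

lemma lookup_len_part: "Poly_Mapping.lookup (len_part P a) w = (if P (length w) then Poly_Mapping.lookup a w else 0)"
  by (auto simp: len_part_def lookup_mapp when_def in_keys_iff)

lemma keys_len_part: "Poly_Mapping.keys (len_part P a) = {w \<in> Poly_Mapping.keys a. P (length w)}"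
  by (auto simp: in_keys_iff lookup_len_part split: if_splits)

lemma len_part_zero [simp]: "len_part P 0 = 0"
  by (rule poly_mapping_eqI) (simp add: lookup_len_part)

lemma len_part_add: "len_part P (a + b) = len_part P a + len_part P b"
  by (rule poly_mapping_eqI) (simp add: lookup_len_part lookup_add)

lemma len_part_diff: "len_part P (a - b) = len_part P a - len_part P b"
  by (rule poly_mapping_eqI) (simp add: lookup_len_part lookup_minus)

lemma len_part_word: "len_part P (word w c) = (if P (length w) then word w c else 0)"
  by (rule poly_mapping_eqI) (simp add: lookup_len_part lookup_single when_def)

lemma len_part_split: "a = len_part P a + len_part (\<lambda>n. \<not> P n) a"
  by (rule poly_mapping_eqI) (simp add: lookup_len_part lookup_add)

lemma len_part_in: "len_part P a \<in> lengths P"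
  by (simp add: lengths_def keys_len_part)

lemma len_part_id: "a \<in> lengths P \<Longrightarrow> len_part P a = a"
  by (rule poly_mapping_eqI) (auto simp: lookup_len_part lengths_def in_keys_iff)

lemma len_part_none: "a \<in> lengths P \<Longrightarrow> (\<And>n. P n \<Longrightarrow> \<not> Q n) \<Longrightarrow> len_part Q a = 0"
  by (rule poly_mapping_eqI) (force simp: lookup_len_part lengths_def in_keys_iff)

lemma len_part_word_mult:
  "len_part P (word w c * a) = word w c * len_part (\<lambda>n. P (length w + n)) a"
  by (induction a rule: free_induct) (auto simp: word_mult len_part_word len_part_add algebra_simps)

lemma len_part_mult_word:
  "len_part P (a * word w c) = len_part (\<lambda>n. P (n + length w)) a * word w c"
  by (induction a rule: free_induct) (auto simp: word_mult len_part_word len_part_add algebra_simps)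

lemma lengths_0 [simp]: "0 \<in> lengths P" by (simp add: lengths_def)

lemma lengths_word: "P (length w) \<Longrightarrow> word w c \<in> lengths P"
  by (simp add: lengths_def)

lemma lengths_add: "a \<in> lengths P \<Longrightarrow> b \<in> lengths P \<Longrightarrow> a + b \<in> lengths P"
  unfolding lengths_def using keys_add[of a b] by blast

lemma lengths_uminus: "a \<in> lengths P \<Longrightarrow> - a \<in> lengths P"
  unfolding lengths_def by (auto simp: in_keys_iff)

lemma lengths_diff: "a \<in> lengths P \<Longrightarrow> b \<in> lengths P \<Longrightarrow> a - b \<in> lengths P"
  using lengths_add[OF _ lengths_uminus, of a P b] by simp

lemma lengths_mono: "a \<in> lengths P \<Longrightarrow> (\<And>n. P n \<Longrightarrow> Q n) \<Longrightarrow> a \<in> lengths Q"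
  by (auto simp: lengths_def)

lemma lengths_mult:
  assumes "a \<in> lengths P" "b \<in> lengths Q" "\<And>i j. P i \<Longrightarrow> Q j \<Longrightarrow> R (i + j)"
  shows "a * b \<in> lengths R"
  using keys_mult[of a b] assms unfolding lengths_def by (fastforce simp: plus_list_def)

definition letters :: "'e set \<Rightarrow> ('e list \<Rightarrow>\<^sub>0 complex) set" where
  "letters S = {a. \<forall>w\<in>Poly_Mapping.keys a. set w \<subseteq> S}"

lemma carrier_free_algebra: "carrier (free_algebra S) = letters S"
  by (simp add: free_algebra_def letters_def)

lemma letters_0 [simp]: "0 \<in> letters S" by (simp add: letters_def)

lemma letters_word: "set w \<subseteq> S \<Longrightarrow> word w c \<in> letters S"
  by (simp add: letters_def)

lemma letters_1 [simp]: "1 \<in> letters S"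
  using letters_word[of "[]" S 1] by (simp add: word_Nil_one)

lemma letters_add: "a \<in> letters S \<Longrightarrow> b \<in> letters S \<Longrightarrow> a + b \<in> letters S"
  unfolding letters_def using keys_add[of a b] by blast

lemma letters_uminus: "a \<in> letters S \<Longrightarrow> - a \<in> letters S"
  unfolding letters_def by (auto simp: in_keys_iff)

lemma letters_diff: "a \<in> letters S \<Longrightarrow> b \<in> letters S \<Longrightarrow> a - b \<in> letters S"
  using letters_add[OF _ letters_uminus, of a S b] by simp

lemma letters_mult: "a \<in> letters S \<Longrightarrow> b \<in> letters S \<Longrightarrow> a * b \<in> letters S"
  using keys_mult[of a b] unfolding letters_def by (fastforce simp: plus_list_def)

lemma letters_len_part: "a \<in> letters S \<Longrightarrow> len_part P a \<in> letters S"
  by (auto simp: letters_def keys_len_part)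

lemmas letters_closed = letters_0 letters_1 letters_word letters_add letters_uminus letters_diff
  letters_mult letters_len_part

definition subst_word :: "('e \<Rightarrow> ('e list \<Rightarrow>\<^sub>0 complex)) \<Rightarrow> 'e list \<Rightarrow> ('e list \<Rightarrow>\<^sub>0 complex)" where
  "subst_word g w = prod_list (map g w)"

definition free_subst :: "('e \<Rightarrow> ('e list \<Rightarrow>\<^sub>0 complex)) \<Rightarrow> ('e list \<Rightarrow>\<^sub>0 complex) \<Rightarrow> ('e list \<Rightarrow>\<^sub>0 complex)" where
  "free_subst g a = (\<Sum>w\<in>Poly_Mapping.keys a. word [] (Poly_Mapping.lookup a w) * subst_word g w)"

lemma free_subst_superset:
  assumes "finite S" "Poly_Mapping.keys a \<subseteq> S"
  shows "free_subst g a = (\<Sum>w\<in>S. word [] (Poly_Mapping.lookup a w) * subst_word g w)"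
  unfolding free_subst_def using assms
  by (intro sum.mono_neutral_left) (auto simp: in_keys_iff)

lemma free_subst_add: "free_subst g (a + b) = free_subst g a + free_subst g b"
proof -
  let ?S = "Poly_Mapping.keys a \<union> Poly_Mapping.keys b"
  have "free_subst g c = (\<Sum>w\<in>?S. word [] (Poly_Mapping.lookup c w) * subst_word g w)"
    if "c = a \<or> c = b \<or> c = a + b" for c
    using that keys_add[of a b] by (intro free_subst_superset) auto
  then show ?thesis
    by (simp add: lookup_add single_add distrib_right sum.distrib)
qed

lemma free_subst_0 [simp]: "free_subst g 0 = 0"
  by (simp add: free_subst_def)

lemma free_subst_word: "free_subst g (word w c) = word [] c * subst_word g w"
  by (subst free_subst_superset[of "{w}"]) auto

lemma free_subst_diff: "free_subst g (a - b) = free_subst g a - free_subst g b"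
  using free_subst_add[of g "a - b" b] by (simp add: algebra_simps)

lemma subst_word_append: "subst_word g (v @ w) = subst_word g v * subst_word g w"
  by (simp add: subst_word_def)

lemma subst_word_Nil [simp]: "subst_word g [] = 1"
  by (simp add: subst_word_def)

lemma subst_word_Cons: "subst_word g (v # w) = g v * subst_word g w"
  by (simp add: subst_word_def)

lemma free_subst_letter: "free_subst g (word [v] c) = word [] c * g v"
  by (simp add: free_subst_word subst_word_def)

lemma free_subst_scalar: "free_subst g (word [] c) = word [] c"
  by (simp add: free_subst_word)

lemma free_subst_mult: "free_subst g (a * b) = free_subst g a * free_subst g b"
proof (induction a rule: free_induct)
  case (word v c)
  show ?case
  proof (induction b rule: free_induct)
    case (word w d)
    have "word [] (c * d) * (subst_word g v * subst_word g w)
        = word [] c * (word [] d * subst_word g v) * subst_word g w"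
      by (simp add: mult.assoc[symmetric] word_mult)
    then show ?case
      by (simp add: word_mult free_subst_word subst_word_append scalar_comm[of d "subst_word g v"] mult.assoc)
  qed (auto simp: free_subst_add distrib_left)
qed (auto simp: free_subst_add distrib_right)

lemma subst_word_letters: "(\<And>v. v \<in> S \<Longrightarrow> g v \<in> letters S) \<Longrightarrow> set w \<subseteq> S \<Longrightarrow> subst_word g w \<in> letters S"
  by (induction w) (auto simp: subst_word_Cons intro!: letters_mult)

lemma letters_sum: "(\<And>i. i \<in> I \<Longrightarrow> f i \<in> letters S) \<Longrightarrow> sum f I \<in> letters S"
  by (induction I rule: infinite_finite_induct) (auto intro: letters_add)

lemma free_subst_letters:
  assumes g: "\<And>v. v \<in> S \<Longrightarrow> g v \<in> letters S" and a: "a \<in> letters S"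
  shows "free_subst g a \<in> letters S"
  unfolding free_subst_def
proof (intro letters_sum letters_mult subst_word_letters g)
  show "word [] c \<in> letters S" for c by (rule letters_word) simp
qed (use a in \<open>auto simp: letters_def\<close>)

text \<open>In each word of the difference at least one letter of \<open>w\<close> is replaced by a word of length \<open>k\<close>,
  and the other letters do not get shorter. The condition \<open>length w \<ge> 1\<close> records that the empty
  word is fixed.\<close>

lemma subst_word_lengths:
  assumes g: "\<And>v. v \<in> set w \<Longrightarrow> g v - word [v] 1 \<in> lengths ((=) k)" and k: "k \<ge> 1"
  shows "subst_word g w \<in> lengths ((\<le>) (length w))"
    and "subst_word g w - word w 1 \<in> lengths (\<lambda>n. length w \<ge> 1 \<and> length w + k - 1 \<le> n)"
proof -
  have "subst_word g w \<in> lengths ((\<le>) (length w)) \<and>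
    subst_word g w - word w 1 \<in> lengths (\<lambda>n. length w \<ge> 1 \<and> length w + k - 1 \<le> n)"
    using g
  proof (induction w)
    case Nil
    then show ?case using lengths_word[of "\<lambda>_. True" "[]" 1] by (simp add: word_Nil_one)
  next
    case (Cons v w)
    let ?d = "g v - word [v] 1"
    have d: "?d \<in> lengths ((=) k)" using Cons.prems by simp
    have IH: "subst_word g w \<in> lengths ((\<le>) (length w))"
        "subst_word g w - word w 1 \<in> lengths (\<lambda>n. length w \<ge> 1 \<and> length w + k - 1 \<le> n)"
      using Cons by auto
    have "word [v] 1 \<in> lengths ((\<le>) 1)" by (rule lengths_word) simp
    moreover have "?d \<in> lengths ((\<le>) 1)" using lengths_mono[OF d] k by auto
    ultimately have g1: "g v \<in> lengths ((\<le>) 1)" using lengths_add by fastforce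
    have eq: "subst_word g (v # w) - word (v # w) 1 =
        ?d * subst_word g w + word [v] 1 * (subst_word g w - word w 1)"
      by (simp add: subst_word_Cons word_Cons[of v w] algebra_simps)
    have "?d * subst_word g w \<in> lengths (\<lambda>n. length (v # w) \<ge> 1 \<and> length (v # w) + k - 1 \<le> n)"
      by (rule lengths_mult[OF d IH(1)]) auto
    moreover have "word [v] 1 * (subst_word g w - word w 1)
        \<in> lengths (\<lambda>n. length (v # w) \<ge> 1 \<and> length (v # w) + k - 1 \<le> n)"
      by (rule lengths_mult[OF lengths_word[of "(=) 1"] IH(2)]) auto
    moreover have "subst_word g (v # w) \<in> lengths ((\<le>) (length (v # w)))"
      unfolding subst_word_Cons by (rule lengths_mult[OF g1 IH(1)]) auto
    ultimately show ?case unfolding eq by (blast intro: lengths_add)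
  qed
  then show "subst_word g w \<in> lengths ((\<le>) (length w))"
    and "subst_word g w - word w 1 \<in> lengths (\<lambda>n. length w \<ge> 1 \<and> length w + k - 1 \<le> n)"
    by auto
qed

lemma lengths_sum: "(\<And>i. i \<in> I \<Longrightarrow> f i \<in> lengths P) \<Longrightarrow> sum f I \<in> lengths P"
  by (induction I rule: infinite_finite_induct) (auto intro: lengths_add)

lemma lengths_scalar_mult: "a \<in> lengths P \<Longrightarrow> word [] c * a \<in> lengths P"
  by (rule lengths_mult[OF lengths_word[of "(=) 0"]]) auto

lemma free_subst_minus_id:
  assumes a: "a \<in> letters S" "a \<in> lengths ((\<le>) j)"
    and g: "\<And>v. v \<in> S \<Longrightarrow> g v - word [v] 1 \<in> lengths ((=) k)" and k: "k \<ge> 1"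
  shows "free_subst g a - a \<in> lengths (\<lambda>n. k \<le> n \<and> j + k - 1 \<le> n)"
proof -
  have "free_subst g a - a = (\<Sum>w\<in>Poly_Mapping.keys a. word [] (Poly_Mapping.lookup a w) * (subst_word g w - word w 1))"
  proof -
    have "a = (\<Sum>w\<in>Poly_Mapping.keys a. word [] (Poly_Mapping.lookup a w) * word w 1)"
      by (rule poly_mapping_eqI)
        (auto simp: word_mult lookup_sum lookup_single when_def in_keys_iff)
    then show ?thesis unfolding free_subst_def
      by (simp add: right_diff_distrib sum_subtractf)
  qed
  also have "\<dots> \<in> lengths (\<lambda>n. k \<le> n \<and> j + k - 1 \<le> n)"
  proof (intro lengths_sum lengths_scalar_mult)
    fix w assume w: "w \<in> Poly_Mapping.keys a"
    then have "set w \<subseteq> S" "j \<le> length w" using a by (auto simp: letters_def lengths_def)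
    then show "subst_word g w - word w 1 \<in> lengths (\<lambda>n. k \<le> n \<and> j + k - 1 \<le> n)"
      using subst_word_lengths(2)[of w g k] g k by (fastforce elim!: lengths_mono)
  qed
  finally show ?thesis .
qed

lemma free_subst_parity:
  assumes a: "a \<in> letters S" "a \<in> lengths (\<lambda>n. even n = b)"
    and g: "\<And>v. v \<in> S \<Longrightarrow> g v \<in> lengths odd"
  shows "free_subst g a \<in> lengths (\<lambda>n. even n = b)"
  unfolding free_subst_def
proof (intro lengths_sum lengths_scalar_mult)
  fix w assume w: "w \<in> Poly_Mapping.keys a"
  have "set w \<subseteq> S \<Longrightarrow> subst_word g w \<in> lengths (\<lambda>n. even n = even (length w))" for w
  proof (induction w)
    case Nil
    then show ?case using lengths_word[of even "[]" 1] by (simp add: word_Nil_one)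
  next
    case (Cons v w)
    then show ?case unfolding subst_word_Cons
      by (intro lengths_mult[of _ odd _ "\<lambda>n. even n = even (length w)"] g) auto
  qed
  then show "subst_word g w \<in> lengths (\<lambda>n. even n = b)"
    using w a by (auto simp: letters_def lengths_def)
qed

section \<open>The exterior algebra of a vector space\<close>

text \<open>Closure of the fibre under the operations puts the relations into the free algebra on the fibre,
  so that they generate an ideal of it.\<close>

locale ext_fibre =
  fixes E :: "('x, 'e) vbundle" and x :: 'x
  assumes vadd_closed: "\<lbrakk>u \<in> fibre E x; v \<in> fibre E x\<rbrakk> \<Longrightarrow> vadd E u v \<in> fibre E x"
    and vscale_closed: "u \<in> fibre E x \<Longrightarrow> vscale E c u \<in> fibre E x"
begin

abbreviation "A \<equiv> letters (fibre E x)"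
abbreviation "I \<equiv> ext_ideal E x"

lemma ring_free: "ring (free_algebra (fibre E x))"
proof (intro ringI abelian_groupI monoidI)
  fix a assume "a \<in> carrier (free_algebra (fibre E x))"
  then show "\<exists>b\<in>carrier (free_algebra (fibre E x)). b \<oplus>\<^bsub>free_algebra (fibre E x)\<^esub> a = \<zero>\<^bsub>free_algebra (fibre E x)\<^esub>"
    using letters_uminus[of a "fibre E x"] unfolding carrier_free_algebra
    by (intro bexI[of _ "- a"]) (simp_all add: free_algebra_def)
qed (auto simp: carrier_free_algebra letters_closed algebra_simps,
    auto simp: free_algebra_def algebra_simps letters_closed simp flip: letters_def)

lemma relations_sub: "ext_relations E x \<subseteq> A"
  unfolding ext_relations_def
  by (auto intro!: letters_diff letters_word vadd_closed vscale_closed)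

lemma ideal_I: "ideal I (free_algebra (fibre E x))"
  unfolding ext_ideal_def
  by (rule ring.genideal_ideal[OF ring_free]) (use relations_sub in \<open>simp add: carrier_free_algebra\<close>)

lemma I_sub: "a \<in> I \<Longrightarrow> a \<in> A"
  using ideal.Icarr[OF ideal_I] by (simp add: carrier_free_algebra)

lemma I_add: "a \<in> I \<Longrightarrow> b \<in> I \<Longrightarrow> a + b \<in> I"
  using additive_subgroup.a_closed[OF ideal.axioms(1)[OF ideal_I], of a b] by (simp add: free_algebra_def)

lemma I_0 [simp]: "0 \<in> I"
  using additive_subgroup.zero_closed[OF ideal.axioms(1)[OF ideal_I]] by (simp add: free_algebra_def)

lemma I_left: "a \<in> A \<Longrightarrow> b \<in> I \<Longrightarrow> a * b \<in> I"
  using ideal.I_l_closed[OF ideal_I, of b a] by (simp add: carrier_free_algebra) (simp add: free_algebra_def)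

lemma I_right: "a \<in> A \<Longrightarrow> b \<in> I \<Longrightarrow> b * a \<in> I"
  using ideal.I_r_closed[OF ideal_I, of b a] by (simp add: carrier_free_algebra) (simp add: free_algebra_def)

lemma I_uminus: "a \<in> I \<Longrightarrow> - a \<in> I"
  using I_left[OF letters_uminus[OF letters_1], of a] by simp

lemma I_diff: "a \<in> I \<Longrightarrow> b \<in> I \<Longrightarrow> a - b \<in> I"
  using I_add[OF _ I_uminus, of a b] by simp

lemma I_rel: "a \<in> ext_relations E x \<Longrightarrow> a \<in> I"
  unfolding ext_ideal_def using ring.genideal_self[OF ring_free] relations_sub
  by (auto simp: carrier_free_algebra)

lemma I_vadd: "\<lbrakk>u \<in> fibre E x; v \<in> fibre E x\<rbrakk> \<Longrightarrow> word [vadd E u v] 1 - word [u] 1 - word [v] 1 \<in> I"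
  by (rule I_rel) (auto simp: ext_relations_def)

lemma I_vscale: "u \<in> fibre E x \<Longrightarrow> word [vscale E c u] 1 - word [u] c \<in> I"
  by (rule I_rel) (auto simp: ext_relations_def)

lemma I_square: "u \<in> fibre E x \<Longrightarrow> word [u, u] 1 \<in> I"
  by (rule I_rel) (auto simp: ext_relations_def)

text \<open>Words suffice as multipliers, because every element of the free algebra is a sum of words.\<close>

lemma I_induct [consumes 1, case_names zero rel add left right]:
  assumes a: "a \<in> I" and z: "P 0" and r: "\<And>r. r \<in> ext_relations E x \<Longrightarrow> P r"
    and s: "\<And>a b. \<lbrakk>a \<in> I; b \<in> I; P a; P b\<rbrakk> \<Longrightarrow> P (a + b)"
    and l: "\<And>a w c. \<lbrakk>a \<in> I; set w \<subseteq> fibre E x; P a\<rbrakk> \<Longrightarrow> P (word w c * a)"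
    and m: "\<And>a w c. \<lbrakk>a \<in> I; set w \<subseteq> fibre E x; P a\<rbrakk> \<Longrightarrow> P (a * word w c)"
  shows "P a"
proof -
  let ?R = "free_algebra (fibre E x)"
  let ?J = "{a \<in> I. P a}"
  have lw: "set w \<subseteq> fibre E x" if "w \<in> Poly_Mapping.keys b" "b \<in> A" for b w
    using that by (auto simp: letters_def)
  have left: "b * a \<in> I \<and> P (b * a)" if a: "a \<in> I" "P a" and b: "b \<in> A" for a b
    by (induction b rule: free_induct)
      (use a b z in \<open>auto simp: distrib_right intro!: s l I_add I_left letters_word dest!: lw\<close>)
  have right: "a * b \<in> I \<and> P (a * b)" if a: "a \<in> I" "P a" and b: "b \<in> A" for a b
    by (induction b rule: free_induct)
      (use a b z in \<open>auto simp: distrib_left intro!: s m I_add I_right letters_word dest!: lw\<close>)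
  have "ideal ?J ?R"
  proof (intro idealI ring_free group.subgroupI abelian_group.a_group ring.is_abelian_group)
    show "?J \<subseteq> carrier (add_monoid ?R)"
      using I_sub by (auto simp: carrier_free_algebra)
    show "?J \<noteq> {}" using z by (auto intro!: exI[of _ 0])
    fix a assume "a \<in> ?J"
    then have aI: "a \<in> I" "P a" by auto
    interpret R: ring ?R by (rule ring_free)
    have "a \<oplus>\<^bsub>?R\<^esub> (- a) = \<zero>\<^bsub>?R\<^esub>" "a \<in> carrier ?R" "- a \<in> carrier ?R"
      using I_sub[OF aI(1)] letters_uminus by (auto simp: carrier_free_algebra) (simp add: free_algebra_def)
    then have "\<ominus>\<^bsub>?R\<^esub> a = - a" by (metis R.minus_equality R.a_comm)
    moreover have "- a \<in> ?J" using left[OF aI, of "- 1"] letters_uminus[OF letters_1] by auto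
    ultimately show "inv\<^bsub>add_monoid ?R\<^esub> a \<in> ?J" by (simp add: a_inv_def)
    show "b \<otimes>\<^bsub>?R\<^esub> a \<in> ?J" if "b \<in> carrier ?R" for b
      using left[OF aI] that by (simp add: carrier_free_algebra) (simp add: free_algebra_def)
    show "a \<otimes>\<^bsub>?R\<^esub> b \<in> ?J" if "b \<in> carrier ?R" for b
      using right[OF aI] that by (simp add: carrier_free_algebra) (simp add: free_algebra_def)
    fix b assume "b \<in> ?J"
    with aI show "a \<otimes>\<^bsub>add_monoid ?R\<^esub> b \<in> ?J"
      by (auto intro!: s I_add simp: free_algebra_def)
  qed
  then have "I \<subseteq> ?J"
    unfolding ext_ideal_def using I_rel r unfolding ext_ideal_def
    by (intro ring.genideal_minimal[OF ring_free]) auto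
  then show ?thesis using a by auto
qed

text \<open>The relations are homogeneous, so \<open>I\<close> is a graded ideal.\<close>

lemma I_len_part: "a \<in> I \<Longrightarrow> len_part P a \<in> I"
proof (induction a arbitrary: P rule: I_induct)
  case (rel r)
  have "len_part P r = r \<or> len_part P r = 0"
    using rel unfolding ext_relations_def
    by (auto simp: len_part_diff len_part_word)
  then show ?case using I_rel[OF rel] by auto
qed (auto simp: len_part_add len_part_word_mult len_part_mult_word I_add I_left I_right letters_word)

text \<open>This is the universal property of the exterior algebra: under these conditions the
  substitution descends to the quotient by \<open>I\<close>.\<close>

lemma free_subst_I:
  assumes g: "\<And>v. v \<in> fibre E x \<Longrightarrow> g v \<in> A"
    and add: "\<And>u v. \<lbrakk>u \<in> fibre E x; v \<in> fibre E x\<rbrakk> \<Longrightarrow> g (vadd E u v) - g u - g v \<in> I"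
    and scale: "\<And>c u. u \<in> fibre E x \<Longrightarrow> g (vscale E c u) - word [] c * g u \<in> I"
    and square: "\<And>u. u \<in> fibre E x \<Longrightarrow> g u * g u \<in> I"
    and a: "a \<in> I"
  shows "free_subst g a \<in> I"
  using a
proof (induction a rule: I_induct)
  case (rel r)
  have one: "word [] 1 * g v = g v" for v
    by (simp add: word_Nil_one)
  have two: "free_subst g (word [u, u] 1) = g u * g u" for u
    by (simp add: free_subst_word word_Nil_one subst_word_def)
  show ?case
    using rel add scale square unfolding ext_relations_def
    by (auto simp: free_subst_diff two free_subst_letter one)
next
  case (left a w c)
  have "free_subst g (word w c) \<in> A" by (rule free_subst_letters[OF g]) (use left in \<open>auto intro: letters_word\<close>)
  then show ?case using left by (simp add: free_subst_mult I_left)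
next
  case (right a w c)
  have "free_subst g (word w c) \<in> A" by (rule free_subst_letters[OF g]) (use right in \<open>auto intro: letters_word\<close>)
  then show ?case using right by (simp add: free_subst_mult I_right)
qed (auto simp: free_subst_add I_add)

subsection \<open>Graded commutativity\<close>

text \<open>Polarisation of the relation \<open>u u = 0\<close>: compare the square of \<open>u + v\<close> with those of \<open>u\<close> and \<open>v\<close>.\<close>

lemma anticommute_letters:
  assumes u: "u \<in> fibre E x" and v: "v \<in> fibre E x"
  shows "word [u, v] 1 + word [v, u] 1 \<in> I"
proof -
  let ?s = "word [vadd E u v] 1" and ?u = "word [u] 1" and ?v = "word [v] 1"
  let ?d = "?s - ?u - ?v"
  have d: "?d \<in> I" using I_vadd[OF u v] .
  have A: "?u + ?v \<in> A" "?s \<in> A"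
    using u v vadd_closed by (auto intro!: letters_add letters_word)
  have uv: "?u * ?u = word [u, u] 1" "?v * ?v = word [v, v] 1" "?s * ?s = word [vadd E u v, vadd E u v] 1"
      "?u * ?v = word [u, v] 1" "?v * ?u = word [v, u] 1"
    by (simp_all add: word_mult)
  have "word [u, v] 1 + word [v, u] 1 = ?s * ?s - ?u * ?u - ?v * ?v - ?d * ?s - (?u + ?v) * ?d"
    unfolding uv(4,5)[symmetric] by (simp add: algebra_simps)
  also have "\<dots> \<in> I"
    unfolding uv by (rule I_diff I_square I_left[OF A(1) d] I_right[OF A(2) d] vadd_closed u v)+
  finally show ?thesis .
qed

lemma letter_word_comm:
  assumes u: "u \<in> fibre E x" and w: "set w \<subseteq> fibre E x"
  shows "word (u # w) 1 - word (w @ [u]) ((-1) ^ length w) \<in> I"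
  using w
proof (induction w)
  case (Cons v w)
  let ?e = "(-1 :: complex) ^ length w"
  have IH: "word (u # w) 1 - word (w @ [u]) ?e \<in> I" using Cons by simp
  have v: "v \<in> fibre E x" and w: "set w \<subseteq> fibre E x" using Cons.prems by auto
  have "word (u # v # w) 1 - word ((v # w) @ [u]) (- ?e)
      = (word [u, v] 1 + word [v, u] 1) * word w 1 - word [v] 1 * (word (u # w) 1 - word (w @ [u]) ?e)"
    by (simp add: algebra_simps word_mult single_uminus)
  also have "\<dots> \<in> I"
    using v w by (intro I_diff I_right I_left anticommute_letters u IH letters_word) auto
  finally show ?case by simp
qed simp

lemma word_odd_comm:
  assumes v: "set v \<subseteq> fibre E x" and w: "set w \<subseteq> fibre E x" and odd: "odd (length w)"
  shows "word (v @ w) 1 - word (w @ v) ((-1) ^ length v) \<in> I"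
  using v
proof (induction v)
  case (Cons u v)
  let ?e = "(-1 :: complex) ^ length v"
  have u: "u \<in> fibre E x" and v: "set v \<subseteq> fibre E x" using Cons.prems by auto
  have IH: "word (v @ w) 1 - word (w @ v) ?e \<in> I" using Cons by simp
  have "word (u # v @ w) 1 - word (w @ u # v) (- ?e)
      = word [u] 1 * (word (v @ w) 1 - word (w @ v) ?e)
        + (word (u # w) 1 - word (w @ [u]) ((-1) ^ length w)) * word v ?e"
    using odd by (simp add: algebra_simps word_mult single_uminus)
  also have "\<dots> \<in> I"
    using u v w by (intro I_add I_right I_left letter_word_comm IH letters_word) auto
  finally show ?case by simp
qed simp

lemma odd_anticommute:
  assumes a: "a \<in> A" "a \<in> lengths odd" and b: "b \<in> A" "b \<in> lengths odd"
  shows "a * b + b * a \<in> I"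
proof (induction a rule: free_induct)
  case (word v c)
  then have v: "set v \<subseteq> fibre E x" "odd (length v)" using a by (auto simp: letters_def lengths_def)
  show ?case
  proof (induction b rule: free_induct)
    case (word w d)
    then have w: "set w \<subseteq> fibre E x" "odd (length w)" using b by (auto simp: letters_def lengths_def)
    have "word v c * word w d + word w d * word v c
        = word [] (c * d) * (word (v @ w) 1 - word (w @ v) ((-1) ^ length v))"
      using v by (simp add: word_mult algebra_simps single_uminus)
    also have "\<dots> \<in> I" using word_odd_comm[OF v(1) w] by (intro I_left letters_word) auto
    finally show ?case .
  next
    case (add p q)
    have "word v c * (p + q) + (p + q) * word v c = (word v c * p + p * word v c) + (word v c * q + q * word v c)"
      by (simp add: algebra_simps)
    then show ?case using I_add[OF add] by simp
  qed auto
next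
  case (add p q)
  have "(p + q) * b + b * (p + q) = (p * b + b * p) + (q * b + b * q)"
    by (simp add: algebra_simps)
  then show ?case using I_add[OF add] by simp
qed auto

text \<open>Anticommuting with itself gives \<open>2 a a = 0\<close>, and 2 is invertible.\<close>

lemma odd_square:
  assumes a: "a \<in> A" "a \<in> lengths odd"
  shows "a * a \<in> I"
proof -
  have "word [] (1/2) * (a * a + a * a) \<in> I"
    using odd_anticommute[OF a a] by (intro I_left letters_word) auto
  moreover have "word [] (1/2) * (a * a + a * a) = (word [] (1/2) + word [] (1/2)) * (a * a)"
    by (simp add: algebra_simps)
  moreover have "word [] (1/2) + word [] (1/2) = (1 :: 'e list \<Rightarrow>\<^sub>0 complex)"
    by (simp add: single_add[symmetric] word_Nil_one)
  ultimately show ?thesis by simp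
qed

text \<open>Move the first of two equal letters next to the second.\<close>

lemma repeated_letter:
  assumes w: "set w \<subseteq> fibre E x" and "\<not> distinct w"
  shows "word w c \<in> I"
proof -
  obtain xs ys zs u where eq: "w = xs @ [u] @ ys @ [u] @ zs"
    using not_distinct_decomp[OF assms(2)] by blast
  let ?e = "(-1 :: complex) ^ length ys"
  have s: "set xs \<subseteq> fibre E x" "set ys \<subseteq> fibre E x" "set zs \<subseteq> fibre E x" "u \<in> fibre E x"
    using w by (auto simp: eq)
  have "word w c = word xs c * ((word (u # ys) 1 - word (ys @ [u]) ?e) * word (u # zs) 1
      + word ys ?e * (word [u, u] 1 * word zs 1))"
    by (simp add: algebra_simps word_mult eq)
  also have "\<dots> \<in> I"
    using s by (intro I_left I_add I_right letter_word_comm I_square letters_word) auto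
  finally show ?thesis .
qed

subsection \<open>Vanishing of high exterior powers\<close>

text \<open>Rewritten in a spanning set, a word with more letters than the set has elements repeats a
  letter.\<close>

lemma long_words_vanish:
  assumes B: "finite B" "B \<subseteq> fibre E x"
    and span: "\<And>v. v \<in> fibre E x \<Longrightarrow> \<exists>f. word [v] 1 - (\<Sum>b\<in>B. word [b] (f b)) \<in> I"
    and a: "a \<in> A" "a \<in> lengths ((\<le>) (Suc (card B)))"
  shows "a \<in> I"
proof -
  have rep: "\<exists>b\<in>letters B. b \<in> lengths ((=) (length w)) \<and> word w 1 - b \<in> I" if "set w \<subseteq> fibre E x" for w
    using that
  proof (induction w)
    case Nil
    then show ?case by (intro bexI[of _ "word [] 1"]) (auto intro: lengths_word letters_word)
  next
    case (Cons v w)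
    obtain b where b: "b \<in> letters B" "b \<in> lengths ((=) (length w))" "word w 1 - b \<in> I"
      using Cons by auto
    obtain f where f: "word [v] 1 - (\<Sum>b\<in>B. word [b] (f b)) \<in> I"
      using span Cons.prems by auto
    let ?s = "\<Sum>b\<in>B. word [b] (f b)"
    have s: "?s \<in> letters B" "?s \<in> lengths ((=) 1)"
      by (auto intro!: letters_sum lengths_sum letters_word lengths_word)
    have bA: "b \<in> A" using b(1) B(2) by (auto simp: letters_def)
    have "word (v # w) 1 - ?s * b = word [v] 1 * (word w 1 - b) + (word [v] 1 - ?s) * b"
      by (simp add: word_Cons[of v w] algebra_simps)
    also have "\<dots> \<in> I"
      using Cons.prems bA by (intro I_add I_left I_right f b letters_word) auto
    finally show ?case
      using letters_mult[OF s(1) b(1)] lengths_mult[OF s(2) b(2), of "(=) (length (v # w))"] by auto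
  qed
  show ?thesis
  proof (induction a rule: free_induct)
    case (word w c)
    then have w: "set w \<subseteq> fibre E x" "Suc (card B) \<le> length w" using a by (auto simp: letters_def lengths_def)
    obtain b where b: "b \<in> letters B" "b \<in> lengths ((=) (length w))" "word w 1 - b \<in> I"
      using rep[OF w(1)] by auto
    have "b \<in> I"
    proof (induction b rule: free_induct)
      case (word z d)
      then have z: "set z \<subseteq> B" "length z > card B" using b w by (auto simp: letters_def lengths_def)
      have "\<not> distinct z" using z card_mono[OF B(1) z(1)] by (auto dest!: distinct_card)
      then show ?case using z B by (intro repeated_letter) auto
    qed (auto intro: I_add)
    then have "word w 1 \<in> I" using I_add[OF b(3)] by fastforce
    then have "word [] c * word w 1 \<in> I" by (intro I_left letters_word) auto
    then show ?case by (simp add: word_mult)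
  qed (auto intro: I_add)
qed

end

context ext_fibre
begin

subsection \<open>The quotient ring and its filtration\<close>

abbreviation "R \<equiv> ext_algebra E x"
abbreviation "cl \<equiv> ext_class E x"

lemma ring_R: "ring R"
  unfolding ext_algebra_def by (rule ideal.quotient_is_ring[OF ideal_I])

lemma cl_closed: "a \<in> A \<Longrightarrow> cl a \<in> carrier R"
  unfolding ext_algebra_def ext_class_def carrier_free_algebra[symmetric]
  by (auto simp: FactRing_def A_RCOSETS_def')

lemma carrier_R: "p \<in> carrier R \<Longrightarrow> \<exists>a\<in>A. p = cl a"
  unfolding ext_algebra_def ext_class_def carrier_free_algebra[symmetric]
  by (auto simp: FactRing_def A_RCOSETS_def' a_r_coset_def')

lemma cl_hom: "cl \<in> ring_hom (free_algebra (fibre E x)) R"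
  using ideal.rcos_ring_hom[OF ideal_I] unfolding ext_algebra_def ext_class_def[abs_def] .

lemma cl_add: "a \<in> A \<Longrightarrow> b \<in> A \<Longrightarrow> cl a \<oplus>\<^bsub>R\<^esub> cl b = cl (a + b)"
  using ring_hom_add[OF cl_hom, of a b] by (simp add: carrier_free_algebra) (simp add: free_algebra_def)

lemma cl_mult: "a \<in> A \<Longrightarrow> b \<in> A \<Longrightarrow> cl a \<otimes>\<^bsub>R\<^esub> cl b = cl (a * b)"
  using ring_hom_mult[OF cl_hom, of a b] by (simp add: carrier_free_algebra) (simp add: free_algebra_def)

lemma cl_one: "\<one>\<^bsub>R\<^esub> = cl 1"
  using ring_hom_one[OF cl_hom] by (simp add: free_algebra_def)

lemma cl_zero: "\<zero>\<^bsub>R\<^esub> = cl 0"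
proof -
  interpret R: ring R by (rule ring_R)
  have "cl 0 \<oplus>\<^bsub>R\<^esub> cl 0 = cl 0" using cl_add[of 0 0] by simp
  then show ?thesis using R.add.r_cancel_one' cl_closed[OF letters_0] by fastforce
qed

lemma cl_uminus: "a \<in> A \<Longrightarrow> \<ominus>\<^bsub>R\<^esub> cl a = cl (- a)"
proof -
  assume a: "a \<in> A"
  interpret R: ring R by (rule ring_R)
  have "cl (- a) \<oplus>\<^bsub>R\<^esub> cl a = \<zero>\<^bsub>R\<^esub>" using cl_add[OF letters_uminus[OF a] a] by (simp add: cl_zero)
  then show ?thesis using R.minus_equality cl_closed a letters_uminus by blast
qed

lemma cl_diff: "a \<in> A \<Longrightarrow> b \<in> A \<Longrightarrow> cl a \<ominus>\<^bsub>R\<^esub> cl b = cl (a - b)"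
  using cl_add[OF _ letters_uminus, of a b] by (simp add: a_minus_def cl_uminus)

lemma cl_eq_zero: "a \<in> A \<Longrightarrow> cl a = cl 0 \<longleftrightarrow> a \<in> I"
proof -
  assume a: "a \<in> A"
  have z: "cl 0 = I"
    unfolding cl_zero[symmetric] by (simp add: ext_algebra_def FactRing_def)
  show ?thesis
    unfolding z unfolding ext_class_def
    using ideal.rcos_const_imp_mem[OF ideal_I, of a] abelian_subgroup.a_rcos_const[of I _ a] a
      ideal.axioms(1)[OF ideal_I]
    by (metis abelian_subgroupI3 carrier_free_algebra ideal_I ideal.axioms(2) ring.is_abelian_group)
qed

lemma cl_eq_iff: "a \<in> A \<Longrightarrow> b \<in> A \<Longrightarrow> cl a = cl b \<longleftrightarrow> a - b \<in> I"
proof -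
  assume a: "a \<in> A" and b: "b \<in> A"
  interpret R: ring R by (rule ring_R)
  have "cl a = cl b \<longleftrightarrow> cl a \<ominus>\<^bsub>R\<^esub> cl b = \<zero>\<^bsub>R\<^esub>"
    using R.minus_equality[of "cl a" "\<ominus>\<^bsub>R\<^esub> cl b"] cl_closed[OF a] cl_closed[OF b]
    by (auto simp: a_minus_def R.r_neg)
  then show ?thesis using cl_diff[OF a b] cl_eq_zero[OF letters_diff[OF a b]] by (simp add: cl_zero)
qed

text \<open>As \<open>I\<close> is graded, the degrees of a class can be read off any representative.\<close>

lemma cl_part_iff: "a \<in> A \<Longrightarrow> cl a \<in> ext_part E x P \<longleftrightarrow> len_part (\<lambda>n. \<not> P n) a \<in> I"
proof -
  assume a: "a \<in> A"
  have *: "ext_part E x P = cl ` {b \<in> A. b \<in> lengths P}"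
    by (simp add: ext_part_def carrier_free_algebra lengths_def)
  show ?thesis
  proof
    assume "cl a \<in> ext_part E x P"
    then obtain b where b: "b \<in> A" "b \<in> lengths P" "cl a = cl b" unfolding * by auto
    then have "len_part (\<lambda>n. \<not> P n) (a - b) \<in> I" using cl_eq_iff a by (intro I_len_part) auto
    moreover have "len_part (\<lambda>n. \<not> P n) b = 0" by (rule len_part_none[OF b(2)]) simp
    ultimately show "len_part (\<lambda>n. \<not> P n) a \<in> I" by (simp add: len_part_diff)
  next
    assume l: "len_part (\<lambda>n. \<not> P n) a \<in> I"
    have "a - len_part P a = len_part (\<lambda>n. \<not> P n) a" using len_part_split[of a P] by (simp add: algebra_simps)
    then have "cl a = cl (len_part P a)" using l a by (subst cl_eq_iff) (auto intro: letters_len_part)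
    then show "cl a \<in> ext_part E x P"
      unfolding * using a by (auto intro!: letters_len_part len_part_in)
  qed
qed

lemma cl_partI: "a \<in> A \<Longrightarrow> a \<in> lengths P \<Longrightarrow> cl a \<in> ext_part E x P"
  by (auto simp: ext_part_def carrier_free_algebra lengths_def)

lemma partE:
  assumes "p \<in> ext_part E x P"
  obtains a where "a \<in> A" "a \<in> lengths P" "p = cl a"
  using assms by (auto simp: ext_part_def carrier_free_algebra lengths_def)

lemma part_carrier: "p \<in> ext_part E x P \<Longrightarrow> p \<in> carrier R"
  by (auto elim!: partE intro: cl_closed)

lemma part_add: "p \<in> ext_part E x P \<Longrightarrow> q \<in> ext_part E x P \<Longrightarrow> p \<oplus>\<^bsub>R\<^esub> q \<in> ext_part E x P"
  by (auto elim!: partE simp: cl_add intro!: cl_partI letters_add lengths_add)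

lemma part_uminus: "p \<in> ext_part E x P \<Longrightarrow> \<ominus>\<^bsub>R\<^esub> p \<in> ext_part E x P"
  by (auto elim!: partE simp: cl_uminus intro!: cl_partI letters_uminus lengths_uminus)

lemma part_diff: "p \<in> ext_part E x P \<Longrightarrow> q \<in> ext_part E x P \<Longrightarrow> p \<ominus>\<^bsub>R\<^esub> q \<in> ext_part E x P"
  unfolding a_minus_def by (intro part_add part_uminus)

lemma part_mult:
  assumes "p \<in> ext_part E x P" "q \<in> ext_part E x Q" "\<And>i j. P i \<Longrightarrow> Q j \<Longrightarrow> S (i + j)"
  shows "p \<otimes>\<^bsub>R\<^esub> q \<in> ext_part E x S"
  using assms(1,2)
  by (auto elim!: partE simp: cl_mult intro!: cl_partI letters_mult lengths_mult[of _ P _ Q] assms(3))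

lemma part_mono: "p \<in> ext_part E x P \<Longrightarrow> (\<And>n. P n \<Longrightarrow> Q n) \<Longrightarrow> p \<in> ext_part E x Q"
  by (auto elim!: partE intro!: cl_partI intro: lengths_mono)

lemma part_zero: "\<zero>\<^bsub>R\<^esub> \<in> ext_part E x P"
  by (simp add: cl_zero cl_partI)

lemma part_all: "p \<in> carrier R \<Longrightarrow> p \<in> ext_part E x (\<lambda>i. 0 \<le> i)"
  by (drule carrier_R) (auto intro!: cl_partI simp: lengths_def)

lemma part_disjoint:
  assumes "p \<in> ext_part E x P" "p \<in> ext_part E x Q" "\<And>n. P n \<Longrightarrow> \<not> Q n"
  shows "p = \<zero>\<^bsub>R\<^esub>"
proof -
  obtain a where a: "a \<in> A" "a \<in> lengths P" "p = cl a" by (rule partE[OF assms(1)])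
  have "len_part (\<lambda>n. \<not> Q n) a \<in> I" using assms(2) a cl_part_iff by simp
  moreover have "len_part (\<lambda>n. \<not> Q n) a = a"
    by (rule len_part_id) (use assms(3) in \<open>auto intro: lengths_mono[OF a(2)]\<close>)
  ultimately show ?thesis using a cl_eq_zero by (simp add: cl_zero)
qed

text \<open>An even element has no component of the odd degree \<open>k\<close>.\<close>

lemma part_even_step:
  assumes p: "p \<in> ext_part E x even" and q: "p \<in> ext_part E x (\<lambda>j. k \<le> j)" and k: "odd k"
  shows "p \<in> ext_part E x (\<lambda>j. k + 1 \<le> j)"
proof -
  obtain a where a: "a \<in> A" "a \<in> lengths even" "p = cl a" by (rule partE[OF p])
  have "len_part (\<lambda>n. \<not> k \<le> n) a \<in> I" using q a cl_part_iff by simp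
  moreover have "len_part (\<lambda>n. \<not> k \<le> n) a = len_part (\<lambda>n. \<not> k + 1 \<le> n) a"
  proof (rule poly_mapping_eqI)
    fix w show "Poly_Mapping.lookup (len_part (\<lambda>n. \<not> k \<le> n) a) w = Poly_Mapping.lookup (len_part (\<lambda>n. \<not> k + 1 \<le> n) a) w"
      using a(2) k by (cases "length w = k") (auto simp: lookup_len_part lengths_def in_keys_iff)
  qed
  ultimately show ?thesis using a cl_part_iff by simp
qed

end

section \<open>Holomorphic functions and sections\<close>

lemma topspace_cspace: "topspace (cspace n) = {z. \<forall>i\<ge>n. z i = 0}"
  by (simp add: cspace_def)

lemma continuous_map_complex_mult:
  fixes f g :: "'a \<Rightarrow> complex"
  assumes "continuous_map X euclidean f" "continuous_map X euclidean g"
  shows "continuous_map X euclidean (\<lambda>x. f x * g x)"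
  using assms by (simp add: continuous_map_atin tendsto_mult)

lemma holo_cspace_mono: "holo_cspace n D f \<Longrightarrow> D' \<subseteq> D \<Longrightarrow> holo_cspace n D' f"
  unfolding holo_cspace_def by (blast intro: continuous_map_from_subtopology_mono)

lemma holo_cspace_const: "holo_cspace n D (\<lambda>_. c)"
  by (simp add: holo_cspace_def)

lemma holo_cspace_add: "holo_cspace n D f \<Longrightarrow> holo_cspace n D g \<Longrightarrow> holo_cspace n D (\<lambda>z. f z + g z)"
  unfolding holo_cspace_def by (auto intro!: continuous_map_add field_differentiable_add)

lemma holo_cspace_mult: "holo_cspace n D f \<Longrightarrow> holo_cspace n D g \<Longrightarrow> holo_cspace n D (\<lambda>z. f z * g z)"
  unfolding holo_cspace_def
  by (auto intro!: field_differentiable_mult continuous_map_complex_mult)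

lemma holo_cspace_cong:
  assumes D: "openin (cspace n) D" and eq: "\<And>z. z \<in> D \<Longrightarrow> f z = g z" and f: "holo_cspace n D f"
  shows "holo_cspace n D g"
  unfolding holo_cspace_def
proof (intro conjI ballI allI impI)
  have s: "topspace (subtopology (cspace n) D) = D"
    using openin_subset[OF D] by auto
  show "continuous_map (subtopology (cspace n) D) euclidean g"
    using f unfolding holo_cspace_def
    by (auto intro: continuous_map_eq[of _ _ f] simp: eq s)
  fix z i assume z: "z \<in> D" and i: "i < n"
  have zt: "\<forall>i\<ge>n. z i = 0" using z openin_subset[OF D] by (auto simp: topspace_cspace)
  \<comment> \<open>Complex differentiability is a local matter, and the coordinate line meets \<open>D\<close> in an open set.\<close>
  have "continuous_map euclidean (cspace n) (\<lambda>t. z(i := t))"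
    unfolding cspace_def continuous_map_in_subtopology
    using zt i by (auto simp: continuous_map_componentwise_UNIV)
  then have "open {t. z(i := t) \<in> D}"
    using openin_continuous_map_preimage[OF _ D] by fastforce
  moreover have "(\<lambda>t. f (z(i := t))) field_differentiable at (z i)"
    using f z i by (simp add: holo_cspace_def)
  ultimately show "(\<lambda>t. g (z(i := t))) field_differentiable at (z i)"
    using z eq has_field_derivative_transform_within_open[of "\<lambda>t. f (z(i := t))" _ "z i" "{t. z(i := t) \<in> D}"
        "\<lambda>t. g (z(i := t))"] unfolding field_differentiable_def by fastforce
qed

lemma holo_fun_mono: "holo_fun M W f \<Longrightarrow> W' \<subseteq> W \<Longrightarrow> holo_fun M W' f"
  unfolding holo_fun_def by (fast intro: holo_cspace_mono)

lemma holo_fun_const: "holo_fun M W (\<lambda>_. c)"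
  by (auto simp: holo_fun_def holo_cspace_const)

lemma holo_fun_add: "holo_fun M W f \<Longrightarrow> holo_fun M W g \<Longrightarrow> holo_fun M W (\<lambda>x. f x + g x)"
  unfolding holo_fun_def by (auto intro!: holo_cspace_add)

lemma holo_fun_mult: "holo_fun M W f \<Longrightarrow> holo_fun M W g \<Longrightarrow> holo_fun M W (\<lambda>x. f x * g x)"
  unfolding holo_fun_def by (auto intro!: holo_cspace_mult)

locale model =
  fixes M :: "'x cmanifold" and E :: "('x, 'e) vbundle"
  assumes complex_manifold: "complex_manifold M"
    and vector_bundle: "holomorphic_vector_bundle M E"
begin

abbreviation "X \<equiv> mtop M"
abbreviation "r \<equiv> vrank E"

lemma holo_fun_cong:
  assumes W: "openin X W" and eq: "\<And>x. x \<in> W \<Longrightarrow> f x = g x" and f: "holo_fun M W f"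
  shows "holo_fun M W g"
  unfolding holo_fun_def
proof (clarify, rule holo_cspace_cong)
  fix U \<phi> assume c: "(U, \<phi>) \<in> charts M"
  have U: "openin X U" and oU: "openin (cspace (mdim M)) (\<phi> ` U)"
    and h: "homeomorphic_map (subtopology X U) (subtopology (cspace (mdim M)) (\<phi> ` U)) \<phi>"
    using c complex_manifold unfolding complex_manifold_def by auto
  have ts: "topspace (subtopology X U) = U" using openin_subset[OF U] by auto
  have inj: "inj_on \<phi> U" using homeomorphic_imp_injective_map[OF h] unfolding ts .
  have "openin (subtopology X U) (W \<inter> U)" using W by (simp add: openin_subtopology_Int)
  then have "openin (subtopology (cspace (mdim M)) (\<phi> ` U)) (\<phi> ` (W \<inter> U))"
    using homeomorphic_imp_open_map[OF h] by (simp add: open_map_def)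
  then show "openin (cspace (mdim M)) (\<phi> ` (W \<inter> U))"
    using openin_trans_full oU by blast
  show "holo_cspace (mdim M) (\<phi> ` (W \<inter> U)) (\<lambda>z. f (inv_into U \<phi> z))"
    using f c by (auto simp: holo_fun_def)
  show "f (inv_into U \<phi> z) = g (inv_into U \<phi> z)" if "z \<in> \<phi> ` (W \<inter> U)" for z
    using that inj eq by auto
qed

lemma triv_open: "(U, h) \<in> trivs E \<Longrightarrow> openin X U"
  using vector_bundle unfolding holomorphic_vector_bundle_def by auto

lemma triv_exists:
  assumes "x \<in> topspace X"
  shows "\<exists>U h. (U, h) \<in> trivs E \<and> x \<in> U"
proof -
  have "(\<Union>(U, h)\<in>trivs E. U) = topspace X"
    using vector_bundle unfolding holomorphic_vector_bundle_def by (elim conjE)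
  then show ?thesis using assms by blast
qed

lemma fibre_closed:
  assumes "x \<in> topspace X" "u \<in> fibre E x"
  shows "v \<in> fibre E x \<Longrightarrow> vadd E u v \<in> fibre E x" and "vscale E c u \<in> fibre E x"
  using assms vector_bundle unfolding holomorphic_vector_bundle_def by auto

lemma ext_fibre: "x \<in> topspace X \<Longrightarrow> ext_fibre E x"
  by unfold_locales (auto intro: fibre_closed)

lemma triv:
  assumes "(U, h) \<in> trivs E" "x \<in> U"
  shows triv_bij: "bij_betw h (fibre E x) (topspace (cspace r))"
    and triv_add: "\<lbrakk>u \<in> fibre E x; v \<in> fibre E x\<rbrakk> \<Longrightarrow> h (vadd E u v) = (\<lambda>i. h u i + h v i)"
    and triv_scale: "u \<in> fibre E x \<Longrightarrow> h (vscale E c u) = (\<lambda>i. c * h u i)"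
proof -
  have "\<forall>(U, h)\<in>trivs E. openin X U \<and> (\<forall>x\<in>U. bij_betw h (fibre E x) (topspace (cspace r)) \<and>
      (\<forall>u\<in>fibre E x. \<forall>v\<in>fibre E x. h (vadd E u v) = (\<lambda>i. h u i + h v i)) \<and>
      (\<forall>c. \<forall>u\<in>fibre E x. h (vscale E c u) = (\<lambda>i. c * h u i)))"
    using vector_bundle unfolding holomorphic_vector_bundle_def by (elim conjE)
  from bspec[OF this assms(1), simplified] assms(2)
  have "bij_betw h (fibre E x) (topspace (cspace r)) \<and>
      (\<forall>u\<in>fibre E x. \<forall>v\<in>fibre E x. h (vadd E u v) = (\<lambda>i. h u i + h v i)) \<and>
      (\<forall>c. \<forall>u\<in>fibre E x. h (vscale E c u) = (\<lambda>i. c * h u i))" by blast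
  then show "bij_betw h (fibre E x) (topspace (cspace r))"
    and "\<lbrakk>u \<in> fibre E x; v \<in> fibre E x\<rbrakk> \<Longrightarrow> h (vadd E u v) = (\<lambda>i. h u i + h v i)"
    and "u \<in> fibre E x \<Longrightarrow> h (vscale E c u) = (\<lambda>i. c * h u i)" by blast+
qed

lemma transition_holo:
  assumes "(U, h) \<in> trivs E" "(V, k) \<in> trivs E" "a < r" "b < r"
  shows "holo_fun M (U \<inter> V) (\<lambda>x. k (inv_into (fibre E x) h (unit_vec a)) b)"
proof -
  have "\<forall>(U, h)\<in>trivs E. \<forall>(V, k)\<in>trivs E. \<forall>a<r. \<forall>b<r.
      holo_fun M (U \<inter> V) (\<lambda>x. k (inv_into (fibre E x) h (unit_vec a)) b)"
    using vector_bundle unfolding holomorphic_vector_bundle_def by (elim conjE)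
  from bspec[OF this assms(1), simplified] assms(2-4) show ?thesis by blast
qed

lemma holo_section_mono: "holo_section M E W u \<Longrightarrow> W' \<subseteq> W \<Longrightarrow> holo_section M E W' u"
  unfolding holo_section_def by (fast intro: holo_fun_mono)

lemma holo_section_fibre: "holo_section M E W u \<Longrightarrow> x \<in> W \<Longrightarrow> u x \<in> fibre E x"
  by (simp add: holo_section_def)

lemma holo_section_coord: "\<lbrakk>holo_section M E W u; (U, h) \<in> trivs E; W \<subseteq> U; a < r\<rbrakk> \<Longrightarrow> holo_fun M W (\<lambda>x. h (u x) a)"
  unfolding holo_section_def by (auto simp: Int_absorb2)

lemma holo_section_add:
  assumes W: "openin X W" and u: "holo_section M E W u" and v: "holo_section M E W v"
  shows "holo_section M E W (\<lambda>x. vadd E (u x) (v x))"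
  unfolding holo_section_def
proof (intro conjI ballI, goal_cases)
  case (1 x)
  then show ?case using fibre_closed(1) openin_subset[OF W] u v by (auto simp: holo_section_def)
next
  case (2 t)
  obtain U h where t: "t = (U, h)" by (cases t)
  have c: "(U, h) \<in> trivs E" using 2 t by simp
  have o: "openin X (W \<inter> U)" using W triv_open[OF c] by auto
  have eq: "h (u x) a + h (v x) a = h (vadd E (u x) (v x)) a" if "x \<in> W \<inter> U" for x a
    using triv_add[OF c, of x "u x" "v x"] that holo_section_fibre[OF u] holo_section_fibre[OF v] by simp
  have f: "holo_fun M (W \<inter> U) (\<lambda>x. h (u x) a + h (v x) a)" if "a < r" for a
    using u v c that unfolding holo_section_def by (intro holo_fun_add) auto
  have "holo_fun M (W \<inter> U) (\<lambda>x. h (vadd E (u x) (v x)) a)" if "a < r" for a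
    by (rule holo_fun_cong[OF o eq f[OF that]])
  then show ?case by (simp add: t)
qed

lemma holo_section_scale:
  assumes W: "openin X W" and u: "holo_section M E W u"
  shows "holo_section M E W (\<lambda>x. vscale E z (u x))"
  unfolding holo_section_def
proof (intro conjI ballI, goal_cases)
  case (1 x)
  then show ?case using fibre_closed(2) openin_subset[OF W] u by (auto simp: holo_section_def)
next
  case (2 t)
  obtain U h where t: "t = (U, h)" by (cases t)
  have c: "(U, h) \<in> trivs E" using 2 t by simp
  have o: "openin X (W \<inter> U)" using W triv_open[OF c] by auto
  have eq: "z * h (u x) a = h (vscale E z (u x)) a" if "x \<in> W \<inter> U" for x a
    using triv_scale[OF c, of x "u x"] that holo_section_fibre[OF u] by simp
  have f: "holo_fun M (W \<inter> U) (\<lambda>x. z * h (u x) a)" if "a < r" for a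
    using u c that unfolding holo_section_def by (intro holo_fun_mult holo_fun_const) auto
  have "holo_fun M (W \<inter> U) (\<lambda>x. h (vscale E z (u x)) a)" if "a < r" for a
    by (rule holo_fun_cong[OF o eq f[OF that]])
  then show ?case by (simp add: t)
qed

definition frame :: "('e \<Rightarrow> nat \<Rightarrow> complex) \<Rightarrow> nat \<Rightarrow> 'x \<Rightarrow> 'e" where
  "frame h a x = inv_into (fibre E x) h (unit_vec a)"

lemma triv_inv:
  assumes "(U, h) \<in> trivs E" "x \<in> U" "\<And>i. i \<ge> r \<Longrightarrow> c i = 0"
  shows "inv_into (fibre E x) h c \<in> fibre E x" and "h (inv_into (fibre E x) h c) = c"
proof -
  have "c \<in> h ` fibre E x"
    using bij_betw_imp_surj_on[OF triv_bij[OF assms(1,2)]] assms(3) by (simp add: topspace_cspace)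
  then show "inv_into (fibre E x) h c \<in> fibre E x" and "h (inv_into (fibre E x) h c) = c"
    by (auto intro: inv_into_into f_inv_into_f)
qed

lemma frame_fibre: "\<lbrakk>(U, h) \<in> trivs E; x \<in> U; a < r\<rbrakk> \<Longrightarrow> frame h a x \<in> fibre E x"
  and frame_coord: "\<lbrakk>(U, h) \<in> trivs E; x \<in> U; a < r\<rbrakk> \<Longrightarrow> h (frame h a x) = unit_vec a"
  unfolding frame_def by (auto intro!: triv_inv simp: unit_vec_def)

lemma triv_coord: "\<lbrakk>(U, h) \<in> trivs E; x \<in> U; v \<in> fibre E x; i \<ge> r\<rbrakk> \<Longrightarrow> h v i = 0"
  using bij_betw_imp_surj_on[OF triv_bij] by (fastforce simp: topspace_cspace)

lemma triv_inj: "\<lbrakk>(U, h) \<in> trivs E; x \<in> U; u \<in> fibre E x; v \<in> fibre E x; h u = h v\<rbrakk> \<Longrightarrow> u = v"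
  using bij_betw_imp_inj_on[OF triv_bij] by (auto dest: inj_onD)

lemma frame_holo:
  assumes c: "(U, h) \<in> trivs E" and a: "a < r"
  shows "holo_section M E U (frame h a)"
  unfolding holo_section_def using frame_fibre[OF c _ a] transition_holo[OF c _ a]
  by (auto simp: frame_def)

text \<open>Adding multiples of the frame vectors one at a time produces a vector with the coordinates of
  \<open>v\<close>, and a vector is determined by its coordinates. Each addition is a relation of the exterior
  algebra.\<close>

lemma frame_expansion:
  assumes c: "(U, h) \<in> trivs E" and x: "x \<in> U" and v: "v \<in> fibre E x"
  shows "word [v] 1 - (\<Sum>a<r. word [frame h a x] (h v a)) \<in> ext_ideal E x"
proof -
  interpret ext_fibre E x using ext_fibre openin_subset[OF triv_open[OF c]] x by auto
  have "\<exists>u\<in>fibre E x. h u = (\<lambda>i. if i < m then h v i else 0) \<and>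
      word [u] 1 - (\<Sum>a<m. word [frame h a x] (h v a)) \<in> I" if "m \<le> r" for m
    using that
  proof (induction m)
    case 0
    have "h (vscale E 0 v) = (\<lambda>i. 0)" using triv_scale[OF c x v] by simp
    then show ?case using v vscale_closed[OF v] I_vscale[OF v, of 0] by (intro bexI[of _ "vscale E 0 v"]) auto
  next
    case (Suc m)
    then obtain u where u: "u \<in> fibre E x" "h u = (\<lambda>i. if i < m then h v i else 0)"
        "word [u] 1 - (\<Sum>a<m. word [frame h a x] (h v a)) \<in> I" by auto
    let ?e = "frame h m x" and ?w = "vscale E (h v m) (frame h m x)"
    have e: "?e \<in> fibre E x" "h ?e = unit_vec m" using frame_fibre[OF c x] frame_coord[OF c x] Suc.prems by auto
    have w: "?w \<in> fibre E x" using vscale_closed e by auto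
    have "word [vadd E u ?w] 1 - (\<Sum>a<Suc m. word [frame h a x] (h v a))
        = (word [vadd E u ?w] 1 - word [u] 1 - word [?w] 1) + (word [u] 1 - (\<Sum>a<m. word [frame h a x] (h v a)))
          + (word [?w] 1 - word [?e] (h v m))" by simp
    also have "\<dots> \<in> I" by (intro I_add I_vadd I_vscale u w e)
    finally show ?case
      using triv_add[OF c x u(1) w] triv_scale[OF c x e(1)] u(1,2) e w vadd_closed[OF u(1) w]
      by (intro bexI[of _ "vadd E u ?w"]) (auto simp: unit_vec_def less_Suc_eq)
  qed
  from this[of r] obtain u where u: "u \<in> fibre E x" "h u = (\<lambda>i. if i < r then h v i else 0)"
      "word [u] 1 - (\<Sum>a<r. word [frame h a x] (h v a)) \<in> I" by auto
  have "h u = h v" using u(2) triv_coord[OF c x v] by (auto simp: fun_eq_iff)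
  then show ?thesis using triv_inj[OF c x u(1) v] u(3) by simp
qed

lemma high_powers_vanish:
  assumes x: "x \<in> topspace X" and p: "p \<in> ext_part E x (\<lambda>j. Suc r \<le> j)"
  shows "p = \<zero>\<^bsub>ext_algebra E x\<^esub>"
proof -
  interpret ext_fibre E x by (rule ext_fibre[OF x])
  obtain U h where c: "(U, h) \<in> trivs E" "x \<in> U" using triv_exists[OF x] by auto
  obtain a where a: "a \<in> A" "a \<in> lengths (\<lambda>j. Suc r \<le> j)" "p = cl a" by (rule partE[OF p])
  let ?B = "(\<lambda>i. frame h i x) ` {..<r}"
  have "inj_on (\<lambda>i. frame h i x) {..<r}"
  proof (rule inj_onI)
    fix i j assume "i \<in> {..<r}" "j \<in> {..<r}" "frame h i x = frame h j x"
    then have "unit_vec i = unit_vec j" using frame_coord[OF c] by (metis lessThan_iff)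
    then show "i = j" by (metis unit_vec_def zero_neq_one)
  qed
  then have B: "card ?B = r" "(\<Sum>b\<in>?B. word [b] (f b)) = (\<Sum>i<r. word [frame h i x] (f (frame h i x)))" for f
    by (auto simp: card_image sum.reindex)
  have "a \<in> I"
  proof (rule long_words_vanish[of ?B])
    fix v assume v: "v \<in> fibre E x"
    \<comment> \<open>The coordinate of \<open>v\<close> that belongs to the frame vector \<open>b\<close>.\<close>
    define f where "f b = h v (THE i. i < r \<and> b = frame h i x)" for b
    have "f (frame h i x) = h v i" if "i < r" for i
    proof -
      have "(THE j. j < r \<and> frame h i x = frame h j x) = i"
        using that \<open>inj_on (\<lambda>i. frame h i x) {..<r}\<close> by (intro the_equality) (auto dest: inj_onD)
      then show ?thesis by (simp add: f_def)
    qed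
    then show "\<exists>f. word [v] 1 - (\<Sum>b\<in>?B. word [b] (f b)) \<in> I"
      using frame_expansion[OF c v] B(2)[of f] by (intro exI[of _ f]) simp
  qed (use a B(1) frame_fibre[OF c] in auto)
  then show ?thesis using a cl_eq_zero by (simp add: cl_zero)
qed

text \<open>In every other trivialisation the zero vector has coordinates zero as well, because it is fixed
  by multiplication with the scalar zero.\<close>

lemma zero_section_holo:
  assumes c: "(U, h) \<in> trivs E"
  shows "holo_section M E U (\<lambda>x. inv_into (fibre E x) h (\<lambda>_. 0))"
  unfolding holo_section_def
proof (intro conjI ballI, goal_cases)
  case (1 x)
  then show ?case using triv_inv(1)[OF c] by simp
next
  case (2 t)
  obtain V k where t: "t = (V, k)" by (cases t)
  have d: "(V, k) \<in> trivs E" using 2 t by simp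
  have o: "openin X (U \<inter> V)" using triv_open[OF c] triv_open[OF d] by auto
  have "0 = k (inv_into (fibre E x) h (\<lambda>_. 0)) a" if x: "x \<in> U \<inter> V" for x a
  proof -
    let ?z = "inv_into (fibre E x) h (\<lambda>_. 0)"
    have xU: "x \<in> U" and xV: "x \<in> V" and xt: "x \<in> topspace X"
      using x openin_subset[OF o] by auto
    have z: "?z \<in> fibre E x" "h ?z = (\<lambda>_. 0)" using triv_inv[OF c xU, of "\<lambda>_. 0"] by auto
    have "vscale E 0 ?z = ?z"
      using triv_scale[OF c xU z(1), of 0] z fibre_closed(2)[OF xt z(1)] by (intro triv_inj[OF c xU]) auto
    then have "k ?z = (\<lambda>i. 0)" using triv_scale[OF d xV z(1), of 0] by simp
    then show ?thesis by simp
  qed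
  then have "holo_fun M (U \<inter> V) (\<lambda>x. k (inv_into (fibre E x) h (\<lambda>_. 0)) a)" for a
    by (rule holo_fun_cong[OF o _ holo_fun_const])
  then show ?case by (simp add: t)
qed

text \<open>The extension has constant coordinates. It is assembled from the zero section and the frame,
  because sums and multiples of holomorphic sections are holomorphic.\<close>

lemma vector_extends:
  assumes c: "(U, h) \<in> trivs E" and x: "x \<in> U" and v: "v \<in> fibre E x"
  shows "\<exists>u. holo_section M E U u \<and> u x = v"
proof -
  have o: "openin X U" by (rule triv_open[OF c])
  have "\<exists>u. holo_section M E U u \<and> h (u x) = (\<lambda>i. if i < m then h v i else 0)" if "m \<le> r" for m
    using that
  proof (induction m)
    case 0
    show ?case using zero_section_holo[OF c] triv_inv(2)[OF c x, of "\<lambda>_. 0"] by auto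
  next
    case (Suc m)
    then obtain u where u: "holo_section M E U u" "h (u x) = (\<lambda>i. if i < m then h v i else 0)" by auto
    let ?w = "\<lambda>y. vscale E (h v m) (frame h m y)"
    have w: "holo_section M E U ?w" using Suc.prems by (intro holo_section_scale o frame_holo[OF c]) auto
    have "h (vadd E (u x) (?w x)) = (\<lambda>i. if i < Suc m then h v i else 0)"
      using triv_add[OF c x holo_section_fibre[OF u(1) x] holo_section_fibre[OF w x]]
        triv_scale[OF c x frame_fibre[OF c x]] frame_coord[OF c x] u(2) Suc.prems
      by (auto simp: unit_vec_def less_Suc_eq)
    then show ?case using holo_section_add[OF o u(1) w] by blast
  qed
  from this[of r] obtain u where u: "holo_section M E U u" "h (u x) = (\<lambda>i. if i < r then h v i else 0)" by auto
  have "h (u x) = h v" using u(2) triv_coord[OF c x v] by (auto simp: fun_eq_iff)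
  then show ?thesis using triv_inj[OF c x holo_section_fibre[OF u(1) x] v] u(1) by auto
qed

end

section \<open>Sections of the exterior algebra\<close>

definition terms_at :: "(('x \<Rightarrow> complex) \<times> ('x \<Rightarrow> 'e) list) list \<Rightarrow> 'x \<Rightarrow> ('e list \<Rightarrow>\<^sub>0 complex)" where
  "terms_at ts y = (\<Sum>(f, us)\<leftarrow>ts. word (map (\<lambda>u. u y) us) (f y))"

lemma terms_at_simps [simp]:
  "terms_at [] y = 0"
  "terms_at ((f, us) # ts) y = word (map (\<lambda>u. u y) us) (f y) + terms_at ts y"
  "terms_at (ts @ ts') y = terms_at ts y + terms_at ts' y"
  by (simp_all add: terms_at_def)

lemma len_part_terms_at:
  "len_part P (terms_at ts y) = terms_at (filter (\<lambda>(f, us). P (length us)) ts) y"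
  by (induction ts) (auto simp: len_part_add len_part_word split: prod.split)

definition mult_terms where
  "mult_terms ts ts' = concat (map (\<lambda>(f, us). map (\<lambda>(g, vs). (\<lambda>x. f x * g x, us @ vs)) ts') ts)"

lemma terms_at_mult: "terms_at (mult_terms ts ts') y = terms_at ts y * terms_at ts' y"
proof (induction ts)
  case (Cons t ts)
  obtain f us where t: "t = (f, us)" by (cases t)
  have "terms_at (map (\<lambda>(g, vs). (\<lambda>x. f x * g x, us @ vs)) ts') y = word (map (\<lambda>u. u y) us) (f y) * terms_at ts' y"
    by (induction ts') (auto simp: word_mult distrib_left)
  with Cons show ?case by (simp add: t mult_terms_def distrib_right)
qed (simp add: mult_terms_def)

definition scale_terms where
  "scale_terms c ts = map (\<lambda>(f, us). (\<lambda>x. c * f x, us)) ts"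

lemma terms_at_scale: "terms_at (scale_terms c ts) y = word [] c * terms_at ts y"
  by (induction ts) (auto simp: scale_terms_def word_mult distrib_left)

context model
begin

definition holo_terms :: "'x set \<Rightarrow> (('x \<Rightarrow> complex) \<times> ('x \<Rightarrow> 'e) list) list \<Rightarrow> bool" where
  "holo_terms W ts \<longleftrightarrow> (\<forall>(f, us)\<in>set ts. holo_fun M W f \<and> (\<forall>u\<in>set us. holo_section M E W u))"

lemma holo_terms_simps [simp]:
  "holo_terms W []"
  "holo_terms W ((f, us) # ts) \<longleftrightarrow> holo_fun M W f \<and> (\<forall>u\<in>set us. holo_section M E W u) \<and> holo_terms W ts"
  "holo_terms W (ts @ ts') \<longleftrightarrow> holo_terms W ts \<and> holo_terms W ts'"
  by (auto simp: holo_terms_def)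

lemma holo_terms_mono: "holo_terms W ts \<Longrightarrow> W' \<subseteq> W \<Longrightarrow> holo_terms W' ts"
  unfolding holo_terms_def by (fast intro: holo_fun_mono holo_section_mono)

lemma holo_terms_filter: "holo_terms W ts \<Longrightarrow> holo_terms W (filter P ts)"
  by (auto simp: holo_terms_def)

lemma holo_terms_mult: "holo_terms W ts \<Longrightarrow> holo_terms W ts' \<Longrightarrow> holo_terms W (mult_terms ts ts')"
  unfolding holo_terms_def mult_terms_def by (fastforce intro!: holo_fun_mult)

lemma holo_terms_scale: "holo_terms W ts \<Longrightarrow> holo_terms W (scale_terms c ts)"
  unfolding holo_terms_def scale_terms_def by (auto intro!: holo_fun_mult holo_fun_const)

lemma terms_at_letters: "holo_terms W ts \<Longrightarrow> y \<in> W \<Longrightarrow> terms_at ts y \<in> letters (fibre E y)"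
proof (induction ts)
  case (Cons t ts)
  have "u y \<in> fibre E y" if "holo_section M E W u" for u
    by (rule holo_section_fibre[OF that Cons.prems(2)])
  with Cons show ?case
    by (cases t) (auto intro!: letters_add letters_word)
qed simp

abbreviation "sring \<equiv> ext_section_ring M E"
abbreviation "Sec \<equiv> ext_sections M E"

lemma sec_at [simp]:
  "x \<in> U \<Longrightarrow> (s \<otimes>\<^bsub>sring U\<^esub> t) x = s x \<otimes>\<^bsub>ext_algebra E x\<^esub> t x"
  "x \<in> U \<Longrightarrow> (s \<oplus>\<^bsub>sring U\<^esub> t) x = s x \<oplus>\<^bsub>ext_algebra E x\<^esub> t x"
  "x \<in> U \<Longrightarrow> \<one>\<^bsub>sring U\<^esub> x = \<one>\<^bsub>ext_algebra E x\<^esub>"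
  by (simp_all add: ext_section_ring_def)

definition sec_diff :: "'x set \<Rightarrow> ('x, 'e) ext_section \<Rightarrow> ('x, 'e) ext_section \<Rightarrow> ('x, 'e) ext_section" where
  "sec_diff U s t = (\<lambda>x\<in>U. s x \<ominus>\<^bsub>ext_algebra E x\<^esub> t x)"

lemma carrier_sring: "carrier (sring U) = Sec U"
  by (simp add: ext_section_ring_def)

lemma open_sub: "openin X U \<Longrightarrow> x \<in> U \<Longrightarrow> x \<in> topspace X"
  using openin_subset by blast

lemma sectionI:
  assumes U: "openin X U" and ext: "s \<in> extensional U"
    and loc: "\<And>x. x \<in> U \<Longrightarrow> \<exists>W\<in>opens X U. x \<in> W \<and>
      (\<exists>ts. holo_terms W ts \<and> (\<forall>y\<in>W. s y = ext_class E y (terms_at ts y)))"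
  shows "s \<in> Sec U"
  unfolding ext_sections_def
proof (intro CollectI conjI ballI)
  show "s \<in> (\<Pi>\<^sub>E x\<in>U. carrier (ext_algebra E x))"
  proof (rule PiE_I)
    fix x assume x: "x \<in> U"
    obtain W where W: "x \<in> W" "\<exists>ts. holo_terms W ts \<and> (\<forall>y\<in>W. s y = ext_class E y (terms_at ts y))"
      by (rule bexE[OF loc[OF x]]) (elim conjE)
    obtain ts where ts: "holo_terms W ts" "s x = ext_class E x (terms_at ts x)"
      using W by (elim exE conjE) simp
    show "s x \<in> carrier (ext_algebra E x)"
      unfolding ts(2)
      by (rule ext_fibre.cl_closed[OF ext_fibre[OF open_sub[OF U x]] terms_at_letters[OF ts(1) W(1)]])
  qed (rule extensional_arb[OF ext])
  fix x assume "x \<in> U"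
  from loc[OF this] show "\<exists>W\<in>opens X U. x \<in> W \<and>
      (\<exists>terms. (\<forall>(f, us)\<in>set terms. holo_fun M W f \<and> (\<forall>u\<in>set us. holo_section M E W u)) \<and>
        (\<forall>y\<in>W. s y = ext_class E y (\<Sum>(f, us)\<leftarrow>terms. Poly_Mapping.single (map (\<lambda>u. u y) us) (f y))))"
    unfolding holo_terms_def terms_at_def .
qed

lemma sectionE:
  assumes "s \<in> Sec U" "x \<in> U"
  obtains W ts where "W \<in> opens X U" "x \<in> W" "holo_terms W ts" "\<And>y. y \<in> W \<Longrightarrow> s y = ext_class E y (terms_at ts y)"
proof -
  have "\<exists>W\<in>opens X U. x \<in> W \<and>
      (\<exists>ts. holo_terms W ts \<and> (\<forall>y\<in>W. s y = ext_class E y (terms_at ts y)))"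
    using assms unfolding ext_sections_def holo_terms_def terms_at_def by blast
  then show ?thesis using that by blast
qed

lemma section_carrier: "s \<in> Sec U \<Longrightarrow> x \<in> U \<Longrightarrow> s x \<in> carrier (ext_algebra E x)"
  unfolding ext_sections_def by (auto dest: PiE_mem)

lemma section_ext: "s \<in> Sec U \<Longrightarrow> s \<in> extensional U"
  unfolding ext_sections_def by (auto simp: PiE_def)

lemma section_eqI: "\<lbrakk>s \<in> Sec U; t \<in> Sec U; \<And>x. x \<in> U \<Longrightarrow> s x = t x\<rbrakk> \<Longrightarrow> s = t"
  by (rule extensionalityI[OF section_ext section_ext])

lemma section2E:
  assumes s: "s \<in> Sec U" and t: "t \<in> Sec U" and x: "x \<in> U"
  obtains W ts ts' where "W \<in> opens X U" "x \<in> W" "holo_terms W ts" "holo_terms W ts'"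
    "\<And>y. y \<in> W \<Longrightarrow> s y = ext_class E y (terms_at ts y)"
    "\<And>y. y \<in> W \<Longrightarrow> t y = ext_class E y (terms_at ts' y)"
proof -
  obtain W ts where W: "W \<in> opens X U" "x \<in> W" "holo_terms W ts" "\<And>y. y \<in> W \<Longrightarrow> s y = ext_class E y (terms_at ts y)"
    by (rule sectionE[OF s x]) blast
  obtain W' ts' where W': "W' \<in> opens X U" "x \<in> W'" "holo_terms W' ts'" "\<And>y. y \<in> W' \<Longrightarrow> t y = ext_class E y (terms_at ts' y)"
    by (rule sectionE[OF t x]) blast
  show ?thesis
    by (rule that[of "W \<inter> W'" ts ts'])
      (use W W' holo_terms_mono in \<open>auto simp: opens_def\<close>)
qed

text \<open>Products, sums and differences of sections are treated alike: each is induced by an operation on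
  lists of terms.\<close>

lemma section_op:
  assumes U: "openin X U" and s: "s \<in> Sec U" and t: "t \<in> Sec U"
    and op: "\<And>W ts ts'. \<lbrakk>holo_terms W ts; holo_terms W ts'\<rbrakk> \<Longrightarrow> holo_terms W (op ts ts')"
    and eq: "\<And>y a b. \<lbrakk>y \<in> U; a \<in> letters (fibre E y); b \<in> letters (fibre E y)\<rbrakk> \<Longrightarrow>
      q y (ext_class E y a) (ext_class E y b) = ext_class E y (p a b)"
    and at: "\<And>ts ts' y. terms_at (op ts ts') y = p (terms_at ts y) (terms_at ts' y)"
  shows "(\<lambda>x\<in>U. q x (s x) (t x)) \<in> Sec U"
proof (rule sectionI[OF U])
  fix x assume "x \<in> U"
  with s t obtain W ts ts' where W: "W \<in> opens X U" "x \<in> W" "holo_terms W ts" "holo_terms W ts'"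
      and sy: "\<And>y. y \<in> W \<Longrightarrow> s y = ext_class E y (terms_at ts y)"
      and ty: "\<And>y. y \<in> W \<Longrightarrow> t y = ext_class E y (terms_at ts' y)"
    by (rule section2E) blast
  have "(\<lambda>x\<in>U. q x (s x) (t x)) y = ext_class E y (terms_at (op ts ts') y)" if y: "y \<in> W" for y
  proof -
    have "y \<in> U" using y W(1) by (auto simp: opens_def)
    then show ?thesis
      using eq[OF \<open>y \<in> U\<close> terms_at_letters[OF W(3) y] terms_at_letters[OF W(4) y]] sy[OF y] ty[OF y]
      by (simp add: at)
  qed
  then show "\<exists>W\<in>opens X U. x \<in> W \<and> (\<exists>ts. holo_terms W ts \<and>
      (\<forall>y\<in>W. (\<lambda>x\<in>U. q x (s x) (t x)) y = ext_class E y (terms_at ts y)))"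
    using W(1,2) op[OF W(3,4)] by (intro bexI[of _ W] conjI exI[of _ "op ts ts'"]) simp_all
qed simp

lemma sec_mult_closed: "\<lbrakk>openin X U; s \<in> Sec U; t \<in> Sec U\<rbrakk> \<Longrightarrow> s \<otimes>\<^bsub>sring U\<^esub> t \<in> Sec U"
  unfolding ext_section_ring_def monoid.simps
  by (rule section_op[where op = mult_terms and p = "(*)"])
    (simp_all add: holo_terms_mult terms_at_mult ext_fibre.cl_mult[OF ext_fibre] open_sub)

lemma sec_add_closed: "\<lbrakk>openin X U; s \<in> Sec U; t \<in> Sec U\<rbrakk> \<Longrightarrow> s \<oplus>\<^bsub>sring U\<^esub> t \<in> Sec U"
  unfolding ext_section_ring_def ring.simps
  by (rule section_op[where op = "(@)" and p = "(+)"])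
    (simp_all add: ext_fibre.cl_add[OF ext_fibre] open_sub)

lemma sec_diff_closed: "\<lbrakk>openin X U; s \<in> Sec U; t \<in> Sec U\<rbrakk> \<Longrightarrow> sec_diff U s t \<in> Sec U"
  unfolding sec_diff_def
  by (rule section_op[where op = "\<lambda>ts ts'. ts @ scale_terms (-1) ts'" and p = "(-)"])
    (simp_all add: holo_terms_scale terms_at_scale ext_fibre.cl_diff[OF ext_fibre] open_sub single_uminus word_Nil_one)

lemma terms_section: "openin X W \<Longrightarrow> holo_terms W ts \<Longrightarrow> (\<lambda>y\<in>W. ext_class E y (terms_at ts y)) \<in> Sec W"
  by (rule sectionI) (auto intro!: bexI[of _ W] simp: opens_def)

lemma section_restrict:
  assumes U: "openin X U" and V: "V \<in> opens X U" and s: "s \<in> Sec U"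
  shows "restrict s V \<in> Sec V"
proof (rule sectionI)
  show "openin X V" using V by (simp add: opens_def)
  fix x assume "x \<in> V"
  then have "x \<in> U" using V by (auto simp: opens_def)
  with s obtain W ts where W: "W \<in> opens X U" "x \<in> W" "holo_terms W ts" "\<And>y. y \<in> W \<Longrightarrow> s y = ext_class E y (terms_at ts y)"
    by (rule sectionE) blast
  then show "\<exists>W\<in>opens X V. x \<in> W \<and> (\<exists>ts. holo_terms W ts \<and> (\<forall>y\<in>W. restrict s V y = ext_class E y (terms_at ts y)))"
    using V \<open>x \<in> V\<close> holo_terms_mono[of W ts "W \<inter> V"] by (intro bexI[of _ "W \<inter> V"]) (auto simp: opens_def)
qed simp

lemma section_glue:
  assumes U: "openin X U" and ext: "s \<in> extensional U"
    and loc: "\<And>x. x \<in> U \<Longrightarrow> \<exists>W\<in>opens X U. x \<in> W \<and> restrict s W \<in> Sec W"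
  shows "s \<in> Sec U"
proof (rule sectionI[OF U ext])
  fix x assume "x \<in> U"
  then obtain V where V: "V \<in> opens X U" "x \<in> V" "restrict s V \<in> Sec V" using loc by blast
  from V(3,2) obtain W ts where W: "W \<in> opens X V" "x \<in> W" "holo_terms W ts"
      "\<And>y. y \<in> W \<Longrightarrow> restrict s V y = ext_class E y (terms_at ts y)"
    by (rule sectionE) blast
  have "s y = ext_class E y (terms_at ts y)" if "y \<in> W" for y
    using W(4)[OF that] that W(1) by (auto simp: opens_def)
  then show "\<exists>W\<in>opens X U. x \<in> W \<and> (\<exists>ts. holo_terms W ts \<and> (\<forall>y\<in>W. s y = ext_class E y (terms_at ts y)))"
    using W(2,3) opens_trans[OF V(1) W(1)] by (intro bexI[of _ W] conjI exI[of _ ts]) simp_all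
qed

text \<open>Locally, the graded pieces are obtained by omitting terms from a list that represents the
  section.\<close>

lemma section_part:
  assumes U: "openin X U" and s: "s \<in> Sec U"
  shows "\<exists>t\<in>Sec U. \<forall>x\<in>U. \<forall>a\<in>letters (fibre E x). s x = ext_class E x a \<longrightarrow> t x = ext_class E x (len_part P a)"
proof -
  define t where "t = (\<lambda>x\<in>U. ext_class E x (len_part P (SOME a. a \<in> letters (fibre E x) \<and> s x = ext_class E x a)))"
  have t: "t x = ext_class E x (len_part P a)"
    if x: "x \<in> U" and a: "a \<in> letters (fibre E x)" "s x = ext_class E x a" for x a
  proof -
    interpret ext_fibre E x by (rule ext_fibre[OF open_sub[OF U x]])
    let ?b = "SOME a. a \<in> A \<and> s x = cl a"
    have b: "?b \<in> A \<and> s x = cl ?b" by (rule someI[of _ a]) (use a in simp)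
    then have "?b - a \<in> I" using cl_eq_iff a by auto
    then have "len_part P ?b - len_part P a \<in> I" using I_len_part[of "?b - a" P] by (simp add: len_part_diff)
    then show ?thesis
      using x a b by (simp add: t_def cl_eq_iff letters_len_part)
  qed
  have "t \<in> Sec U"
  proof (rule sectionI[OF U])
    show "t \<in> extensional U" by (simp add: t_def)
    fix x assume "x \<in> U"
    with s obtain W ts where W: "W \<in> opens X U" "x \<in> W" "holo_terms W ts" "\<And>y. y \<in> W \<Longrightarrow> s y = ext_class E y (terms_at ts y)"
      by (rule sectionE) blast
    have "t y = ext_class E y (terms_at (filter (\<lambda>(f, us). P (length us)) ts) y)" if y: "y \<in> W" for y
    proof -
      have "y \<in> U" using y W(1) by (auto simp: opens_def)
      from t[OF this terms_at_letters[OF W(3) y] W(4)[OF y]] show ?thesis by (simp add: len_part_terms_at)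
    qed
    then show "\<exists>W\<in>opens X U. x \<in> W \<and> (\<exists>ts. holo_terms W ts \<and> (\<forall>y\<in>W. t y = ext_class E y (terms_at ts y)))"
      using W(1,2) holo_terms_filter[OF W(3)]
      by (intro bexI[of _ W] conjI exI[of _ "filter (\<lambda>(f, us). P (length us)) ts"]) simp_all
  qed
  then show ?thesis using t by blast
qed

subsection \<open>Functions and vector fields generate\<close>

definition fun_sec :: "'x set \<Rightarrow> ('x \<Rightarrow> complex) \<Rightarrow> ('x, 'e) ext_section" where
  "fun_sec W f = (\<lambda>y\<in>W. ext_class E y (word [] (f y)))"

definition vec_sec :: "'x set \<Rightarrow> ('x \<Rightarrow> 'e) \<Rightarrow> ('x, 'e) ext_section" where
  "vec_sec W u = (\<lambda>y\<in>W. ext_class E y (word [u y] 1))"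

lemma fun_sec_section: "openin X W \<Longrightarrow> holo_fun M W f \<Longrightarrow> fun_sec W f \<in> Sec W"
  using terms_section[of W "[(f, [])]"] by (simp add: fun_sec_def)

lemma vec_sec_section: "openin X W \<Longrightarrow> holo_section M E W u \<Longrightarrow> vec_sec W u \<in> Sec W"
  using terms_section[of W "[(\<lambda>_. 1, [u])]"] holo_fun_const[of M W 1] by (simp add: vec_sec_def)

lemma const_section_fun: "const_section E W c = fun_sec W (\<lambda>_. c)"
  by (simp add: const_section_def fun_sec_def)

lemma restrict_vec_sec: "W' \<subseteq> W \<Longrightarrow> restrict (vec_sec W u) W' = vec_sec W' u"
  by (auto simp: vec_sec_def fun_eq_iff)

text \<open>The index of \<open>Q\<close> is a lower bound for the degree, so that one rule serves for statements
  about all sections and for statements about the filtration.\<close>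

lemma terms_induct:
  assumes W: "openin X W" and ts: "holo_terms W ts"
    and len: "\<And>f us. (f, us) \<in> set ts \<Longrightarrow> j \<le> length us"
    and Qf: "\<And>f. holo_fun M W f \<Longrightarrow> Q 0 (fun_sec W f)"
    and Qv: "\<And>u. holo_section M E W u \<Longrightarrow> Q (Suc 0) (vec_sec W u)"
    and Qm: "\<And>i j s t. \<lbrakk>s \<in> Sec W; t \<in> Sec W; Q i s; Q j t\<rbrakk> \<Longrightarrow> Q (i + j) (s \<otimes>\<^bsub>sring W\<^esub> t)"
    and Qa: "\<And>j s t. \<lbrakk>s \<in> Sec W; t \<in> Sec W; Q j s; Q j t\<rbrakk> \<Longrightarrow> Q j (s \<oplus>\<^bsub>sring W\<^esub> t)"
    and Qz: "\<And>j. Q j (fun_sec W (\<lambda>_. 0))"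
    and Qmono: "\<And>i j s. \<lbrakk>Q i s; j \<le> i\<rbrakk> \<Longrightarrow> Q j s"
  shows "Q j (\<lambda>y\<in>W. ext_class E y (terms_at ts y))"
proof -
  let ?p = "\<lambda>us. \<lambda>y\<in>W. ext_class E y (word (map (\<lambda>u. u y) us) 1)"
  have cl_mult: "ext_class E y (a * b) = ext_class E y a \<otimes>\<^bsub>ext_algebra E y\<^esub> ext_class E y b"
    and cl_add: "ext_class E y (a + b) = ext_class E y a \<oplus>\<^bsub>ext_algebra E y\<^esub> ext_class E y b"
    if "y \<in> W" "a \<in> letters (fibre E y)" "b \<in> letters (fibre E y)" for y a b
    using that ext_fibre.cl_mult[OF ext_fibre] ext_fibre.cl_add[OF ext_fibre] open_sub[OF W] by simp_all
  have let_map: "word (map (\<lambda>u. u y) us) c \<in> letters (fibre E y)"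
    if "y \<in> W" "\<forall>u\<in>set us. holo_section M E W u" for y us c
    using that by (intro letters_word) (auto simp: holo_section_fibre)
  have p: "?p us \<in> Sec W \<and> Q (length us) (?p us)" if us: "\<forall>u\<in>set us. holo_section M E W u" for us
    using us
  proof (induction us)
    case Nil
    have "?p [] = fun_sec W (\<lambda>_. 1)" by (simp add: fun_sec_def)
    then show ?case using Qf[OF holo_fun_const] fun_sec_section[OF W holo_fun_const] by simp
  next
    case (Cons u us)
    have eq: "?p (u # us) = vec_sec W u \<otimes>\<^bsub>sring W\<^esub> ?p us"
    proof (rule extensionalityI[where A = W])
      fix y assume y: "y \<in> W"
      show "?p (u # us) y = (vec_sec W u \<otimes>\<^bsub>sring W\<^esub> ?p us) y"
        using y Cons.prems let_map[of y "[u]" 1] let_map[of y us 1]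
        by (simp add: word_Cons[of "u y" "map (\<lambda>u. u y) us"] cl_mult[OF y] vec_sec_def)
    qed (auto simp: ext_section_ring_def)
    have u: "holo_section M E W u" and us: "\<forall>u\<in>set us. holo_section M E W u" using Cons.prems by auto
    note IH = Cons.IH[OF us, THEN conjunct1] Cons.IH[OF us, THEN conjunct2]
    show ?case
      unfolding eq using Qm[OF vec_sec_section[OF W u] IH(1) Qv[OF u] IH(2)]
        sec_mult_closed[OF W vec_sec_section[OF W u] IH(1)]
      by (simp only: list.size add_Suc add_0 add_0_right add_Suc_right simp_thms)
  qed
  show ?thesis
    using ts len
  proof (induction ts)
    case Nil
    have "(\<lambda>y\<in>W. ext_class E y (terms_at [] y)) = fun_sec W (\<lambda>_. 0)" by (simp add: fun_sec_def)
    then show ?case using Qz by simp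
  next
    case (Cons t ts)
    obtain f us where t: "t = (f, us)" by (cases t)
    have f: "holo_fun M W f" and us: "\<forall>u\<in>set us. holo_section M E W u" and ts: "holo_terms W ts" and j: "j \<le> length us"
      using Cons.prems(1) Cons.prems(2)[of f us] by (auto simp: t)
    let ?s = "\<lambda>y\<in>W. ext_class E y (terms_at ts y)"
    have eq: "(\<lambda>y\<in>W. ext_class E y (terms_at (t # ts) y)) = (fun_sec W f \<otimes>\<^bsub>sring W\<^esub> ?p us) \<oplus>\<^bsub>sring W\<^esub> ?s"
    proof (rule extensionalityI[where A = W])
      fix y assume y: "y \<in> W"
      have "word (map (\<lambda>u. u y) us) (f y) = word [] (f y) * word (map (\<lambda>u. u y) us) 1"
        by (simp add: word_mult)
      then show "(\<lambda>y\<in>W. ext_class E y (terms_at (t # ts) y)) y = ((fun_sec W f \<otimes>\<^bsub>sring W\<^esub> ?p us) \<oplus>\<^bsub>sring W\<^esub> ?s) y"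
        using y let_map[OF y us] terms_at_letters[OF ts y] letters_word[of "[]" "fibre E y"]
        by (simp add: t cl_add[OF y] cl_mult[OF y] letters_mult fun_sec_def)
    qed (auto simp: ext_section_ring_def)
    have fs: "fun_sec W f \<in> Sec W" "Q 0 (fun_sec W f)" using fun_sec_section[OF W f] Qf[OF f] by auto
    note pus = p[OF us, THEN conjunct1] p[OF us, THEN conjunct2]
    have "Q (length us) (fun_sec W f \<otimes>\<^bsub>sring W\<^esub> ?p us)" using Qm[OF fs(1) pus(1) fs(2) pus(2)] by (simp only: add_0)
    from Qmono[OF this j] have 1: "Q j (fun_sec W f \<otimes>\<^bsub>sring W\<^esub> ?p us)" .
    have 2: "Q j ?s" by (rule Cons.IH[OF ts]) (auto intro: Cons.prems(2))
    show ?case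
      unfolding eq by (rule Qa[OF sec_mult_closed[OF W fs(1) pus(1)] terms_section[OF W ts] 1 2])
  qed
qed

end

subsection \<open>Congruences between elements of the exterior algebra\<close>

context ext_fibre
begin

lemma R_diff_closed: "p \<in> carrier R \<Longrightarrow> q \<in> carrier R \<Longrightarrow> p \<ominus>\<^bsub>R\<^esub> q \<in> carrier R"
  by (intro ring.ring_simprules ring_R)

lemma R_add_closed: "p \<in> carrier R \<Longrightarrow> q \<in> carrier R \<Longrightarrow> p \<oplus>\<^bsub>R\<^esub> q \<in> carrier R"
  by (intro ring.ring_simprules ring_R)

lemma R_add_diff: "p \<in> carrier R \<Longrightarrow> q \<in> carrier R \<Longrightarrow> q \<oplus>\<^bsub>R\<^esub> (p \<ominus>\<^bsub>R\<^esub> q) = p"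
  by (auto dest!: carrier_R simp: cl_add cl_diff letters_diff)

lemma R_add_diff_cancel: "p \<in> carrier R \<Longrightarrow> q \<in> carrier R \<Longrightarrow> (q \<oplus>\<^bsub>R\<^esub> p) \<ominus>\<^bsub>R\<^esub> q = p"
  by (auto dest!: carrier_R simp: cl_add cl_diff letters_add)

lemma R_diff_mult:
  "\<lbrakk>p \<in> carrier R; q \<in> carrier R; p' \<in> carrier R; q' \<in> carrier R\<rbrakk> \<Longrightarrow>
    (p \<otimes>\<^bsub>R\<^esub> q) \<ominus>\<^bsub>R\<^esub> (p' \<otimes>\<^bsub>R\<^esub> q') = ((p \<ominus>\<^bsub>R\<^esub> p') \<otimes>\<^bsub>R\<^esub> q) \<oplus>\<^bsub>R\<^esub> (p' \<otimes>\<^bsub>R\<^esub> (q \<ominus>\<^bsub>R\<^esub> q'))"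
  by (auto dest!: carrier_R simp: cl_add cl_diff cl_mult letters_diff letters_mult algebra_simps)

lemma R_diff_add:
  "\<lbrakk>p \<in> carrier R; q \<in> carrier R; p' \<in> carrier R; q' \<in> carrier R\<rbrakk> \<Longrightarrow>
    (p \<oplus>\<^bsub>R\<^esub> q) \<ominus>\<^bsub>R\<^esub> (p' \<oplus>\<^bsub>R\<^esub> q') = (p \<ominus>\<^bsub>R\<^esub> p') \<oplus>\<^bsub>R\<^esub> (q \<ominus>\<^bsub>R\<^esub> q')"
  by (auto dest!: carrier_R simp: cl_add cl_diff letters_diff letters_add algebra_simps)

lemma R_diff_trans:
  "\<lbrakk>p \<in> carrier R; q \<in> carrier R; s \<in> carrier R\<rbrakk> \<Longrightarrow>
    p \<ominus>\<^bsub>R\<^esub> s = (p \<ominus>\<^bsub>R\<^esub> q) \<oplus>\<^bsub>R\<^esub> (q \<ominus>\<^bsub>R\<^esub> s)"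
  by (auto dest!: carrier_R simp: cl_add cl_diff letters_diff)

lemma R_diff_swap: "\<lbrakk>p \<in> carrier R; q \<in> carrier R\<rbrakk> \<Longrightarrow> \<ominus>\<^bsub>R\<^esub> (p \<ominus>\<^bsub>R\<^esub> q) = q \<ominus>\<^bsub>R\<^esub> p"
  by (auto dest!: carrier_R simp: cl_uminus cl_diff letters_diff)

lemma R_diff_self: "p \<in> carrier R \<Longrightarrow> p \<ominus>\<^bsub>R\<^esub> p = \<zero>\<^bsub>R\<^esub>"
  by (auto dest!: carrier_R simp: cl_diff cl_zero)

lemma R_add_zero: "p \<in> carrier R \<Longrightarrow> p \<oplus>\<^bsub>R\<^esub> \<zero>\<^bsub>R\<^esub> = p"
  by (auto dest!: carrier_R simp: cl_add cl_zero)

lemma R_diff_eq_zero: "\<lbrakk>p \<in> carrier R; q \<in> carrier R; p \<ominus>\<^bsub>R\<^esub> q = \<zero>\<^bsub>R\<^esub>\<rbrakk> \<Longrightarrow> p = q"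
  using R_add_diff R_add_zero by metis

lemma part_diff_swap:
  "\<lbrakk>p \<in> carrier R; q \<in> carrier R; p \<ominus>\<^bsub>R\<^esub> q \<in> ext_part E x P\<rbrakk> \<Longrightarrow> q \<ominus>\<^bsub>R\<^esub> p \<in> ext_part E x P"
  using part_uminus R_diff_swap by metis

lemma part_diff_trans:
  "\<lbrakk>p \<in> carrier R; q \<in> carrier R; s \<in> carrier R; p \<ominus>\<^bsub>R\<^esub> q \<in> ext_part E x P; q \<ominus>\<^bsub>R\<^esub> s \<in> ext_part E x P\<rbrakk>
    \<Longrightarrow> p \<ominus>\<^bsub>R\<^esub> s \<in> ext_part E x P"
  using part_add R_diff_trans by metis

lemma part_diff_mult:
  assumes c: "p \<in> carrier R" "q \<in> carrier R" "p' \<in> carrier R" "q' \<in> carrier R"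
    and "p \<ominus>\<^bsub>R\<^esub> p' \<in> ext_part E x (\<lambda>j. k \<le> j)" "q \<ominus>\<^bsub>R\<^esub> q' \<in> ext_part E x (\<lambda>j. k \<le> j)"
  shows "(p \<otimes>\<^bsub>R\<^esub> q) \<ominus>\<^bsub>R\<^esub> (p' \<otimes>\<^bsub>R\<^esub> q') \<in> ext_part E x (\<lambda>j. k \<le> j)"
  unfolding R_diff_mult[OF c]
  by (intro part_add part_mult[OF assms(5) part_all[OF c(2)]] part_mult[OF part_all[OF c(3)] assms(6)]) auto

lemma cl_part_cut: "a \<in> A \<Longrightarrow> cl a \<in> ext_part E x P \<Longrightarrow> cl a = cl (len_part P a)"
proof -
  assume a: "a \<in> A" and p: "cl a \<in> ext_part E x P"
  have "a - len_part P a = len_part (\<lambda>n. \<not> P n) a" using len_part_split[of a P] by (simp add: algebra_simps)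
  then show ?thesis using p a cl_part_iff by (simp add: cl_eq_iff letters_len_part)
qed

end

section \<open>Automorphism groups\<close>

context model
begin

abbreviation fil :: "'x \<Rightarrow> nat \<Rightarrow> ('e list \<Rightarrow>\<^sub>0 complex) set set" where
  "fil x k \<equiv> ext_part E x (\<lambda>j. k \<le> j)"

lemma fil_mono: "x \<in> topspace X \<Longrightarrow> p \<in> fil x k \<Longrightarrow> j \<le> k \<Longrightarrow> p \<in> fil x j"
  using ext_fibre.part_mono[OF ext_fibre, of x p "\<lambda>i. k \<le> i" "\<lambda>i. j \<le> i"] by auto

abbreviation "Part \<equiv> ext_sections_part M E"

lemma PartI: "s \<in> Sec U \<Longrightarrow> (\<And>x. x \<in> U \<Longrightarrow> s x \<in> ext_part E x P) \<Longrightarrow> s \<in> Part U P"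
  and PartD: "s \<in> Part U P \<Longrightarrow> s \<in> Sec U" "s \<in> Part U P \<Longrightarrow> x \<in> U \<Longrightarrow> s x \<in> ext_part E x P"
  by (auto simp: ext_sections_part_def)

lemma one_section: "openin X U \<Longrightarrow> \<one>\<^bsub>sring U\<^esub> = const_section E U 1"
  by (rule ext) (simp add: ext_section_ring_def const_section_def ext_fibre.cl_one[OF ext_fibre] open_sub word_Nil_one)

lemma const_section_closed: "openin X U \<Longrightarrow> const_section E U c \<in> Sec U"
  unfolding const_section_fun by (rule fun_sec_section[OF _ holo_fun_const])

lemma autI:
  assumes U: "openin X U"
    and ext: "\<alpha> \<in> extensional (opens X U)" "\<And>V. V \<in> opens X U \<Longrightarrow> \<alpha> V \<in> extensional (Sec V)"
    and closed: "\<And>V s. \<lbrakk>V \<in> opens X U; s \<in> Sec V\<rbrakk> \<Longrightarrow> \<alpha> V s \<in> Sec V"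
    and mult: "\<And>V s t. \<lbrakk>V \<in> opens X U; s \<in> Sec V; t \<in> Sec V\<rbrakk> \<Longrightarrow>
      \<alpha> V (s \<otimes>\<^bsub>sring V\<^esub> t) = \<alpha> V s \<otimes>\<^bsub>sring V\<^esub> \<alpha> V t"
    and add: "\<And>V s t. \<lbrakk>V \<in> opens X U; s \<in> Sec V; t \<in> Sec V\<rbrakk> \<Longrightarrow>
      \<alpha> V (s \<oplus>\<^bsub>sring V\<^esub> t) = \<alpha> V s \<oplus>\<^bsub>sring V\<^esub> \<alpha> V t"
    and const: "\<And>V c. V \<in> opens X U \<Longrightarrow> \<alpha> V (const_section E V c) = const_section E V c"
    and bij: "\<And>V. V \<in> opens X U \<Longrightarrow> bij_betw (\<alpha> V) (Sec V) (Sec V)"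
    and ev: "\<And>V s. \<lbrakk>V \<in> opens X U; s \<in> Part V even\<rbrakk> \<Longrightarrow> \<alpha> V s \<in> Part V even"
    and od: "\<And>V s. \<lbrakk>V \<in> opens X U; s \<in> Part V odd\<rbrakk> \<Longrightarrow> \<alpha> V s \<in> Part V odd"
    and restr: "\<And>V W s. \<lbrakk>V \<in> opens X U; W \<in> opens X V; s \<in> Sec V\<rbrakk> \<Longrightarrow>
      \<alpha> W (restrict s W) = restrict (\<alpha> V s) W"
  shows "\<alpha> \<in> ext_auts M E U"
  unfolding ext_auts_def
proof (intro CollectI conjI ballI allI)
  show "\<alpha> \<in> (\<Pi>\<^sub>E V\<in>opens X U. Sec V \<rightarrow>\<^sub>E Sec V)"
    using ext closed by (auto simp: PiE_def)
  fix V assume V: "V \<in> opens X U"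
  then have oV: "openin X V" by (simp add: opens_def)
  show "\<alpha> V \<in> ring_hom (sring V) (sring V)"
    using closed[OF V] mult[OF V] add[OF V] const[OF V]
    by (intro ring_hom_memI) (simp_all add: carrier_sring one_section[OF oV])
  show "bij_betw (\<alpha> V) (Sec V) (Sec V)" by (rule bij[OF V])
  show "\<alpha> V (const_section E V c) = const_section E V c" for c by (rule const[OF V])
  show "\<alpha> V ` Part V even \<subseteq> Part V even" "\<alpha> V ` Part V odd \<subseteq> Part V odd"
    using ev[OF V] od[OF V] by auto
  show "\<alpha> W (restrict s W) = restrict (\<alpha> V s) W" if "W \<in> opens X V" "s \<in> Sec V" for W s
    by (rule restr[OF V that])
qed

lemma autD:
  assumes a: "\<alpha> \<in> ext_auts M E U" and V: "V \<in> opens X U"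
  shows aut_closed: "s \<in> Sec V \<Longrightarrow> \<alpha> V s \<in> Sec V"
    and aut_mult: "\<lbrakk>s \<in> Sec V; t \<in> Sec V\<rbrakk> \<Longrightarrow> \<alpha> V (s \<otimes>\<^bsub>sring V\<^esub> t) = \<alpha> V s \<otimes>\<^bsub>sring V\<^esub> \<alpha> V t"
    and aut_add: "\<lbrakk>s \<in> Sec V; t \<in> Sec V\<rbrakk> \<Longrightarrow> \<alpha> V (s \<oplus>\<^bsub>sring V\<^esub> t) = \<alpha> V s \<oplus>\<^bsub>sring V\<^esub> \<alpha> V t"
    and aut_const: "\<alpha> V (const_section E V c) = const_section E V c"
    and aut_bij: "bij_betw (\<alpha> V) (Sec V) (Sec V)"
    and aut_even: "s \<in> Part V even \<Longrightarrow> \<alpha> V s \<in> Part V even"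
    and aut_odd: "s \<in> Part V odd \<Longrightarrow> \<alpha> V s \<in> Part V odd"
    and aut_restr: "\<lbrakk>W \<in> opens X V; s \<in> Sec V\<rbrakk> \<Longrightarrow> \<alpha> W (restrict s W) = restrict (\<alpha> V s) W"
    and aut_ext: "\<alpha> V \<in> extensional (Sec V)"
proof -
  have P: "\<alpha> \<in> (\<Pi>\<^sub>E V\<in>opens X U. Sec V \<rightarrow>\<^sub>E Sec V)"
    and A: "\<forall>V\<in>opens X U. \<alpha> V \<in> ring_hom (sring V) (sring V) \<and> bij_betw (\<alpha> V) (Sec V) (Sec V) \<and>
        (\<forall>c. \<alpha> V (const_section E V c) = const_section E V c) \<and>
        \<alpha> V ` Part V even \<subseteq> Part V even \<and> \<alpha> V ` Part V odd \<subseteq> Part V odd"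
    and B: "\<forall>V\<in>opens X U. \<forall>W\<in>opens X V. \<forall>s\<in>Sec V. \<alpha> W (restrict s W) = restrict (\<alpha> V s) W"
    using a unfolding ext_auts_def by auto
  note AV = bspec[OF A V]
  have h: "\<alpha> V \<in> ring_hom (sring V) (sring V)" using AV by (rule conjunct1)
  show "s \<in> Sec V \<Longrightarrow> \<alpha> V s \<in> Sec V"
    using ring_hom_closed[OF h] by (simp add: carrier_sring)
  show "\<lbrakk>s \<in> Sec V; t \<in> Sec V\<rbrakk> \<Longrightarrow> \<alpha> V (s \<otimes>\<^bsub>sring V\<^esub> t) = \<alpha> V s \<otimes>\<^bsub>sring V\<^esub> \<alpha> V t"
    using ring_hom_mult[OF h] by (simp add: carrier_sring)
  show "\<lbrakk>s \<in> Sec V; t \<in> Sec V\<rbrakk> \<Longrightarrow> \<alpha> V (s \<oplus>\<^bsub>sring V\<^esub> t) = \<alpha> V s \<oplus>\<^bsub>sring V\<^esub> \<alpha> V t"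
    using ring_hom_add[OF h] by (simp add: carrier_sring)
  show "\<alpha> V (const_section E V c) = const_section E V c" using AV by simp
  show "bij_betw (\<alpha> V) (Sec V) (Sec V)" using AV by simp
  show "s \<in> Part V even \<Longrightarrow> \<alpha> V s \<in> Part V even" using AV by auto
  show "s \<in> Part V odd \<Longrightarrow> \<alpha> V s \<in> Part V odd" using AV by auto
  show "\<lbrakk>W \<in> opens X V; s \<in> Sec V\<rbrakk> \<Longrightarrow> \<alpha> W (restrict s W) = restrict (\<alpha> V s) W" using B V by simp
  have "\<alpha> V \<in> Sec V \<rightarrow>\<^sub>E Sec V" by (rule PiE_mem[OF P V])
  then show "\<alpha> V \<in> extensional (Sec V)" by (simp add: PiE_def)
qed

lemma aut_extensional: "\<alpha> \<in> ext_auts M E U \<Longrightarrow> \<alpha> \<in> extensional (opens X U)"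
  unfolding ext_auts_def by (auto simp: PiE_def)

lemma aut_eqI:
  assumes a: "\<alpha> \<in> ext_auts M E U" and b: "\<beta> \<in> ext_auts M E U"
    and eq: "\<And>V s. \<lbrakk>V \<in> opens X U; s \<in> Sec V\<rbrakk> \<Longrightarrow> \<alpha> V s = \<beta> V s"
  shows "\<alpha> = \<beta>"
  by (rule extensionalityI[OF aut_extensional[OF a] aut_extensional[OF b]],
      rule extensionalityI[OF aut_ext[OF a] aut_ext[OF b]]) (simp_all add: eq)

lemma opens_open: "V \<in> opens X U \<Longrightarrow> openin X V"
  by (simp add: opens_def)

lemma opens_top: "V \<in> opens X U \<Longrightarrow> x \<in> V \<Longrightarrow> x \<in> topspace X"
  using open_sub opens_open by blast

lemma aut_local:
  assumes a: "\<alpha> \<in> ext_auts M E U" and V: "V \<in> opens X U" and W: "W \<in> opens X V" and s: "s \<in> Sec V" and x: "x \<in> W"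
  shows "\<alpha> V s x = \<alpha> W (restrict s W) x"
  using aut_restr[OF a V W s] x by simp

lemma sec_diff_at: "x \<in> V \<Longrightarrow> sec_diff V s t x = s x \<ominus>\<^bsub>ext_algebra E x\<^esub> t x"
  by (simp add: sec_diff_def)

lemma aut_diff:
  assumes a: "\<alpha> \<in> ext_auts M E U" and V: "V \<in> opens X U" and s: "s \<in> Sec V" and t: "t \<in> Sec V" and x: "x \<in> V"
  shows "\<alpha> V (sec_diff V s t) x = \<alpha> V s x \<ominus>\<^bsub>ext_algebra E x\<^esub> \<alpha> V t x"
proof -
  have oV: "openin X V" by (rule opens_open[OF V])
  interpret ext_fibre E x by (rule ext_fibre[OF opens_top[OF V x]])
  note d = sec_diff_closed[OF oV s t]
  have "t \<oplus>\<^bsub>sring V\<^esub> sec_diff V s t = s"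
  proof (rule section_eqI[OF sec_add_closed[OF oV t d] s])
    fix y assume y: "y \<in> V"
    show "(t \<oplus>\<^bsub>sring V\<^esub> sec_diff V s t) y = s y"
      using y ext_fibre.R_add_diff[OF ext_fibre[OF opens_top[OF V y]] section_carrier[OF s y] section_carrier[OF t y]]
      by (simp add: sec_diff_at)
  qed
  then have "\<alpha> V s = \<alpha> V t \<oplus>\<^bsub>sring V\<^esub> \<alpha> V (sec_diff V s t)"
    using aut_add[OF a V t d] by simp
  then show ?thesis
    using x R_add_diff_cancel[OF section_carrier[OF aut_closed[OF a V d] x] section_carrier[OF aut_closed[OF a V t] x]]
    by simp
qed

abbreviation "G k U \<equiv> carrier (sections (G_sheaf M E k) U)"

lemma G_iff: "\<alpha> \<in> G k U \<longleftrightarrow> \<alpha> \<in> ext_auts M E U \<and>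
    (\<forall>V\<in>opens X U. \<forall>s\<in>Sec V. \<forall>x\<in>V. \<alpha> V s x \<ominus>\<^bsub>ext_algebra E x\<^esub> s x \<in> fil x k)"
  by (simp add: G_sheaf_def)

lemma G_aut: "\<alpha> \<in> G k U \<Longrightarrow> \<alpha> \<in> ext_auts M E U"
  and G_fil: "\<lbrakk>\<alpha> \<in> G k U; V \<in> opens X U; s \<in> Sec V; x \<in> V\<rbrakk> \<Longrightarrow> \<alpha> V s x \<ominus>\<^bsub>ext_algebra E x\<^esub> s x \<in> fil x k"
  by (simp_all add: G_iff)

text \<open>An automorphism in \<open>G\<^sub>k\<close> with \<open>k \<ge> 1\<close> respects the filtration: a section of \<open>J\<^sup>j\<close> is locally
  a sum of products of at least \<open>j\<close> sections of the bundle, and these go to \<open>J\<^sup>1\<close>.\<close>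

lemma aut_filtration:
  assumes a: "\<alpha> \<in> G k U" and k: "k \<ge> 1" and V: "V \<in> opens X U" and s: "s \<in> Sec V"
    and sj: "\<And>y. y \<in> V \<Longrightarrow> s y \<in> fil y j" and x: "x \<in> V"
  shows "\<alpha> V s x \<in> fil x j"
proof -
  note aa = G_aut[OF a]
  obtain W ts where W: "W \<in> opens X V" "x \<in> W" "holo_terms W ts"
      and sy: "\<And>y. y \<in> W \<Longrightarrow> s y = ext_class E y (terms_at ts y)"
    by (rule sectionE[OF s x]) blast
  have WU: "W \<in> opens X U" by (rule opens_trans[OF V W(1)])
  have oW: "openin X W" by (rule opens_open[OF W(1)])
  have xt: "x \<in> topspace X" by (rule open_sub[OF oW W(2)])
  interpret ext_fibre E x by (rule ext_fibre[OF xt])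
  define ts' where "ts' = filter (\<lambda>(f, us). j \<le> length us) ts"
  have ts': "holo_terms W ts'" unfolding ts'_def by (rule holo_terms_filter[OF W(3)])
  have sW: "restrict s W = (\<lambda>y\<in>W. ext_class E y (terms_at ts' y))"
  proof (rule restrict_ext)
    fix y assume y: "y \<in> W"
    interpret Y: ext_fibre E y by (rule ext_fibre[OF open_sub[OF oW y]])
    have "y \<in> V" using y W(1) by (auto simp: opens_def)
    from sj[OF this] have "Y.cl (terms_at ts y) \<in> fil y j" unfolding sy[OF y] .
    from Y.cl_part_cut[OF terms_at_letters[OF W(3) y] this]
    show "s y = ext_class E y (terms_at ts' y)"
      by (simp add: sy[OF y] ts'_def len_part_terms_at)
  qed
  have c: "\<alpha> W t x \<in> carrier R" if "t \<in> Sec W" for t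
    by (rule section_carrier[OF aut_closed[OF aa WU that] W(2)])
  have "\<alpha> W (\<lambda>y\<in>W. ext_class E y (terms_at ts' y)) x \<in> fil x j"
  proof (rule terms_induct[where Q = "\<lambda>i t. \<alpha> W t x \<in> fil x i", OF oW ts'])
    show "j \<le> length us" if "(f, us) \<in> set ts'" for f us
      using that by (auto simp: ts'_def)
    show "\<alpha> W (fun_sec W f) x \<in> fil x 0" if "holo_fun M W f" for f
      by (rule part_all[OF c[OF fun_sec_section[OF oW that]]])
    show "\<alpha> W (vec_sec W u) x \<in> fil x (Suc 0)" if u: "holo_section M E W u" for u
    proof -
      note v = vec_sec_section[OF oW u]
      have 1: "vec_sec W u x \<in> fil x (Suc 0)"
        using W(2) holo_section_fibre[OF u W(2)]
        by (auto simp: vec_sec_def intro!: cl_partI letters_word lengths_word)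
      have 2: "\<alpha> W (vec_sec W u) x \<ominus>\<^bsub>R\<^esub> vec_sec W u x \<in> fil x (Suc 0)"
        using fil_mono[OF xt G_fil[OF a WU v W(2)]] k by simp
      show ?thesis
        using part_add[OF 1 2] R_add_diff[OF c[OF v] section_carrier[OF v W(2)]] by simp
    qed
    show "\<alpha> W (p \<otimes>\<^bsub>sring W\<^esub> q) x \<in> fil x (i + i')"
      if "p \<in> Sec W" "q \<in> Sec W" "\<alpha> W p x \<in> fil x i" "\<alpha> W q x \<in> fil x i'" for i i' p q
      using part_mult[OF that(3,4), of "\<lambda>n. i + i' \<le> n"] W(2) by (simp add: aut_mult[OF aa WU that(1,2)])
    show "\<alpha> W (p \<oplus>\<^bsub>sring W\<^esub> q) x \<in> fil x i"
      if "p \<in> Sec W" "q \<in> Sec W" "\<alpha> W p x \<in> fil x i" "\<alpha> W q x \<in> fil x i" for i p q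
      using part_add[OF that(3,4)] W(2) by (simp add: aut_add[OF aa WU that(1,2)])
    show "\<alpha> W (fun_sec W (\<lambda>_. 0)) x \<in> fil x i" for i
      using aut_const[OF aa WU, of 0] part_zero W(2)
      by (simp add: const_section_fun) (simp add: fun_sec_def flip: cl_zero)
    show "\<alpha> W p x \<in> fil x i'" if "\<alpha> W p x \<in> fil x i" "i' \<le> i" for i i' p
      by (rule fil_mono[OF xt that])
  qed
  then show ?thesis using aut_local[OF aa V W(1) s W(2)] sW by simp
qed

text \<open>Functions and sections of the bundle generate the algebra, and \<open>J\<^sup>k\<close> is an ideal, so a
  congruence modulo \<open>J\<^sup>k\<close> on these generators passes to products and sums.\<close>

lemma aut_congruence:
  assumes a: "\<alpha> \<in> ext_auts M E U" and b: "\<beta> \<in> ext_auts M E U"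
    and f: "\<And>W f x. \<lbrakk>W \<in> opens X U; holo_fun M W f; x \<in> W\<rbrakk> \<Longrightarrow>
      \<alpha> W (fun_sec W f) x \<ominus>\<^bsub>ext_algebra E x\<^esub> \<beta> W (fun_sec W f) x \<in> fil x k"
    and v: "\<And>W u x. \<lbrakk>W \<in> opens X U; holo_section M E W u; x \<in> W\<rbrakk> \<Longrightarrow>
      \<alpha> W (vec_sec W u) x \<ominus>\<^bsub>ext_algebra E x\<^esub> \<beta> W (vec_sec W u) x \<in> fil x k"
    and V: "V \<in> opens X U" and s: "s \<in> Sec V" and x: "x \<in> V"
  shows "\<alpha> V s x \<ominus>\<^bsub>ext_algebra E x\<^esub> \<beta> V s x \<in> fil x k"
proof -
  obtain W ts where W: "W \<in> opens X V" "x \<in> W" "holo_terms W ts"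
      and sy: "\<And>y. y \<in> W \<Longrightarrow> s y = ext_class E y (terms_at ts y)"
    by (rule sectionE[OF s x]) blast
  have WU: "W \<in> opens X U" by (rule opens_trans[OF V W(1)])
  have oW: "openin X W" by (rule opens_open[OF W(1)])
  interpret ext_fibre E x by (rule ext_fibre[OF open_sub[OF oW W(2)]])
  have sW: "restrict s W = (\<lambda>y\<in>W. ext_class E y (terms_at ts y))"
    by (rule restrict_ext) (rule sy)
  have c: "\<alpha> W t x \<in> carrier R" "\<beta> W t x \<in> carrier R" if "t \<in> Sec W" for t
    using section_carrier[OF aut_closed[OF a WU that] W(2)] section_carrier[OF aut_closed[OF b WU that] W(2)] by auto
  have "\<alpha> W (\<lambda>y\<in>W. ext_class E y (terms_at ts y)) x \<ominus>\<^bsub>R\<^esub> \<beta> W (\<lambda>y\<in>W. ext_class E y (terms_at ts y)) x \<in> fil x k"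
  proof (rule terms_induct[where Q = "\<lambda>_ t. \<alpha> W t x \<ominus>\<^bsub>R\<^esub> \<beta> W t x \<in> fil x k" and j = 0, OF oW W(3)])
    show "\<alpha> W (p \<otimes>\<^bsub>sring W\<^esub> q) x \<ominus>\<^bsub>R\<^esub> \<beta> W (p \<otimes>\<^bsub>sring W\<^esub> q) x \<in> fil x k"
      if "p \<in> Sec W" "q \<in> Sec W" "\<alpha> W p x \<ominus>\<^bsub>R\<^esub> \<beta> W p x \<in> fil x k" "\<alpha> W q x \<ominus>\<^bsub>R\<^esub> \<beta> W q x \<in> fil x k" for i i' :: nat and p q
      using part_diff_mult[OF c(1)[OF that(1)] c(1)[OF that(2)] c(2)[OF that(1)] c(2)[OF that(2)] that(3,4)] W(2)
      by (simp add: aut_mult[OF a WU that(1,2)] aut_mult[OF b WU that(1,2)])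
    show "\<alpha> W (p \<oplus>\<^bsub>sring W\<^esub> q) x \<ominus>\<^bsub>R\<^esub> \<beta> W (p \<oplus>\<^bsub>sring W\<^esub> q) x \<in> fil x k"
      if "p \<in> Sec W" "q \<in> Sec W" "\<alpha> W p x \<ominus>\<^bsub>R\<^esub> \<beta> W p x \<in> fil x k" "\<alpha> W q x \<ominus>\<^bsub>R\<^esub> \<beta> W q x \<in> fil x k" for i :: nat and p q
      using part_add[OF that(3,4)] W(2)
      by (simp add: aut_add[OF a WU that(1,2)] aut_add[OF b WU that(1,2)]
          R_diff_add[OF c(1)[OF that(1)] c(1)[OF that(2)] c(2)[OF that(1)] c(2)[OF that(2)]])
    show "\<alpha> W (fun_sec W (\<lambda>_. 0)) x \<ominus>\<^bsub>R\<^esub> \<beta> W (fun_sec W (\<lambda>_. 0)) x \<in> fil x k" for i :: nat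
      by (rule f[OF WU holo_fun_const W(2)])
  qed (simp_all add: f[OF WU _ W(2)] v[OF WU _ W(2)])
  then show ?thesis using aut_local[OF a V W(1) s W(2)] aut_local[OF b V W(1) s W(2)] sW by simp
qed

lemma fun_sec_even: "openin X W \<Longrightarrow> holo_fun M W f \<Longrightarrow> fun_sec W f \<in> Part W even"
  by (rule PartI[OF fun_sec_section])
    (auto simp: fun_sec_def intro!: ext_fibre.cl_partI[OF ext_fibre] letters_word lengths_word open_sub)

text \<open>The difference is even, so it has no component of the odd degree \<open>k\<close>.\<close>

lemma aut_fun:
  assumes a: "\<alpha> \<in> G k U" and k: "odd k" and W: "W \<in> opens X U" and f: "holo_fun M W f" and x: "x \<in> W"
  shows "\<alpha> W (fun_sec W f) x \<ominus>\<^bsub>ext_algebra E x\<^esub> fun_sec W f x \<in> fil x (k + 1)"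
proof -
  have oW: "openin X W" by (rule opens_open[OF W])
  interpret ext_fibre E x by (rule ext_fibre[OF open_sub[OF oW x]])
  note e = fun_sec_even[OF oW f]
  show ?thesis
    by (rule part_even_step[OF _ G_fil[OF a W PartD(1)[OF e] x] k])
      (rule part_diff[OF PartD(2)[OF aut_even[OF G_aut[OF a] W e] x] PartD(2)[OF e x]])
qed

subsection \<open>Composition and inverse\<close>

definition comp_aut :: "'x set \<Rightarrow> ('x, 'e) ext_aut \<Rightarrow> ('x, 'e) ext_aut \<Rightarrow> ('x, 'e) ext_aut" where
  "comp_aut U \<alpha> \<beta> = (\<lambda>V\<in>opens X U. compose (Sec V) (\<alpha> V) (\<beta> V))"

definition id_aut :: "'x set \<Rightarrow> ('x, 'e) ext_aut" where
  "id_aut U = (\<lambda>V\<in>opens X U. \<lambda>s\<in>Sec V. s)"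

definition inv_aut :: "'x set \<Rightarrow> ('x, 'e) ext_aut \<Rightarrow> ('x, 'e) ext_aut" where
  "inv_aut U \<alpha> = (\<lambda>V\<in>opens X U. \<lambda>s\<in>Sec V. inv_into (Sec V) (\<alpha> V) s)"

lemma comp_aut_at: "V \<in> opens X U \<Longrightarrow> s \<in> Sec V \<Longrightarrow> comp_aut U \<alpha> \<beta> V s = \<alpha> V (\<beta> V s)"
  by (simp add: comp_aut_def compose_def)

lemma id_aut_at: "V \<in> opens X U \<Longrightarrow> s \<in> Sec V \<Longrightarrow> id_aut U V s = s"
  by (simp add: id_aut_def)

lemma comp_aut_closed:
  assumes U: "openin X U" and a: "\<alpha> \<in> ext_auts M E U" and b: "\<beta> \<in> ext_auts M E U"
  shows "comp_aut U \<alpha> \<beta> \<in> ext_auts M E U"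
proof (rule autI[OF U])
  show "comp_aut U \<alpha> \<beta> \<in> extensional (opens X U)" by (simp add: comp_aut_def)
  fix V assume V: "V \<in> opens X U"
  note oV = opens_open[OF V]
  show "comp_aut U \<alpha> \<beta> V \<in> extensional (Sec V)" using V by (simp add: comp_aut_def)
  show "comp_aut U \<alpha> \<beta> V s \<in> Sec V" if s: "s \<in> Sec V" for s
    by (simp add: comp_aut_at[OF V s] aut_closed[OF a V] aut_closed[OF b V] s)
  show "comp_aut U \<alpha> \<beta> V (s \<otimes>\<^bsub>sring V\<^esub> t) = comp_aut U \<alpha> \<beta> V s \<otimes>\<^bsub>sring V\<^esub> comp_aut U \<alpha> \<beta> V t"
    if "s \<in> Sec V" "t \<in> Sec V" for s t
    using that by (simp add: comp_aut_at[OF V] sec_mult_closed[OF oV] aut_mult[OF b V] aut_mult[OF a V] aut_closed[OF b V])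
  show "comp_aut U \<alpha> \<beta> V (s \<oplus>\<^bsub>sring V\<^esub> t) = comp_aut U \<alpha> \<beta> V s \<oplus>\<^bsub>sring V\<^esub> comp_aut U \<alpha> \<beta> V t"
    if "s \<in> Sec V" "t \<in> Sec V" for s t
    using that by (simp add: comp_aut_at[OF V] sec_add_closed[OF oV] aut_add[OF b V] aut_add[OF a V] aut_closed[OF b V])
  show "comp_aut U \<alpha> \<beta> V (const_section E V c) = const_section E V c" for c
    by (simp add: comp_aut_at[OF V const_section_closed[OF oV]] aut_const[OF b V] aut_const[OF a V])
  show "bij_betw (comp_aut U \<alpha> \<beta> V) (Sec V) (Sec V)"
    using V bij_betw_compose[OF aut_bij[OF b V] aut_bij[OF a V]] by (simp add: comp_aut_def)
  show "comp_aut U \<alpha> \<beta> V s \<in> Part V even" if s: "s \<in> Part V even" for s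
    by (simp add: comp_aut_at[OF V PartD(1)[OF s]] aut_even[OF a V] aut_even[OF b V] s)
  show "comp_aut U \<alpha> \<beta> V s \<in> Part V odd" if s: "s \<in> Part V odd" for s
    using aut_odd[OF a V aut_odd[OF b V s]] comp_aut_at[OF V PartD(1)[OF s]] by simp
  show "comp_aut U \<alpha> \<beta> W (restrict s W) = restrict (comp_aut U \<alpha> \<beta> V s) W" if W: "W \<in> opens X V" and s: "s \<in> Sec V" for W s
    unfolding comp_aut_at[OF opens_trans[OF V W] section_restrict[OF oV W s]] comp_aut_at[OF V s]
      aut_restr[OF b V W s] aut_restr[OF a V W aut_closed[OF b V s]] by (rule refl)
qed

lemma id_aut_closed: "openin X U \<Longrightarrow> id_aut U \<in> ext_auts M E U"
proof (rule autI, assumption)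
  show "id_aut U \<in> extensional (opens X U)" by (simp add: id_aut_def)
  fix V assume V: "V \<in> opens X U"
  note oV = opens_open[OF V]
  show "id_aut U V \<in> extensional (Sec V)" using V by (simp add: id_aut_def)
  show "bij_betw (id_aut U V) (Sec V) (Sec V)"
    using bij_betw_cong[of "Sec V" "id_aut U V" "\<lambda>s. s" "Sec V"] id_aut_at[OF V] bij_betw_id[of "Sec V"]
    by (simp add: id_def)
  show "id_aut U V s \<in> Part V even" if s: "s \<in> Part V even" for s
    using s id_aut_at[OF V PartD(1)[OF s]] by simp
  show "id_aut U V s \<in> Part V odd" if s: "s \<in> Part V odd" for s
    using s id_aut_at[OF V PartD(1)[OF s]] by simp
  show "id_aut U V (const_section E V c) = const_section E V c" for c
    by (rule id_aut_at[OF V const_section_closed[OF oV]])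
  show "id_aut U W (restrict s W) = restrict (id_aut U V s) W" if W: "W \<in> opens X V" and s: "s \<in> Sec V" for W s
    unfolding id_aut_at[OF opens_trans[OF V W] section_restrict[OF oV W s]] id_aut_at[OF V s] by (rule refl)
qed (simp_all add: id_aut_at sec_mult_closed[OF opens_open] sec_add_closed[OF opens_open])

lemma inv_aut_at:
  assumes a: "\<alpha> \<in> ext_auts M E U" and V: "V \<in> opens X U" and s: "s \<in> Sec V"
  shows inv_aut_Sec: "inv_aut U \<alpha> V s \<in> Sec V" and aut_inv_aut: "\<alpha> V (inv_aut U \<alpha> V s) = s"
    and inv_aut_aut: "inv_aut U \<alpha> V (\<alpha> V s) = s"
proof -
  note bij = aut_bij[OF a V]
  have s': "s \<in> \<alpha> V ` Sec V" using bij s by (simp add: bij_betw_def)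
  have e: "inv_aut U \<alpha> V t = inv_into (Sec V) (\<alpha> V) t" if "t \<in> Sec V" for t
    using V that by (simp add: inv_aut_def)
  show "inv_aut U \<alpha> V s \<in> Sec V" unfolding e[OF s] by (rule inv_into_into[OF s'])
  show "\<alpha> V (inv_aut U \<alpha> V s) = s" unfolding e[OF s] by (rule f_inv_into_f[OF s'])
  show "inv_aut U \<alpha> V (\<alpha> V s) = s"
    unfolding e[OF aut_closed[OF a V s]] by (rule inv_into_f_f[OF bij_betw_imp_inj_on[OF bij] s])
qed

lemma aut_inj:
  assumes "\<alpha> \<in> ext_auts M E U" "V \<in> opens X U" "s \<in> Sec V" "t \<in> Sec V" "\<alpha> V s = \<alpha> V t"
  shows "s = t"
  using inj_onD[OF bij_betw_imp_inj_on[OF aut_bij[OF assms(1,2)]] assms(5,3,4)] .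

text \<open>Decompose the preimage into its parts of either parity: the image of the part of the wrong
  parity has both parities, so it is zero.\<close>

lemma aut_parity_inv:
  assumes a: "\<alpha> \<in> ext_auts M E U" and V: "V \<in> opens X U" and t: "t \<in> Sec V"
    and Q: "\<And>n. Q n \<longleftrightarrow> \<not> P n"
    and pP: "\<And>s. s \<in> Part V P \<Longrightarrow> \<alpha> V s \<in> Part V P" and pQ: "\<And>s. s \<in> Part V Q \<Longrightarrow> \<alpha> V s \<in> Part V Q"
    and at: "\<alpha> V t \<in> Part V P"
  shows "t \<in> Part V P"
proof -
  have oV: "openin X V" by (rule opens_open[OF V])
  obtain t1 where t1: "t1 \<in> Sec V" "\<And>x a. \<lbrakk>x \<in> V; a \<in> letters (fibre E x); t x = ext_class E x a\<rbrakk> \<Longrightarrow> t1 x = ext_class E x (len_part P a)"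
    using section_part[OF oV t, of P] by blast
  obtain t2 where t2: "t2 \<in> Sec V" "\<And>x a. \<lbrakk>x \<in> V; a \<in> letters (fibre E x); t x = ext_class E x a\<rbrakk> \<Longrightarrow> t2 x = ext_class E x (len_part Q a)"
    using section_part[OF oV t, of Q] by blast
  have parts: "t1 x \<in> ext_part E x P \<and> t2 x \<in> ext_part E x Q \<and> t x = t1 x \<oplus>\<^bsub>ext_algebra E x\<^esub> t2 x" if x: "x \<in> V" for x
  proof -
    interpret ext_fibre E x by (rule ext_fibre[OF opens_top[OF V x]])
    obtain b where b: "b \<in> A" "t x = cl b" using carrier_R[OF section_carrier[OF t x]] by blast
    have "Q = (\<lambda>n. \<not> P n)" using Q by blast
    then have "len_part P b + len_part Q b = b" using len_part_split[of b P] by simp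
    then show ?thesis
      using t1(2)[OF x b] t2(2)[OF x b] b
      by (simp add: cl_add letters_len_part cl_partI len_part_in)
  qed
  have P1: "t1 \<in> Part V P" "t2 \<in> Part V Q"
    using PartI[OF t1(1), of P] PartI[OF t2(1), of Q] parts by blast+
  have "t1 \<oplus>\<^bsub>sring V\<^esub> t2 = t"
    using parts by (intro section_eqI[OF sec_add_closed[OF oV t1(1) t2(1)] t]) simp
  then have sum: "\<alpha> V t = \<alpha> V t1 \<oplus>\<^bsub>sring V\<^esub> \<alpha> V t2" using aut_add[OF a V t1(1) t2(1)] by simp
  have "\<alpha> V t2 x = const_section E V 0 x" if x: "x \<in> V" for x
  proof -
    interpret ext_fibre E x by (rule ext_fibre[OF opens_top[OF V x]])
    have "\<alpha> V t2 x = \<alpha> V t x \<ominus>\<^bsub>R\<^esub> \<alpha> V t1 x"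
      using R_add_diff_cancel[OF section_carrier[OF aut_closed[OF a V t2(1)] x] section_carrier[OF aut_closed[OF a V t1(1)] x]] x
      by (simp add: sum)
    then have "\<alpha> V t2 x \<in> ext_part E x P"
      using part_diff[OF PartD(2)[OF at x] PartD(2)[OF pP[OF P1(1)] x]] by simp
    then have "\<alpha> V t2 x = \<zero>\<^bsub>R\<^esub>"
      by (rule part_disjoint[OF _ PartD(2)[OF pQ[OF P1(2)] x]]) (simp add: Q)
    then show ?thesis using x by (simp add: const_section_def cl_zero)
  qed
  then have "\<alpha> V t2 = \<alpha> V (const_section E V 0)"
    unfolding aut_const[OF a V] by (rule section_eqI[OF aut_closed[OF a V t2(1)] const_section_closed[OF oV]])
  then have t20: "t2 = const_section E V 0"
    by (rule aut_inj[OF a V t2(1) const_section_closed[OF oV]])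
  have "t x = t1 x" if x: "x \<in> V" for x
  proof -
    interpret ext_fibre E x by (rule ext_fibre[OF opens_top[OF V x]])
    have "t2 x = \<zero>\<^bsub>R\<^esub>" using x by (simp add: t20 const_section_def cl_zero)
    then show ?thesis using parts[OF x] R_add_zero[OF section_carrier[OF t1(1) x]] by simp
  qed
  then have "t = t1" by (rule section_eqI[OF t t1(1)])
  then show ?thesis using P1(1) by simp
qed

lemma inv_aut_closed:
  assumes U: "openin X U" and a: "\<alpha> \<in> ext_auts M E U"
  shows "inv_aut U \<alpha> \<in> ext_auts M E U"
proof (rule autI[OF U])
  let ?b = "inv_aut U \<alpha>"
  show "?b \<in> extensional (opens X U)" by (simp add: inv_aut_def)
  fix V assume V: "V \<in> opens X U"
  note oV = opens_open[OF V]
  note i = inv_aut_at[OF a V]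
  show "?b V \<in> extensional (Sec V)" using V by (simp add: inv_aut_def)
  show "?b V s \<in> Sec V" if "s \<in> Sec V" for s by (rule i(1)[OF that])
  show "?b V (s \<otimes>\<^bsub>sring V\<^esub> t) = ?b V s \<otimes>\<^bsub>sring V\<^esub> ?b V t" if s: "s \<in> Sec V" and t: "t \<in> Sec V" for s t
    using aut_mult[OF a V i(1)[OF s] i(1)[OF t]] i(2)[OF s] i(2)[OF t]
      i(3)[OF sec_mult_closed[OF oV i(1)[OF s] i(1)[OF t]]] by simp
  show "?b V (s \<oplus>\<^bsub>sring V\<^esub> t) = ?b V s \<oplus>\<^bsub>sring V\<^esub> ?b V t" if s: "s \<in> Sec V" and t: "t \<in> Sec V" for s t
    using aut_add[OF a V i(1)[OF s] i(1)[OF t]] i(2)[OF s] i(2)[OF t]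
      i(3)[OF sec_add_closed[OF oV i(1)[OF s] i(1)[OF t]]] by simp
  show "?b V (const_section E V c) = const_section E V c" for c
    using i(3)[OF const_section_closed[OF oV]] aut_const[OF a V] by simp
  show "bij_betw (?b V) (Sec V) (Sec V)"
    by (rule bij_betwI[where g = "\<alpha> V"]) (auto intro: i aut_closed[OF a V])
  show "?b V s \<in> Part V even" if s: "s \<in> Part V even" for s
    by (rule aut_parity_inv[OF a V i(1)[OF PartD(1)[OF s]], where Q = odd])
      (use s i(2)[OF PartD(1)[OF s]] aut_even[OF a V] aut_odd[OF a V] in auto)
  show "?b V s \<in> Part V odd" if s: "s \<in> Part V odd" for s
    by (rule aut_parity_inv[OF a V i(1)[OF PartD(1)[OF s]], where Q = even])
      (use s i(2)[OF PartD(1)[OF s]] aut_even[OF a V] aut_odd[OF a V] in auto)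
  show "?b W (restrict s W) = restrict (?b V s) W" if W: "W \<in> opens X V" and s: "s \<in> Sec V" for W s
    using inv_aut_aut[OF a opens_trans[OF V W] section_restrict[OF oV W i(1)[OF s]]]
      aut_restr[OF a V W i(1)[OF s]] i(2)[OF s] by simp
qed

lemma comp_G:
  assumes U: "openin X U" and a: "\<alpha> \<in> G k U" and b: "\<beta> \<in> G k U"
  shows "comp_aut U \<alpha> \<beta> \<in> G k U"
  unfolding G_iff
proof (intro conjI ballI comp_aut_closed U G_aut[OF a] G_aut[OF b])
  fix V s x assume V: "V \<in> opens X U" and s: "s \<in> Sec V" and x: "x \<in> V"
  interpret ext_fibre E x by (rule ext_fibre[OF opens_top[OF V x]])
  note bs = aut_closed[OF G_aut[OF b] V s]
  show "comp_aut U \<alpha> \<beta> V s x \<ominus>\<^bsub>R\<^esub> s x \<in> fil x k"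
    unfolding comp_aut_at[OF V s]
    by (rule part_diff_trans[OF section_carrier[OF aut_closed[OF G_aut[OF a] V bs] x] section_carrier[OF bs x] section_carrier[OF s x]
          G_fil[OF a V bs x] G_fil[OF b V s x]])
qed

lemma id_G: "openin X U \<Longrightarrow> id_aut U \<in> G k U"
  unfolding G_iff
  by (auto simp: id_aut_closed id_aut_at ext_fibre.R_diff_self[OF ext_fibre[OF opens_top] section_carrier]
      ext_fibre.part_zero[OF ext_fibre[OF opens_top]])

lemma inv_G:
  assumes U: "openin X U" and a: "\<alpha> \<in> G k U"
  shows "inv_aut U \<alpha> \<in> G k U"
  unfolding G_iff
proof (intro conjI ballI inv_aut_closed U G_aut[OF a])
  fix V s x assume V: "V \<in> opens X U" and s: "s \<in> Sec V" and x: "x \<in> V"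
  interpret ext_fibre E x by (rule ext_fibre[OF opens_top[OF V x]])
  note i = inv_aut_at[OF G_aut[OF a] V s]
  show "inv_aut U \<alpha> V s x \<ominus>\<^bsub>R\<^esub> s x \<in> fil x k"
    by (rule part_diff_swap[OF section_carrier[OF s x] section_carrier[OF i(1) x]])
      (use G_fil[OF a V i(1) x] i(2) in simp)
qed

lemma G_mult: "\<alpha> \<otimes>\<^bsub>sections (G_sheaf M E k) U\<^esub> \<beta> = comp_aut U \<alpha> \<beta>"
  and G_one: "\<one>\<^bsub>sections (G_sheaf M E k) U\<^esub> = id_aut U"
  and G_restr: "restr (G_sheaf M E k) U V \<alpha> = restrict \<alpha> (opens X V)"
  by (simp_all add: G_sheaf_def comp_aut_def id_aut_def)

lemma G_eqI: "\<lbrakk>\<alpha> \<in> G k U; \<beta> \<in> G k' U; \<And>V s. \<lbrakk>V \<in> opens X U; s \<in> Sec V\<rbrakk> \<Longrightarrow> \<alpha> V s = \<beta> V s\<rbrakk> \<Longrightarrow> \<alpha> = \<beta>"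
  by (rule aut_eqI[OF G_aut G_aut])

lemma comp_inv_aut:
  assumes U: "openin X U" and a: "\<alpha> \<in> G k U"
  shows "comp_aut U (inv_aut U \<alpha>) \<alpha> = id_aut U"
  by (rule G_eqI[OF comp_G[OF U inv_G[OF U a] a] id_G[OF U]])
    (simp add: comp_aut_at id_aut_at inv_aut_aut[OF G_aut[OF a]])

lemma group_G:
  assumes U: "openin X U"
  shows "group (sections (G_sheaf M E k) U)"
proof (rule groupI, unfold G_mult G_one)
  show "id_aut U \<in> G k U" by (rule id_G[OF U])
  fix \<alpha> assume a: "\<alpha> \<in> G k U"
  show "comp_aut U (id_aut U) \<alpha> = \<alpha>"
    by (rule G_eqI[OF comp_G[OF U id_G[OF U] a] a])
      (simp add: comp_aut_at id_aut_at aut_closed[OF G_aut[OF a]])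
  show "\<exists>\<beta>\<in>G k U. comp_aut U \<beta> \<alpha> = id_aut U"
    using comp_inv_aut[OF U a] inv_G[OF U a] by blast
  fix \<beta> assume b: "\<beta> \<in> G k U"
  show "comp_aut U \<alpha> \<beta> \<in> G k U" by (rule comp_G[OF U a b])
  fix \<gamma> assume c: "\<gamma> \<in> G k U"
  show "comp_aut U (comp_aut U \<alpha> \<beta>) \<gamma> = comp_aut U \<alpha> (comp_aut U \<beta> \<gamma>)"
    by (rule G_eqI[OF comp_G[OF U comp_G[OF U a b] c] comp_G[OF U a comp_G[OF U b c]]])
      (simp add: comp_aut_at aut_closed[OF G_aut[OF b]] aut_closed[OF G_aut[OF c]])
qed

lemma G_inv:
  assumes U: "openin X U" and a: "\<alpha> \<in> G k U"
  shows "inv\<^bsub>sections (G_sheaf M E k) U\<^esub> \<alpha> = inv_aut U \<alpha>"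
  by (rule group.inv_equality[OF group_G[OF U] _ a inv_G[OF U a]])
    (simp add: G_mult G_one comp_inv_aut[OF U a])

lemma restrict_G:
  assumes U: "openin X U" and V: "V \<in> opens X U" and a: "\<alpha> \<in> G k U"
  shows "restrict \<alpha> (opens X V) \<in> G k V"
proof -
  have s: "W \<in> opens X U" if "W \<in> opens X V" for W by (rule opens_trans[OF V that])
  note aa = G_aut[OF a]
  have e: "restrict \<alpha> (opens X V) W = \<alpha> W" if "W \<in> opens X V" for W
    using that by simp
  have "restrict \<alpha> (opens X V) \<in> ext_auts M E V"
  proof (rule autI[OF opens_open[OF V]])
    show "restrict \<alpha> (opens X V) \<in> extensional (opens X V)" by simp
    fix W assume W: "W \<in> opens X V"
    note A = aa s[OF W]
    show "restrict \<alpha> (opens X V) W \<in> extensional (Sec W)"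
      unfolding e[OF W] by (rule aut_ext[OF A])
    show "restrict \<alpha> (opens X V) W p \<in> Sec W" if "p \<in> Sec W" for p
      unfolding e[OF W] by (rule aut_closed[OF A that])
    show "restrict \<alpha> (opens X V) W (p \<otimes>\<^bsub>sring W\<^esub> q) = restrict \<alpha> (opens X V) W p \<otimes>\<^bsub>sring W\<^esub> restrict \<alpha> (opens X V) W q"
      if "p \<in> Sec W" "q \<in> Sec W" for p q
      unfolding e[OF W] by (rule aut_mult[OF A that])
    show "restrict \<alpha> (opens X V) W (p \<oplus>\<^bsub>sring W\<^esub> q) = restrict \<alpha> (opens X V) W p \<oplus>\<^bsub>sring W\<^esub> restrict \<alpha> (opens X V) W q"
      if "p \<in> Sec W" "q \<in> Sec W" for p q
      unfolding e[OF W] by (rule aut_add[OF A that])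
    show "restrict \<alpha> (opens X V) W (const_section E W c) = const_section E W c" for c
      unfolding e[OF W] by (rule aut_const[OF A])
    show "bij_betw (restrict \<alpha> (opens X V) W) (Sec W) (Sec W)"
      unfolding e[OF W] by (rule aut_bij[OF A])
    show "restrict \<alpha> (opens X V) W p \<in> Part W even" if "p \<in> Part W even" for p
      unfolding e[OF W] by (rule aut_even[OF A that])
    show "restrict \<alpha> (opens X V) W p \<in> Part W odd" if "p \<in> Part W odd" for p
      unfolding e[OF W] by (rule aut_odd[OF A that])
    show "restrict \<alpha> (opens X V) W' (restrict p W') = restrict (restrict \<alpha> (opens X V) W p) W'"
      if W': "W' \<in> opens X W" and p: "p \<in> Sec W" for W' p
      unfolding e[OF W] e[OF opens_trans[OF W W']] by (rule aut_restr[OF A W' p])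
  qed
  then show ?thesis
    unfolding G_iff using G_fil[OF a s] by (simp add: e)
qed

lemma G_mono:
  assumes k: "k \<le> k'" and a: "\<alpha> \<in> G k' U"
  shows "\<alpha> \<in> G k U"
  unfolding G_iff
proof (intro conjI ballI G_aut[OF a])
  fix V s x assume V: "V \<in> opens X U" and s: "s \<in> Sec V" and x: "x \<in> V"
  show "\<alpha> V s x \<ominus>\<^bsub>ext_algebra E x\<^esub> s x \<in> fil x k"
    by (rule fil_mono[OF opens_top[OF V x] G_fil[OF a V s x] k])
qed

lemma presheaf_G: "presheaf_of_groups X (G_sheaf M E k)"
proof (rule presheaf_of_groups.intro)
  fix U assume U: "openin X U"
  show "group (sections (G_sheaf M E k) U)" by (rule group_G[OF U])
  show "restr (G_sheaf M E k) U U \<alpha> = \<alpha>" if "\<alpha> \<in> G k U" for \<alpha>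
    unfolding G_restr by (rule extensional_restrict[OF aut_extensional[OF G_aut[OF that]]])
  fix V assume V: "V \<in> opens X U"
  have sub: "opens X V \<subseteq> opens X U" using opens_trans[OF V] by blast
  show "restr (G_sheaf M E k) U V \<in> hom (sections (G_sheaf M E k) U) (sections (G_sheaf M E k) V)"
  proof (rule homI, unfold G_mult G_restr)
    show "restrict \<alpha> (opens X V) \<in> G k V" if "\<alpha> \<in> G k U" for \<alpha> by (rule restrict_G[OF U V that])
    show "restrict (comp_aut U \<alpha> \<beta>) (opens X V) = comp_aut V (restrict \<alpha> (opens X V)) (restrict \<beta> (opens X V))" for \<alpha> \<beta>
      unfolding comp_aut_def using sub by (auto simp: fun_eq_iff)
  qed
  show "restr (G_sheaf M E k) V W (restr (G_sheaf M E k) U V \<alpha>) = restr (G_sheaf M E k) U W \<alpha>"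
    if W: "W \<in> opens X V" for W \<alpha>
    unfolding G_restr using opens_trans[OF W] by (auto simp: fun_eq_iff)
qed

lemma subpresheaf_G: "subpresheaf_of_groups X (G_sheaf M E k) (G_sheaf M E (k + 1))"
proof (rule subpresheaf_of_groups.intro[OF presheaf_G subpresheaf_of_groups_axioms.intro])
  fix U assume U: "openin X U"
  show "subgroup (G (k + 1) U) (sections (G_sheaf M E k) U)"
  proof (rule subgroup.intro, unfold G_mult G_one)
    show "G (k + 1) U \<subseteq> G k U" using G_mono[of k "k + 1"] by auto
    show "inv\<^bsub>sections (G_sheaf M E k) U\<^esub> \<alpha> \<in> G (k + 1) U" if a: "\<alpha> \<in> G (k + 1) U" for \<alpha>
      using inv_G[OF U a] G_inv[OF U G_mono[OF _ a], of k] by simp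
  qed (rule comp_G[OF U] id_G[OF U]; assumption?)+
  show "sections (G_sheaf M E (k + 1)) U = sections (G_sheaf M E k) U\<lparr>carrier := G (k + 1) U\<rparr>"
    by (simp add: G_sheaf_def)
  show "restr (G_sheaf M E k) U V \<alpha> \<in> G (k + 1) V" if "V \<in> opens X U" "\<alpha> \<in> G (k + 1) U" for V \<alpha>
    unfolding G_restr by (rule restrict_G[OF U that])
  show "\<alpha> \<in> G (k + 1) U"
    if a: "\<alpha> \<in> G k U" and loc: "\<And>x. x \<in> U \<Longrightarrow> \<exists>W\<in>opens X U. x \<in> W \<and> restr (G_sheaf M E k) U W \<alpha> \<in> G (k + 1) W" for \<alpha>
    unfolding G_iff
  proof (intro conjI ballI G_aut[OF a])
    fix V s x assume V: "V \<in> opens X U" and s: "s \<in> Sec V" and x: "x \<in> V"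
    have "x \<in> U" using V x by (auto simp: opens_def)
    then obtain W where W: "W \<in> opens X U" "x \<in> W" "restrict \<alpha> (opens X W) \<in> G (k + 1) W"
      using loc unfolding G_restr by blast
    have VW: "V \<inter> W \<in> opens X V" "V \<inter> W \<in> opens X W" "x \<in> V \<inter> W"
      using V W x by (auto simp: opens_def)
    show "\<alpha> V s x \<ominus>\<^bsub>ext_algebra E x\<^esub> s x \<in> fil x (k + 1)"
      using G_fil[OF W(3) VW(2) section_restrict[OF opens_open[OF V] VW(1) s] VW(3)]
        aut_local[OF G_aut[OF a] V VW(1) s VW(3)] VW by simp
  qed
qed (simp add: G_sheaf_def)

text \<open>The automorphism \<open>\<alpha>\<close> maps \<open>\<alpha>\<^sup>-\<^sup>1(\<beta>(s)) - s\<close> to \<open>\<beta>(s) - \<alpha>(s)\<close>, and both \<open>\<alpha>\<close> and its inverse respect the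
  filtration.\<close>

lemma quotient_congruent:
  assumes U: "openin X U" and k: "k \<ge> 1" and a: "\<alpha> \<in> G k U" and b: "\<beta> \<in> G k U"
  shows "comp_aut U (inv_aut U \<alpha>) \<beta> \<in> G (k + 1) U \<longleftrightarrow>
    (\<forall>V\<in>opens X U. \<forall>s\<in>Sec V. \<forall>x\<in>V. \<beta> V s x \<ominus>\<^bsub>ext_algebra E x\<^esub> \<alpha> V s x \<in> fil x (k + 1))"
    (is "?l \<longleftrightarrow> ?r")
proof
  assume l: ?l
  show ?r
  proof (intro ballI)
    fix V s x assume V: "V \<in> opens X U" and s: "s \<in> Sec V" and x: "x \<in> V"
    note oV = opens_open[OF V] and aa = G_aut[OF a]
    note bs = aut_closed[OF G_aut[OF b] V s]
    note ib = inv_aut_Sec[OF aa V bs]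
    note d = sec_diff_closed[OF oV ib s]
    have "\<alpha> V (sec_diff V (inv_aut U \<alpha> V (\<beta> V s)) s) x \<in> fil x (k + 1)"
    proof (rule aut_filtration[OF a k V d _ x])
      fix y assume y: "y \<in> V"
      show "sec_diff V (inv_aut U \<alpha> V (\<beta> V s)) s y \<in> fil y (k + 1)"
        using G_fil[OF l V s y] by (simp add: sec_diff_at[OF y] comp_aut_at[OF V s])
    qed
    then show "\<beta> V s x \<ominus>\<^bsub>ext_algebra E x\<^esub> \<alpha> V s x \<in> fil x (k + 1)"
      by (simp add: aut_diff[OF aa V ib s x] aut_inv_aut[OF aa V bs])
  qed
next
  assume r: ?r
  note i = inv_G[OF U a]
  show ?l
    unfolding G_iff
  proof (intro conjI ballI comp_aut_closed U G_aut[OF i] G_aut[OF b])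
    fix V s x assume V: "V \<in> opens X U" and s: "s \<in> Sec V" and x: "x \<in> V"
    note oV = opens_open[OF V] and aa = G_aut[OF a]
    note as = aut_closed[OF aa V s] and bs = aut_closed[OF G_aut[OF b] V s]
    note d = sec_diff_closed[OF oV bs as]
    have "inv_aut U \<alpha> V (sec_diff V (\<beta> V s) (\<alpha> V s)) x \<in> fil x (k + 1)"
    proof (rule aut_filtration[OF i k V d _ x])
      fix y assume y: "y \<in> V"
      show "sec_diff V (\<beta> V s) (\<alpha> V s) y \<in> fil y (k + 1)"
        using r V s y by (simp add: sec_diff_at[OF y])
    qed
    then show "comp_aut U (inv_aut U \<alpha>) \<beta> V s x \<ominus>\<^bsub>ext_algebra E x\<^esub> s x \<in> fil x (k + 1)"
      by (simp add: aut_diff[OF G_aut[OF i] V bs as x] comp_aut_at[OF V s] inv_aut_aut[OF aa V s])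
  qed
qed

end

section \<open>The linear part of an automorphism\<close>

context ext_fibre
begin

text \<open>As \<open>I\<close> is graded, an element of \<open>J\<^sup>k\<^sup>+\<^sup>1\<close> vanishes if it can be represented without words of
  length above \<open>k\<close>.\<close>

lemma low_part_in_I:
  assumes d: "d \<in> A" "cl d \<in> ext_part E x (\<lambda>j. k + 1 \<le> j)" and e: "e \<in> I" and l: "d - e \<in> lengths (\<lambda>n. n \<le> k)"
  shows "d \<in> I"
proof -
  let ?P = "\<lambda>n. \<not> k + 1 \<le> n"
  have "len_part ?P d \<in> I" using d cl_part_iff by simp
  moreover have "len_part ?P e \<in> I" by (rule I_len_part[OF e])
  moreover have "len_part ?P (d - e) = d - e" by (rule len_part_id[OF lengths_mono[OF l]]) simp
  ultimately have "d - e \<in> I" using I_diff[of "len_part ?P d" "len_part ?P e"] by (simp add: len_part_diff)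
  then show ?thesis using I_add[OF _ e, of "d - e"] by simp
qed

end

context model
begin

definition frame_terms :: "('e \<Rightarrow> nat \<Rightarrow> complex) \<Rightarrow> ('x \<Rightarrow> 'e) \<Rightarrow> nat \<Rightarrow> (('x \<Rightarrow> complex) \<times> ('x \<Rightarrow> 'e) list) list" where
  "frame_terms h u m = map (\<lambda>a. (\<lambda>y. h (u y) a, [frame h a])) [0..<m]"

lemma frame_terms_at: "terms_at (frame_terms h u m) y = (\<Sum>a<m. word [frame h a y] (h (u y) a))"
  by (induction m) (simp_all add: frame_terms_def)

text \<open>Modulo \<open>J\<^sup>k\<^sup>+\<^sup>1\<close>, an automorphism in \<open>G\<^sub>k\<close> with \<open>k\<close> odd is linear over the holomorphic functions on
  sections of the bundle. Expanding in a frame shows that the image at \<open>x\<close> depends on the value of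
  the section at \<open>x\<close> only.\<close>

lemma aut_vec_pointwise:
  assumes a: "\<alpha> \<in> G k U" and k: "odd k" and W: "W \<in> opens X U"
    and c: "(T, h) \<in> trivs E" and WT: "W \<subseteq> T"
    and u: "holo_section M E W u" and v: "holo_section M E W v" and x: "x \<in> W" and uv: "u x = v x"
  shows "\<alpha> W (vec_sec W u) x \<ominus>\<^bsub>ext_algebra E x\<^esub> \<alpha> W (vec_sec W v) x \<in> fil x (k + 1)"
proof -
  have oW: "openin X W" by (rule opens_open[OF W])
  note aa = G_aut[OF a]
  interpret ext_fibre E x by (rule ext_fibre[OF open_sub[OF oW x]])
  let ?s = "\<lambda>u m. \<lambda>y\<in>W. ext_class E y (terms_at (frame_terms h u m) y)"
  have holo: "holo_terms W (frame_terms h w m)" if w: "holo_section M E W w" and m: "m \<le> r" for w m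
    unfolding holo_terms_def frame_terms_def
    using m holo_section_coord[OF w c WT] holo_section_mono[OF frame_holo[OF c] WT] by auto
  have sec: "?s w m \<in> Sec W" if "holo_section M E W w" "m \<le> r" for w m
    by (rule terms_section[OF oW holo[OF that]])
  have cr: "\<alpha> W t x \<in> carrier R" if "t \<in> Sec W" for t
    by (rule section_carrier[OF aut_closed[OF aa W that] x])
  have full: "vec_sec W w = ?s w r" if w: "holo_section M E W w" for w
    unfolding vec_sec_def
  proof (rule restrict_ext)
    fix y assume y: "y \<in> W"
    interpret Y: ext_fibre E y by (rule ext_fibre[OF open_sub[OF oW y]])
    have wy: "w y \<in> fibre E y" by (rule holo_section_fibre[OF w y])
    have "word [w y] 1 - terms_at (frame_terms h w r) y \<in> Y.I"
      unfolding frame_terms_at using frame_expansion[OF c _ wy] y WT by auto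
    then show "ext_class E y (word [w y] 1) = ext_class E y (terms_at (frame_terms h w r) y)"
      using wy terms_at_letters[OF holo[OF w order_refl] y] by (subst Y.cl_eq_iff) (auto intro: letters_word)
  qed
  have step: "?s w (Suc m) = ?s w m \<oplus>\<^bsub>sring W\<^esub> (fun_sec W (\<lambda>y. h (w y) m) \<otimes>\<^bsub>sring W\<^esub> vec_sec W (frame h m))"
    if w: "holo_section M E W w" and m: "Suc m \<le> r" for w m
  proof (rule extensionalityI[where A = W])
    fix y assume y: "y \<in> W"
    interpret Y: ext_fibre E y by (rule ext_fibre[OF open_sub[OF oW y]])
    have f: "frame h m y \<in> fibre E y" using frame_fibre[OF c _] y WT m by auto
    have e: "terms_at (frame_terms h w (Suc m)) y = terms_at (frame_terms h w m) y + word [] (h (w y) m) * word [frame h m y] 1"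
      by (simp add: frame_terms_at word_mult)
    have l: "terms_at (frame_terms h w m) y \<in> letters (fibre E y)" using m by (intro terms_at_letters[OF holo[OF w] y]) simp
    have l1: "word [] (h (w y) m) \<in> letters (fibre E y)" "word [frame h m y] 1 \<in> letters (fibre E y)"
      using f by (auto intro: letters_word)
    show "?s w (Suc m) y = (?s w m \<oplus>\<^bsub>sring W\<^esub> (fun_sec W (\<lambda>y. h (w y) m) \<otimes>\<^bsub>sring W\<^esub> vec_sec W (frame h m))) y"
      using y l l1 by (simp add: e Y.cl_add Y.cl_mult letters_mult fun_sec_def vec_sec_def)
  qed (auto simp: ext_section_ring_def)
  have "\<alpha> W (?s u m) x \<ominus>\<^bsub>R\<^esub> \<alpha> W (?s v m) x \<in> fil x (k + 1)" if "m \<le> r" for m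
    using that
  proof (induction m)
    case 0
    have "?s u 0 = ?s v 0" by (simp add: frame_terms_def)
    then show ?case by (simp only: part_zero R_diff_self[OF cr[OF sec[OF v le0]]])
  next
    case (Suc m)
    let ?e = "vec_sec W (frame h m)"
    let ?f = "\<lambda>w. fun_sec W (\<lambda>y. h (w y) m)"
    have m: "m \<le> r" "m < r" using Suc.prems by auto
    have e: "?e \<in> Sec W" by (rule vec_sec_section[OF oW holo_section_mono[OF frame_holo[OF c m(2)] WT]])
    have hf: "holo_fun M W (\<lambda>y. h (w y) m)" if "holo_section M E W w" for w
      by (rule holo_section_coord[OF that c WT m(2)])
    have f: "?f w \<in> Sec W" if "holo_section M E W w" for w by (rule fun_sec_section[OF oW hf[OF that]])
    have val: "\<alpha> W (?s w (Suc m)) x = \<alpha> W (?s w m) x \<oplus>\<^bsub>R\<^esub> (\<alpha> W (?f w) x \<otimes>\<^bsub>R\<^esub> \<alpha> W ?e x)"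
      if w: "holo_section M E W w" for w
      unfolding step[OF w Suc.prems] aut_add[OF aa W sec[OF w m(1)] sec_mult_closed[OF oW f[OF w] e]]
        aut_mult[OF aa W f[OF w] e] using x by simp
    have fx: "?f u x = ?f v x" using x uv by (simp add: fun_sec_def)
    have "\<alpha> W (?f u) x \<ominus>\<^bsub>R\<^esub> \<alpha> W (?f v) x \<in> fil x (k + 1)"
      by (rule part_diff_trans[OF cr[OF f[OF u]] section_carrier[OF f[OF u] x] cr[OF f[OF v]] aut_fun[OF a k W hf[OF u] x]])
        (unfold fx, rule part_diff_swap[OF cr[OF f[OF v]] section_carrier[OF f[OF v] x] aut_fun[OF a k W hf[OF v] x]])
    moreover have "\<alpha> W ?e x \<ominus>\<^bsub>R\<^esub> \<alpha> W ?e x \<in> fil x (k + 1)"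
      using R_diff_self[OF cr[OF e]] part_zero by simp
    ultimately have p: "(\<alpha> W (?f u) x \<otimes>\<^bsub>R\<^esub> \<alpha> W ?e x) \<ominus>\<^bsub>R\<^esub> (\<alpha> W (?f v) x \<otimes>\<^bsub>R\<^esub> \<alpha> W ?e x) \<in> fil x (k + 1)"
      by (rule part_diff_mult[OF cr[OF f[OF u]] cr[OF e] cr[OF f[OF v]] cr[OF e]])
    have mc: "\<alpha> W (?f w) x \<otimes>\<^bsub>R\<^esub> \<alpha> W ?e x \<in> carrier R" if "holo_section M E W w" for w
      using monoid.m_closed[OF ring.is_monoid[OF ring_R] cr[OF f[OF that]] cr[OF e]] .
    show ?case
      unfolding val[OF u] val[OF v] R_diff_add[OF cr[OF sec[OF u m(1)]] mc[OF u] cr[OF sec[OF v m(1)]] mc[OF v]]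
      by (rule part_add[OF Suc.IH[OF m(1)] p])
  qed
  from this[of r] show ?thesis using full[OF u] full[OF v] by simp
qed

lemma vector_extends_near:
  assumes x: "x \<in> V" and V: "openin X V" and v: "v \<in> fibre E x"
  shows "\<exists>W\<in>opens X V. x \<in> W \<and> (\<exists>u. holo_section M E W u \<and> u x = v)"
proof -
  obtain T h where T: "(T, h) \<in> trivs E" "x \<in> T" using triv_exists[OF open_sub[OF V x]] by blast
  obtain u where u: "holo_section M E T u" "u x = v" using vector_extends[OF T v] by blast
  show ?thesis
    using V triv_open[OF T(1)] x T(2) u(2) holo_section_mono[OF u(1), of "V \<inter> T"]
    by (intro bexI[of _ "V \<inter> T"]) (auto simp: opens_def)
qed

end

section \<open>The global lift\<close>

text \<open>For odd \<open>k\<close> the automorphisms that represent \<open>a\<close> are linear over functions modulo \<open>J\<^sup>k\<^sup>+\<^sup>1\<close>, and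
  \<open>k \<ge> 2\<close> makes their difference to the identity nilpotent.\<close>

locale quotient_section = model M E for M :: "'x cmanifold" and E :: "('x, 'e) vbundle" +
  fixes k :: nat and a :: "'x \<Rightarrow> ('x set \<times> ('x, 'e) ext_aut) set"
  assumes odd_k: "odd k" and k2: "k \<ge> 2"
    and section_a: "a \<in> quot_sections X (G_sheaf M E k) (G_sheaf M E (k + 1)) (topspace X)"
begin

sublocale GN: subpresheaf_of_groups X "G_sheaf M E k" "G_sheaf M E (k + 1)"
  by (rule subpresheaf_G)

abbreviation germ where
  "germ x V \<alpha> \<equiv> quot_germ X (G_sheaf M E k) (G_sheaf M E (k + 1)) x V \<alpha>"

definition is_lift :: "'x set \<Rightarrow> ('x, 'e) ext_aut \<Rightarrow> bool" where
  "is_lift V \<alpha> \<longleftrightarrow> openin X V \<and> \<alpha> \<in> G k V \<and> (\<forall>y\<in>V. a y = germ y V \<alpha>)"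

lemma lift_exists:
  assumes x: "x \<in> topspace X"
  shows "\<exists>V \<alpha>. is_lift V \<alpha> \<and> x \<in> V"
proof -
  have "\<forall>x\<in>topspace X. \<exists>V\<in>opens X (topspace X). x \<in> V \<and> (\<exists>\<alpha>\<in>G k V. \<forall>y\<in>V. a y = germ y V \<alpha>)"
    using section_a unfolding quot_sections_def by simp
  from bspec[OF this x] show ?thesis unfolding is_lift_def opens_def by blast
qed

lemma liftD: "is_lift V \<alpha> \<Longrightarrow> openin X V" "is_lift V \<alpha> \<Longrightarrow> \<alpha> \<in> G k V"
  by (simp_all add: is_lift_def)

lemma lift_congruent:
  assumes l: "is_lift V \<alpha>" and x: "x \<in> V" and b: "(V', \<beta>) \<in> a x"
  shows "\<beta> \<in> G k V'" and "openin X V'"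
    and "\<exists>W\<in>opens X (V \<inter> V'). x \<in> W \<and>
      (\<forall>S\<in>opens X W. \<forall>s\<in>Sec S. \<forall>y\<in>S. \<beta> S s y \<ominus>\<^bsub>ext_algebra E y\<^esub> \<alpha> S s y \<in> fil y (k + 1))"
proof -
  note V = liftD[OF l]
  have "(V', \<beta>) \<in> germ x V \<alpha>" using b l x by (simp add: is_lift_def)
  then have oV': "openin X V'" and b': "\<beta> \<in> G k V'"
    and "\<exists>W\<in>opens X (V \<inter> V'). x \<in> W \<and> inv\<^bsub>sections (G_sheaf M E k) W\<^esub> (restrict \<alpha> (opens X W))
        \<otimes>\<^bsub>sections (G_sheaf M E k) W\<^esub> restrict \<beta> (opens X W) \<in> G (k + 1) W"
    by (simp_all add: quot_germ_def G_restr)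
  then obtain W where W: "W \<in> opens X (V \<inter> V')" "x \<in> W" "inv\<^bsub>sections (G_sheaf M E k) W\<^esub> (restrict \<alpha> (opens X W))
        \<otimes>\<^bsub>sections (G_sheaf M E k) W\<^esub> restrict \<beta> (opens X W) \<in> G (k + 1) W" by blast
  have oW: "openin X W" "W \<in> opens X V" "W \<in> opens X V'" using W(1) by (auto simp: opens_def)
  note r = restrict_G[OF V(1) oW(2) V(2)] restrict_G[OF oV' oW(3) b']
  have "comp_aut W (inv_aut W (restrict \<alpha> (opens X W))) (restrict \<beta> (opens X W)) \<in> G (k + 1) W"
    using W(3) unfolding G_inv[OF oW(1) r(1)] G_mult .
  then have "\<forall>S\<in>opens X W. \<forall>s\<in>Sec S. \<forall>y\<in>S. \<beta> S s y \<ominus>\<^bsub>ext_algebra E y\<^esub> \<alpha> S s y \<in> fil y (k + 1)"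
    using quotient_congruent[OF oW(1) _ r] k2 by simp
  then show "\<beta> \<in> G k V'" and "openin X V'"
    and "\<exists>W\<in>opens X (V \<inter> V'). x \<in> W \<and>
      (\<forall>S\<in>opens X W. \<forall>s\<in>Sec S. \<forall>y\<in>S. \<beta> S s y \<ominus>\<^bsub>ext_algebra E y\<^esub> \<alpha> S s y \<in> fil y (k + 1))"
    using W(1,2) b' oV' by blast+
qed

text \<open>\<open>gen_image x v\<close> represents \<open>v + \<phi>\<^sub>x(v)\<close>, where \<open>\<phi>\<^sub>x(v)\<close> is the component of degree \<open>k\<close> of the
  image of \<open>v\<close> under any automorphism inducing \<open>a\<close> near \<open>x\<close>.\<close>

definition is_gen_image :: "'x \<Rightarrow> 'e \<Rightarrow> ('e list \<Rightarrow>\<^sub>0 complex) \<Rightarrow> bool" where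
  "is_gen_image x v b \<longleftrightarrow> b \<in> letters (fibre E x) \<and> b - word [v] 1 \<in> lengths ((=) k) \<and>
    (\<exists>V \<alpha> W u. (V, \<alpha>) \<in> a x \<and> W \<in> opens X V \<and> x \<in> W \<and> holo_section M E W u \<and> u x = v \<and>
      \<alpha> W (vec_sec W u) x \<ominus>\<^bsub>ext_algebra E x\<^esub> ext_class E x b \<in> fil x (k + 1))"

definition gen_image :: "'x \<Rightarrow> 'e \<Rightarrow> ('e list \<Rightarrow>\<^sub>0 complex)" where
  "gen_image x v = (SOME b. is_gen_image x v b)"

lemma gen_image:
  assumes x: "x \<in> topspace X" and v: "v \<in> fibre E x"
  shows "is_gen_image x v (gen_image x v)"
proof -
  interpret ext_fibre E x by (rule ext_fibre[OF x])
  obtain V \<alpha> where l: "is_lift V \<alpha>" "x \<in> V" using lift_exists[OF x] by blast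
  note V = liftD[OF l(1)]
  obtain W u where W: "W \<in> opens X V" "x \<in> W" and u: "holo_section M E W u" "u x = v"
    using vector_extends_near[OF l(2) V(1) v] by blast
  have oW: "openin X W" by (rule opens_open[OF W(1)])
  have in_a: "(V, \<alpha>) \<in> a x"
    using GN.quot_germ_self[OF V l(2)] l by (simp add: is_lift_def)
  note s = vec_sec_section[OF oW u(1)]
  let ?w = "word [v] 1"
  have w: "?w \<in> A" using v by (intro letters_word) simp
  obtain c where c: "c \<in> A" "\<alpha> W (vec_sec W u) x = cl c"
    using carrier_R[OF section_carrier[OF aut_closed[OF G_aut[OF V(2)] W(1) s] W(2)]] by blast
  have "vec_sec W u x = cl ?w" using W(2) u(2) by (simp add: vec_sec_def)
  then have "cl (c - ?w) \<in> fil x k"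
    using G_fil[OF V(2) W(1) s W(2)] c w by (simp add: cl_diff)
  then have low: "len_part (\<lambda>n. \<not> k \<le> n) (c - ?w) \<in> I" using cl_part_iff c w by (simp add: letters_diff)
  define b where "b = ?w + len_part ((=) k) (c - ?w)"
  have b: "b \<in> A" unfolding b_def by (intro letters_add w letters_len_part letters_diff c)
  have cb: "c - b = (c - ?w) - len_part ((=) k) (c - ?w)" by (simp add: b_def)
  have "len_part (\<lambda>n. \<not> k + 1 \<le> n) (c - b) = len_part (\<lambda>n. \<not> k \<le> n) (c - ?w)"
    unfolding cb by (intro poly_mapping_eqI) (auto simp: lookup_len_part lookup_minus)
  with low have "cl c \<ominus>\<^bsub>R\<^esub> cl b \<in> fil x (k + 1)"
    using cl_part_iff[OF letters_diff[OF c(1) b]] by (simp add: cl_diff[OF c(1) b])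
  moreover have "b - ?w \<in> lengths ((=) k)" using len_part_in[of "(=) k" "c - ?w"] by (simp add: b_def)
  ultimately have "is_gen_image x v b"
    unfolding is_gen_image_def using b in_a W u c(2) by metis
  then show ?thesis unfolding gen_image_def by (rule someI)
qed

lemma gen_image_letters: "x \<in> topspace X \<Longrightarrow> v \<in> fibre E x \<Longrightarrow> gen_image x v \<in> letters (fibre E x)"
  and gen_image_diff: "x \<in> topspace X \<Longrightarrow> v \<in> fibre E x \<Longrightarrow> gen_image x v - word [v] 1 \<in> lengths ((=) k)"
  using gen_image by (simp_all add: is_gen_image_def)

text \<open>The choices made for \<open>gen_image\<close> do not matter modulo \<open>J\<^sup>k\<^sup>+\<^sup>1\<close>: automorphisms that induce \<open>a\<close> are congruent,
  and the image of a section of the bundle at \<open>x\<close> depends on its value at \<open>x\<close> only.\<close>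

lemma gen_image_lift:
  assumes l: "is_lift V \<alpha>" and W: "W \<in> opens X V" and x: "x \<in> W" and u: "holo_section M E W u"
  shows "\<alpha> W (vec_sec W u) x \<ominus>\<^bsub>ext_algebra E x\<^esub> ext_class E x (gen_image x (u x)) \<in> fil x (k + 1)"
proof -
  note V = liftD[OF l]
  have oW: "openin X W" by (rule opens_open[OF W])
  have xt: "x \<in> topspace X" by (rule open_sub[OF oW x])
  have xV: "x \<in> V" using W x by (auto simp: opens_def)
  interpret ext_fibre E x by (rule ext_fibre[OF xt])
  note ux = holo_section_fibre[OF u x]
  let ?b = "gen_image x (u x)"
  obtain V' \<alpha>' W' u' where p: "(V', \<alpha>') \<in> a x" "W' \<in> opens X V'" "x \<in> W'" "holo_section M E W' u'" "u' x = u x"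
      "\<alpha>' W' (vec_sec W' u') x \<ominus>\<^bsub>R\<^esub> cl ?b \<in> fil x (k + 1)"
    using gen_image[OF xt ux] unfolding is_gen_image_def by blast
  note V' = lift_congruent(1,2)[OF l xV p(1)]
  obtain W0 where W0: "W0 \<in> opens X (V \<inter> V')" "x \<in> W0"
      and cong: "\<And>S s y. \<lbrakk>S \<in> opens X W0; s \<in> Sec S; y \<in> S\<rbrakk> \<Longrightarrow> \<alpha>' S s y \<ominus>\<^bsub>ext_algebra E y\<^esub> \<alpha> S s y \<in> fil y (k + 1)"
    using lift_congruent(3)[OF l xV p(1)] by blast
  obtain T h where T: "(T, h) \<in> trivs E" "x \<in> T" using triv_exists[OF xt] by blast
  define D where "D = W \<inter> W' \<inter> W0 \<inter> T"
  have oD: "openin X D" unfolding D_def using oW opens_open[OF p(2)] opens_open[OF W0(1)] triv_open[OF T(1)] by blast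
  have D: "D \<in> opens X W" "D \<in> opens X W'" "D \<in> opens X W0" "D \<subseteq> T" "x \<in> D" "D \<subseteq> W" "D \<subseteq> W'"
    using oD x p(3) W0(2) T(2) by (auto simp: opens_def D_def)
  have DV: "D \<in> opens X V" "D \<in> opens X V'" by (rule opens_trans[OF W D(1)], rule opens_trans[OF p(2) D(2)])
  note uD = holo_section_mono[OF u D(6)] and uD' = holo_section_mono[OF p(4) D(7)]
  note s = vec_sec_section[OF oD uD] and s' = vec_sec_section[OF oD uD']
  have e: "\<alpha> W (vec_sec W u) x = \<alpha> D (vec_sec D u) x"
    using aut_local[OF G_aut[OF V(2)] W D(1) vec_sec_section[OF oW u] D(5)] restrict_vec_sec[OF D(6)] by simp
  have e': "\<alpha>' W' (vec_sec W' u') x = \<alpha>' D (vec_sec D u') x"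
    using aut_local[OF G_aut[OF V'(1)] p(2) D(2) vec_sec_section[OF opens_open[OF p(2)] p(4)] D(5)]
      restrict_vec_sec[OF D(7)] by simp
  have c: "\<alpha> D (vec_sec D u) x \<in> carrier R" "\<alpha> D (vec_sec D u') x \<in> carrier R" "\<alpha>' D (vec_sec D u') x \<in> carrier R" "cl ?b \<in> carrier R"
    using section_carrier[OF aut_closed[OF G_aut[OF V(2)] DV(1) s] D(5)] section_carrier[OF aut_closed[OF G_aut[OF V(2)] DV(1) s'] D(5)]
      section_carrier[OF aut_closed[OF G_aut[OF V'(1)] DV(2) s'] D(5)] cl_closed[OF gen_image_letters[OF xt ux]] by auto
  have "\<alpha> D (vec_sec D u) x \<ominus>\<^bsub>R\<^esub> \<alpha> D (vec_sec D u') x \<in> fil x (k + 1)"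
    by (rule aut_vec_pointwise[OF V(2) odd_k DV(1) T(1) D(4) uD uD' D(5)]) (simp add: p(5))
  moreover have "\<alpha> D (vec_sec D u') x \<ominus>\<^bsub>R\<^esub> \<alpha>' D (vec_sec D u') x \<in> fil x (k + 1)"
    by (rule part_diff_swap[OF c(3,2) cong[OF D(3) s' D(5)]])
  moreover have "\<alpha>' D (vec_sec D u') x \<ominus>\<^bsub>R\<^esub> cl ?b \<in> fil x (k + 1)" using p(6) unfolding e' .
  ultimately show ?thesis
    unfolding e using part_diff_trans[OF c(1,2,4) _ part_diff_trans[OF c(2,3,4)]] by blast
qed

text \<open>Automorphisms respect sums and constant multiples, so both differences lie in \<open>J\<^sup>k\<^sup>+\<^sup>1\<close>; up to a
  relation they consist of words of length \<open>k\<close>.\<close>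

lemma gen_image_linear:
  assumes x: "x \<in> topspace X" and u: "u \<in> fibre E x"
  shows gen_image_vadd: "v \<in> fibre E x \<Longrightarrow> gen_image x (vadd E u v) - gen_image x u - gen_image x v \<in> ext_ideal E x"
    and gen_image_vscale: "gen_image x (vscale E c u) - word [] c * gen_image x u \<in> ext_ideal E x"
proof -
  interpret ext_fibre E x by (rule ext_fibre[OF x])
  let ?g = "gen_image x"
  obtain V \<alpha> where l: "is_lift V \<alpha>" "x \<in> V" using lift_exists[OF x] by blast
  note V = liftD[OF l(1)] and aa = G_aut[OF liftD(2)[OF l(1)]]
  have gA: "?g w \<in> A" if "w \<in> fibre E x" for w by (rule gen_image_letters[OF x that])
  have gl: "?g w - word [w] 1 \<in> lengths ((=) k)" if "w \<in> fibre E x" for w by (rule gen_image_diff[OF x that])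
  obtain W u' where W: "W \<in> opens X V" "x \<in> W" and u': "holo_section M E W u'" "u' x = u"
    using vector_extends_near[OF l(2) V(1) u] by blast
  have oW: "openin X W" by (rule opens_open[OF W(1)])
  have cr: "\<alpha> S t x \<in> carrier R" if "S \<in> opens X V" "x \<in> S" "t \<in> Sec S" for S t
    by (rule section_carrier[OF aut_closed[OF aa that(1,3)] that(2)])
  have clg: "cl (?g w) \<in> carrier R" if "w \<in> fibre E x" for w by (rule cl_closed[OF gA[OF that]])
  show "gen_image x (vadd E u v) - gen_image x u - gen_image x v \<in> I" if v: "v \<in> fibre E x"
  proof -
    obtain S v' where S: "S \<in> opens X W" "x \<in> S" and v': "holo_section M E S v'" "v' x = v"
      using vector_extends_near[OF W(2) oW v] by blast
    have oS: "openin X S" and SV: "S \<in> opens X V" using opens_open[OF S(1)] opens_trans[OF W(1) S(1)] by auto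
    have uS: "holo_section M E S u'" using holo_section_mono[OF u'(1)] S(1) by (auto simp: opens_def)
    let ?w = "\<lambda>y. vadd E (u' y) (v' y)"
    have wS: "holo_section M E S ?w" by (rule holo_section_add[OF oS uS v'(1)])
    have uv: "vadd E u v \<in> fibre E x" by (rule vadd_closed[OF u v])
    have sum: "vec_sec S ?w = vec_sec S u' \<oplus>\<^bsub>sring S\<^esub> vec_sec S v'"
    proof (rule section_eqI[OF vec_sec_section[OF oS wS] sec_add_closed[OF oS vec_sec_section[OF oS uS] vec_sec_section[OF oS v'(1)]]])
      fix y assume y: "y \<in> S"
      interpret Y: ext_fibre E y by (rule ext_fibre[OF open_sub[OF oS y]])
      note f = holo_section_fibre[OF uS y] holo_section_fibre[OF v'(1) y]
      show "vec_sec S ?w y = (vec_sec S u' \<oplus>\<^bsub>sring S\<^esub> vec_sec S v') y"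
        using y f Y.vadd_closed[OF f] Y.I_vadd[OF f]
        by (simp add: vec_sec_def Y.cl_add Y.cl_eq_iff letters_word letters_add algebra_simps)
    qed
    note cu = cr[OF SV S(2) vec_sec_section[OF oS uS]] and cv = cr[OF SV S(2) vec_sec_section[OF oS v'(1)]]
    have val: "\<alpha> S (vec_sec S ?w) x = \<alpha> S (vec_sec S u') x \<oplus>\<^bsub>R\<^esub> \<alpha> S (vec_sec S v') x"
      unfolding sum aut_add[OF aa SV vec_sec_section[OF oS uS] vec_sec_section[OF oS v'(1)]] using S(2) by simp
    have 1: "cl (?g (vadd E u v)) \<ominus>\<^bsub>R\<^esub> \<alpha> S (vec_sec S ?w) x \<in> fil x (k + 1)"
      using gen_image_lift[OF l(1) SV S(2) wS] u'(2) v'(2)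
      by (intro part_diff_swap[OF cr[OF SV S(2) vec_sec_section[OF oS wS]] clg[OF uv]]) simp
    have 2: "\<alpha> S (vec_sec S ?w) x \<ominus>\<^bsub>R\<^esub> (cl (?g u) \<oplus>\<^bsub>R\<^esub> cl (?g v)) \<in> fil x (k + 1)"
      unfolding val R_diff_add[OF cu cv clg[OF u] clg[OF v]]
      using gen_image_lift[OF l(1) SV S(2) uS] gen_image_lift[OF l(1) SV S(2) v'(1)] u'(2) v'(2)
      by (intro part_add) simp_all
    have "cl (?g (vadd E u v)) \<ominus>\<^bsub>R\<^esub> (cl (?g u) \<oplus>\<^bsub>R\<^esub> cl (?g v)) \<in> fil x (k + 1)"
      by (rule part_diff_trans[OF clg[OF uv] cr[OF SV S(2) vec_sec_section[OF oS wS]] R_add_closed[OF clg[OF u] clg[OF v]] 1 2])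
    then have fil: "cl (?g (vadd E u v) - ?g u - ?g v) \<in> fil x (k + 1)"
      using gA u v uv by (simp add: cl_add cl_diff letters_add diff_diff_eq)
    have "?g (vadd E u v) - ?g u - ?g v - (word [vadd E u v] 1 - word [u] 1 - word [v] 1)
        = (?g (vadd E u v) - word [vadd E u v] 1) - (?g u - word [u] 1) - (?g v - word [v] 1)"
      by (simp add: algebra_simps)
    also have "\<dots> \<in> lengths (\<lambda>n. n \<le> k)"
      by (rule lengths_mono[OF lengths_diff[OF lengths_diff[OF gl[OF uv] gl[OF u]] gl[OF v]]]) simp
    finally show ?thesis
      using gA u v uv by (intro low_part_in_I[OF _ fil I_vadd[OF u v]] letters_diff)
  qed
  show "gen_image x (vscale E c u) - word [] c * gen_image x u \<in> I"
  proof -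
    let ?w = "\<lambda>y. vscale E c (u' y)"
    have wW: "holo_section M E W ?w" by (rule holo_section_scale[OF oW u'(1)])
    have cu: "vscale E c u \<in> fibre E x" by (rule vscale_closed[OF u])
    note s = vec_sec_section[OF oW u'(1)]
    have prod: "vec_sec W ?w = const_section E W c \<otimes>\<^bsub>sring W\<^esub> vec_sec W u'"
    proof (rule section_eqI[OF vec_sec_section[OF oW wW] sec_mult_closed[OF oW const_section_closed[OF oW] s]])
      fix y assume y: "y \<in> W"
      interpret Y: ext_fibre E y by (rule ext_fibre[OF open_sub[OF oW y]])
      note f = holo_section_fibre[OF u'(1) y]
      show "vec_sec W ?w y = (const_section E W c \<otimes>\<^bsub>sring W\<^esub> vec_sec W u') y"
        using y f Y.vscale_closed[OF f] Y.I_vscale[OF f]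
        by (simp add: vec_sec_def const_section_def Y.cl_mult Y.cl_eq_iff letters_word word_mult)
    qed
    have l0: "word [] c \<in> A" by (rule letters_word) simp
    have cc: "cl (word [] c) \<in> carrier R" by (rule cl_closed[OF l0])
    have val: "\<alpha> W (vec_sec W ?w) x = cl (word [] c) \<otimes>\<^bsub>R\<^esub> \<alpha> W (vec_sec W u') x"
      unfolding prod aut_mult[OF aa W(1) const_section_closed[OF oW] s] aut_const[OF aa W(1)]
      using W(2) by (simp add: const_section_def)
    have 1: "cl (?g (vscale E c u)) \<ominus>\<^bsub>R\<^esub> \<alpha> W (vec_sec W ?w) x \<in> fil x (k + 1)"
      using gen_image_lift[OF l(1) W wW] u'(2)
      by (intro part_diff_swap[OF cr[OF W vec_sec_section[OF oW wW]] clg[OF cu]]) simp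
    have "cl (word [] c) \<ominus>\<^bsub>R\<^esub> cl (word [] c) \<in> fil x (k + 1)" using R_diff_self[OF cc] part_zero by simp
    then have 2: "\<alpha> W (vec_sec W ?w) x \<ominus>\<^bsub>R\<^esub> (cl (word [] c) \<otimes>\<^bsub>R\<^esub> cl (?g u)) \<in> fil x (k + 1)"
      unfolding val using gen_image_lift[OF l(1) W u'(1)] u'(2)
      by (intro part_diff_mult[OF cc cr[OF W s] cc clg[OF u]]) simp_all
    have mc: "cl (word [] c) \<otimes>\<^bsub>R\<^esub> cl (?g u) \<in> carrier R"
      by (rule monoid.m_closed[OF ring.is_monoid[OF ring_R] cc clg[OF u]])
    have "cl (?g (vscale E c u)) \<ominus>\<^bsub>R\<^esub> (cl (word [] c) \<otimes>\<^bsub>R\<^esub> cl (?g u)) \<in> fil x (k + 1)"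
      by (rule part_diff_trans[OF clg[OF cu] cr[OF W vec_sec_section[OF oW wW]] mc 1 2])
    then have fil: "cl (?g (vscale E c u) - word [] c * ?g u) \<in> fil x (k + 1)"
      using gA u cu l0 by (simp add: cl_mult cl_diff letters_mult)
    have "?g (vscale E c u) - word [] c * ?g u - (word [vscale E c u] 1 - word [u] c)
        = (?g (vscale E c u) - word [vscale E c u] 1) - word [] c * (?g u - word [u] 1)"
      by (simp add: algebra_simps word_mult)
    also have "\<dots> \<in> lengths (\<lambda>n. n \<le> k)"
      by (rule lengths_mono[OF lengths_diff[OF gl[OF cu] lengths_scalar_mult[OF gl[OF u]]]]) simp
    finally show ?thesis
      using gA u cu l0 by (intro low_part_in_I[OF _ fil I_vscale[OF u]] letters_diff letters_mult)
  qed
qed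

lemma gen_image_odd:
  assumes "x \<in> topspace X" "u \<in> fibre E x"
  shows "gen_image x u \<in> lengths odd"
proof -
  have "gen_image x u - word [u] 1 \<in> lengths odd"
    using lengths_mono[OF gen_image_diff[OF assms], of odd] odd_k by auto
  moreover have "word [u] 1 \<in> lengths odd" by (rule lengths_word) simp
  ultimately show ?thesis using lengths_add[of "gen_image x u - word [u] 1" odd "word [u] 1"] by simp
qed

definition fibre_lift :: "'x \<Rightarrow> ('e list \<Rightarrow>\<^sub>0 complex) set \<Rightarrow> ('e list \<Rightarrow>\<^sub>0 complex) set" where
  "fibre_lift x p = ext_class E x (free_subst (gen_image x) (SOME b. b \<in> letters (fibre E x) \<and> p = ext_class E x b))"

context
  fixes x assumes x: "x \<in> topspace X"
begin

interpretation ext_fibre E x by (rule ext_fibre[OF x])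

lemma subst_letters: "b \<in> A \<Longrightarrow> free_subst (gen_image x) b \<in> A"
  by (rule free_subst_letters[OF gen_image_letters[OF x]])

text \<open>The substitution \<open>v \<mapsto> v + \<phi>(v)\<close> respects the relations: \<open>\<phi>\<close> is linear, and \<open>v + \<phi>(v)\<close> is odd,
  so its square vanishes.\<close>

lemma fibre_lift_cl: "b \<in> A \<Longrightarrow> fibre_lift x (cl b) = cl (free_subst (gen_image x) b)"
proof -
  assume b: "b \<in> A"
  let ?c = "SOME c. c \<in> A \<and> cl b = cl c"
  have c: "?c \<in> A \<and> cl b = cl ?c" by (rule someI[of _ b]) (use b in simp)
  then have "?c - b \<in> I" using cl_eq_iff b by auto
  then have "free_subst (gen_image x) (?c - b) \<in> I"
    by (rule free_subst_I[OF gen_image_letters[OF x] gen_image_vadd[OF x] gen_image_vscale[OF x]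
          odd_square[OF gen_image_letters[OF x] gen_image_odd[OF x]], rotated -1])
  then show ?thesis
    unfolding fibre_lift_def using c b subst_letters by (subst cl_eq_iff) (auto simp: free_subst_diff)
qed

lemma fibre_lift_closed: "p \<in> carrier R \<Longrightarrow> fibre_lift x p \<in> carrier R"
  by (auto dest!: carrier_R simp: fibre_lift_cl intro!: cl_closed subst_letters)

lemma fibre_lift_mult: "p \<in> carrier R \<Longrightarrow> q \<in> carrier R \<Longrightarrow> fibre_lift x (p \<otimes>\<^bsub>R\<^esub> q) = fibre_lift x p \<otimes>\<^bsub>R\<^esub> fibre_lift x q"
  by (auto dest!: carrier_R simp: fibre_lift_cl cl_mult letters_mult free_subst_mult subst_letters)

lemma fibre_lift_add: "p \<in> carrier R \<Longrightarrow> q \<in> carrier R \<Longrightarrow> fibre_lift x (p \<oplus>\<^bsub>R\<^esub> q) = fibre_lift x p \<oplus>\<^bsub>R\<^esub> fibre_lift x q"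
  by (auto dest!: carrier_R simp: fibre_lift_cl cl_add letters_add free_subst_add subst_letters)

lemma fibre_lift_diff: "p \<in> carrier R \<Longrightarrow> q \<in> carrier R \<Longrightarrow> fibre_lift x (p \<ominus>\<^bsub>R\<^esub> q) = fibre_lift x p \<ominus>\<^bsub>R\<^esub> fibre_lift x q"
  by (auto dest!: carrier_R simp: fibre_lift_cl cl_diff letters_diff free_subst_diff subst_letters)

lemma fibre_lift_scalar: "fibre_lift x (cl (word [] c)) = cl (word [] c)"
  using fibre_lift_cl[OF letters_word, of "[]" c] by (simp add: free_subst_scalar)

lemma fibre_lift_vec: "v \<in> fibre E x \<Longrightarrow> fibre_lift x (cl (word [v] 1)) = cl (gen_image x v)"
  using fibre_lift_cl[OF letters_word, of "[v]" 1] by (simp add: free_subst_letter word_Nil_one)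

lemma fibre_lift_even: "p \<in> ext_part E x even \<Longrightarrow> fibre_lift x p \<in> ext_part E x even"
  using free_subst_parity[OF _ _ gen_image_odd[OF x], where b = True]
  by (auto elim!: partE simp: fibre_lift_cl intro!: cl_partI subst_letters)

lemma fibre_lift_odd: "p \<in> ext_part E x odd \<Longrightarrow> fibre_lift x p \<in> ext_part E x odd"
  using free_subst_parity[OF _ _ gen_image_odd[OF x], where b = False]
  by (auto elim!: partE simp: fibre_lift_cl intro!: cl_partI subst_letters)

lemma fibre_lift_raises:
  assumes p: "p \<in> fil x j"
  shows "fibre_lift x p \<ominus>\<^bsub>R\<^esub> p \<in> fil x k" and "fibre_lift x p \<ominus>\<^bsub>R\<^esub> p \<in> fil x (Suc j)"
proof -
  obtain b where b: "b \<in> A" "b \<in> lengths (\<lambda>n. j \<le> n)" "p = cl b" by (rule partE[OF p])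
  have l: "free_subst (gen_image x) b - b \<in> lengths (\<lambda>n. k \<le> n \<and> j + k - 1 \<le> n)"
    using k2 by (intro free_subst_minus_id[OF b(1,2) gen_image_diff[OF x]]) auto
  have e: "fibre_lift x p \<ominus>\<^bsub>R\<^esub> p = cl (free_subst (gen_image x) b - b)"
    using b subst_letters by (simp add: fibre_lift_cl cl_diff)
  show "fibre_lift x p \<ominus>\<^bsub>R\<^esub> p \<in> fil x k" "fibre_lift x p \<ominus>\<^bsub>R\<^esub> p \<in> fil x (Suc j)"
    unfolding e using k2
    by (auto intro!: cl_partI letters_diff subst_letters b(1) lengths_mono[OF l])
qed

text \<open>The difference to the identity raises the filtration, which is finite.\<close>

lemma fibre_lift_inj:
  assumes p: "p \<in> carrier R" and q: "q \<in> carrier R" and eq: "fibre_lift x p = fibre_lift x q"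
  shows "p = q"
proof -
  let ?d = "p \<ominus>\<^bsub>R\<^esub> q"
  have d: "?d \<in> carrier R" by (rule R_diff_closed[OF p q])
  have z: "fibre_lift x ?d = \<zero>\<^bsub>R\<^esub>"
    using fibre_lift_diff[OF p q] R_diff_self[OF fibre_lift_closed[OF q]] by (simp add: eq)
  have "?d \<in> fil x j" for j
  proof (induction j)
    case 0
    show ?case by (rule part_all[OF d])
  next
    case (Suc j)
    have "\<zero>\<^bsub>R\<^esub> \<ominus>\<^bsub>R\<^esub> ?d \<in> fil x (Suc j)" using fibre_lift_raises(2)[OF Suc] by (simp add: z)
    then have "?d \<ominus>\<^bsub>R\<^esub> \<zero>\<^bsub>R\<^esub> \<in> fil x (Suc j)"
      by (rule part_diff_swap[OF part_carrier[OF part_zero] d])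
    moreover have "w \<ominus>\<^bsub>R\<^esub> \<zero>\<^bsub>R\<^esub> = w" if "w \<in> carrier R" for w
      using that by (auto dest!: carrier_R simp: cl_zero cl_diff)
    ultimately show ?case using d by simp
  qed
  then show ?thesis using high_powers_vanish[OF x] R_diff_eq_zero[OF p q] by blast
qed

end

definition global_lift :: "('x, 'e) ext_aut" where
  "global_lift = (\<lambda>V\<in>opens X (topspace X). \<lambda>s\<in>Sec V. \<lambda>y\<in>V. fibre_lift y (s y))"

lemma global_lift_at: "V \<in> opens X (topspace X) \<Longrightarrow> s \<in> Sec V \<Longrightarrow> global_lift V s = (\<lambda>y\<in>V. fibre_lift y (s y))"
  by (simp add: global_lift_def)

text \<open>On sections of the bundle the fibrewise lift agrees with the truncation in degrees at most \<open>k\<close>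
  of any local lift, so it preserves holomorphy.\<close>

lemma fibre_lift_vec_section:
  assumes l: "is_lift V \<alpha>" and D: "D \<in> opens X V" and u: "holo_section M E D u"
  shows "(\<lambda>y\<in>D. fibre_lift y (vec_sec D u y)) \<in> Sec D"
proof -
  note V = liftD[OF l]
  have oD: "openin X D" by (rule opens_open[OF D])
  note s = aut_closed[OF G_aut[OF V(2)] D vec_sec_section[OF oD u]]
  obtain t where t: "t \<in> Sec D" "\<And>y c. \<lbrakk>y \<in> D; c \<in> letters (fibre E y); \<alpha> D (vec_sec D u) y = ext_class E y c\<rbrakk>
      \<Longrightarrow> t y = ext_class E y (len_part (\<lambda>n. \<not> k + 1 \<le> n) c)"
    using section_part[OF oD s, of "\<lambda>n. \<not> k + 1 \<le> n"] by blast
  have "(\<lambda>y\<in>D. fibre_lift y (vec_sec D u y)) = t"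
  proof (rule extensionalityI[OF _ section_ext[OF t(1)]])
    fix y assume y: "y \<in> D"
    have yt: "y \<in> topspace X" by (rule open_sub[OF oD y])
    interpret ext_fibre E y by (rule ext_fibre[OF yt])
    note uy = holo_section_fibre[OF u y]
    let ?g = "gen_image y (u y)" and ?P = "\<lambda>n. \<not> k + 1 \<le> n"
    have g: "?g \<in> A" by (rule gen_image_letters[OF yt uy])
    obtain c where c: "c \<in> A" "\<alpha> D (vec_sec D u) y = cl c" using carrier_R[OF section_carrier[OF s y]] by blast
    have "cl (c - ?g) \<in> fil y (k + 1)"
      using gen_image_lift[OF l D y u] c g by (simp add: cl_diff)
    then have "len_part ?P (c - ?g) \<in> I" using cl_part_iff[OF letters_diff[OF c(1) g]] by simp
    moreover have "len_part ?P ?g = ?g"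
    proof (rule len_part_id)
      have "?g - word [u y] 1 \<in> lengths ?P" by (rule lengths_mono[OF gen_image_diff[OF yt uy]]) simp
      moreover have "word [u y] 1 \<in> lengths ?P" using k2 by (intro lengths_word) simp
      ultimately show "?g \<in> lengths ?P" using lengths_add[of "?g - word [u y] 1" ?P "word [u y] 1"] by simp
    qed
    ultimately have "cl (len_part ?P c) = cl ?g"
      using c g by (simp add: cl_eq_iff letters_len_part len_part_diff)
    then show "(\<lambda>y\<in>D. fibre_lift y (vec_sec D u y)) y = t y"
      using t(2)[OF y c] y fibre_lift_vec[OF yt uy] by (simp add: vec_sec_def)
  qed simp
  then show ?thesis using t(1) by simp
qed

lemma fun_sec_fixed:
  "openin X D \<Longrightarrow> (\<lambda>y\<in>D. fibre_lift y (fun_sec D f y)) = fun_sec D f"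
  by (rule extensionalityI[where A = D]) (simp_all add: fun_sec_def fibre_lift_scalar open_sub)

lemma fibre_lift_section:
  assumes V: "openin X V" and s: "s \<in> Sec V"
  shows "(\<lambda>y\<in>V. fibre_lift y (s y)) \<in> Sec V"
proof (rule section_glue[OF V])
  fix x assume x: "x \<in> V"
  obtain V0 \<alpha> where l: "is_lift V0 \<alpha>" "x \<in> V0" using lift_exists[OF open_sub[OF V x]] by blast
  obtain W ts where W: "W \<in> opens X V" "x \<in> W" "holo_terms W ts"
      and sy: "\<And>y. y \<in> W \<Longrightarrow> s y = ext_class E y (terms_at ts y)"
    by (rule sectionE[OF s x]) blast
  define D where "D = W \<inter> V0"
  have oD: "openin X D" unfolding D_def using opens_open[OF W(1)] liftD(1)[OF l(1)] by blast
  have D: "D \<in> opens X V0" "D \<in> opens X V" "D \<subseteq> W" "x \<in> D" "D \<subseteq> V"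
    using oD W(1,2) l(2) by (auto simp: D_def opens_def)
  let ?L = "\<lambda>t. \<lambda>y\<in>D. fibre_lift y (t y)"
  have "?L (\<lambda>y\<in>D. ext_class E y (terms_at ts y)) \<in> Sec D"
  proof (rule terms_induct[where Q = "\<lambda>_ t. ?L t \<in> Sec D" and j = 0, OF oD holo_terms_mono[OF W(3) D(3)]])
    show "?L (fun_sec D f) \<in> Sec D" if "holo_fun M D f" for f
      unfolding fun_sec_fixed[OF oD] by (rule fun_sec_section[OF oD that])
    show "?L (fun_sec D (\<lambda>_. 0)) \<in> Sec D" for j :: nat
      unfolding fun_sec_fixed[OF oD] by (rule fun_sec_section[OF oD holo_fun_const])
    show "?L (vec_sec D u) \<in> Sec D" if "holo_section M E D u" for u
      by (rule fibre_lift_vec_section[OF l(1) D(1) that])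
    show "?L (p \<otimes>\<^bsub>sring D\<^esub> q) \<in> Sec D" if "p \<in> Sec D" "q \<in> Sec D" "?L p \<in> Sec D" "?L q \<in> Sec D" for i j :: nat and p q
    proof -
      have "?L (p \<otimes>\<^bsub>sring D\<^esub> q) = ?L p \<otimes>\<^bsub>sring D\<^esub> ?L q"
        by (rule extensionalityI[where A = D])
          (simp_all add: fibre_lift_mult open_sub[OF oD] section_carrier[OF that(1)] section_carrier[OF that(2)],
            simp add: ext_section_ring_def)
      then show ?thesis using sec_mult_closed[OF oD that(3,4)] by simp
    qed
    show "?L (p \<oplus>\<^bsub>sring D\<^esub> q) \<in> Sec D" if "p \<in> Sec D" "q \<in> Sec D" "?L p \<in> Sec D" "?L q \<in> Sec D" for j :: nat and p q
    proof -
      have "?L (p \<oplus>\<^bsub>sring D\<^esub> q) = ?L p \<oplus>\<^bsub>sring D\<^esub> ?L q"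
        by (rule extensionalityI[where A = D])
          (simp_all add: fibre_lift_add open_sub[OF oD] section_carrier[OF that(1)] section_carrier[OF that(2)],
            simp add: ext_section_ring_def)
      then show ?thesis using sec_add_closed[OF oD that(3,4)] by simp
    qed
  qed simp_all
  moreover have "?L (\<lambda>y\<in>D. ext_class E y (terms_at ts y)) = restrict (\<lambda>y\<in>V. fibre_lift y (s y)) D"
    using sy D(3,5) by (auto simp: fun_eq_iff)
  ultimately show "\<exists>W\<in>opens X V. x \<in> W \<and> restrict (\<lambda>y\<in>V. fibre_lift y (s y)) W \<in> Sec W"
    using D(2,4) by (intro bexI[of _ D]) simp_all
qed simp

text \<open>Successive approximation: \<open>t\<close> minus its image lies one step deeper in the filtration, and \<open>n\<close> counts
  the steps that remain.\<close>

lemma global_lift_surj: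
  assumes V: "V \<in> opens X (topspace X)" and t: "t \<in> Sec V" "\<And>y. y \<in> V \<Longrightarrow> t y \<in> fil y (Suc r - n)"
  shows "\<exists>s\<in>Sec V. global_lift V s = t"
  using t
proof (induction n arbitrary: t)
  case 0
  have oV: "openin X V" by (rule opens_open[OF V])
  have "global_lift V t y = t y" if y: "y \<in> V" for y
  proof -
    have yt: "y \<in> topspace X" by (rule open_sub[OF oV y])
    interpret ext_fibre E y by (rule ext_fibre[OF yt])
    have "t y = \<zero>\<^bsub>R\<^esub>" using high_powers_vanish[OF yt] 0(2)[OF y] by simp
    then show ?thesis using fibre_lift_scalar[OF yt, of 0] y 0(1) by (simp add: global_lift_at[OF V] cl_zero)
  qed
  then have "global_lift V t = t"
    using fibre_lift_section[OF oV 0(1)] unfolding global_lift_at[OF V 0(1)]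
    by (intro section_eqI[OF _ 0(1)])
  then show ?case using 0(1) by blast
next
  case (Suc n)
  have oV: "openin X V" by (rule opens_open[OF V])
  have L: "global_lift V p \<in> Sec V" if "p \<in> Sec V" for p
    unfolding global_lift_at[OF V that] by (rule fibre_lift_section[OF oV that])
  let ?d = "sec_diff V t (global_lift V t)"
  have d: "?d \<in> Sec V" by (rule sec_diff_closed[OF oV Suc.prems(1) L[OF Suc.prems(1)]])
  have "?d y \<in> fil y (Suc r - n)" if y: "y \<in> V" for y
  proof -
    have yt: "y \<in> topspace X" by (rule open_sub[OF oV y])
    interpret ext_fibre E y by (rule ext_fibre[OF yt])
    note ty = section_carrier[OF Suc.prems(1) y]
    have "fibre_lift y (t y) \<ominus>\<^bsub>R\<^esub> t y \<in> fil y (Suc (Suc r - Suc n))"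
      by (rule fibre_lift_raises(2)[OF yt Suc.prems(2)[OF y]])
    then have "t y \<ominus>\<^bsub>R\<^esub> fibre_lift y (t y) \<in> fil y (Suc (Suc r - Suc n))"
      by (rule part_diff_swap[OF fibre_lift_closed[OF yt ty] ty])
    then have "t y \<ominus>\<^bsub>R\<^esub> fibre_lift y (t y) \<in> fil y (Suc r - n)"
      by (rule fil_mono[OF yt]) simp
    then show ?thesis using y by (simp add: sec_diff_at global_lift_at[OF V Suc.prems(1)])
  qed
  then obtain s where s: "s \<in> Sec V" "global_lift V s = ?d" using Suc.IH[OF d] by blast
  have ts: "t \<oplus>\<^bsub>sring V\<^esub> s \<in> Sec V" by (rule sec_add_closed[OF oV Suc.prems(1) s(1)])
  have "global_lift V (t \<oplus>\<^bsub>sring V\<^esub> s) = t"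
  proof (rule section_eqI[OF L[OF ts] Suc.prems(1)])
    fix y assume y: "y \<in> V"
    have yt: "y \<in> topspace X" by (rule open_sub[OF oV y])
    interpret ext_fibre E y by (rule ext_fibre[OF yt])
    note ty = section_carrier[OF Suc.prems(1) y]
    have "fibre_lift y (s y) = t y \<ominus>\<^bsub>R\<^esub> fibre_lift y (t y)"
      using fun_cong[OF s(2), of y] y by (simp add: sec_diff_at global_lift_at[OF V s(1)] global_lift_at[OF V Suc.prems(1)])
    then show "global_lift V (t \<oplus>\<^bsub>sring V\<^esub> s) y = t y"
      using y R_add_diff[OF ty fibre_lift_closed[OF yt ty]]
      by (simp add: global_lift_at[OF V ts] fibre_lift_add[OF yt ty section_carrier[OF s(1) y]])
  qed
  then show ?case using ts by blast
qed

lemma global_lift_G: "global_lift \<in> G k (topspace X)"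
  unfolding G_iff
proof (intro conjI ballI)
  have oX: "openin X (topspace X)" by simp
  show "global_lift \<in> ext_auts M E (topspace X)"
  proof (rule autI[OF oX])
    show "global_lift \<in> extensional (opens X (topspace X))" by (simp add: global_lift_def)
    fix V assume V: "V \<in> opens X (topspace X)"
    have oV: "openin X V" by (rule opens_open[OF V])
    note at = global_lift_at[OF V]
    have yt: "y \<in> topspace X" if "y \<in> V" for y by (rule open_sub[OF oV that])
    have L: "global_lift V p \<in> Sec V" if "p \<in> Sec V" for p
      unfolding at[OF that] by (rule fibre_lift_section[OF oV that])
    show "global_lift V \<in> extensional (Sec V)" using V by (simp add: global_lift_def)
    show "global_lift V s \<in> Sec V" if "s \<in> Sec V" for s by (rule L[OF that])
    show "global_lift V (s \<otimes>\<^bsub>sring V\<^esub> t) = global_lift V s \<otimes>\<^bsub>sring V\<^esub> global_lift V t"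
      if s: "s \<in> Sec V" and t: "t \<in> Sec V" for s t
      by (rule section_eqI[OF L[OF sec_mult_closed[OF oV s t]] sec_mult_closed[OF oV L[OF s] L[OF t]]])
        (simp add: at s t sec_mult_closed[OF oV] fibre_lift_mult[OF yt] section_carrier[OF s] section_carrier[OF t])
    show "global_lift V (s \<oplus>\<^bsub>sring V\<^esub> t) = global_lift V s \<oplus>\<^bsub>sring V\<^esub> global_lift V t"
      if s: "s \<in> Sec V" and t: "t \<in> Sec V" for s t
      by (rule section_eqI[OF L[OF sec_add_closed[OF oV s t]] sec_add_closed[OF oV L[OF s] L[OF t]]])
        (simp add: at s t sec_add_closed[OF oV] fibre_lift_add[OF yt] section_carrier[OF s] section_carrier[OF t])
    show "global_lift V (const_section E V c) = const_section E V c" for c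
      unfolding at[OF const_section_closed[OF oV]] unfolding const_section_fun by (rule fun_sec_fixed[OF oV])
    show "global_lift V s \<in> Part V even" if s: "s \<in> Part V even" for s
      using PartD(2)[OF s] fibre_lift_even[OF yt]
      by (intro PartI[OF L[OF PartD(1)[OF s]]]) (simp add: at[OF PartD(1)[OF s]])
    show "global_lift V s \<in> Part V odd" if s: "s \<in> Part V odd" for s
      using PartD(2)[OF s] fibre_lift_odd[OF yt]
      by (intro PartI[OF L[OF PartD(1)[OF s]]]) (simp add: at[OF PartD(1)[OF s]])
    show "bij_betw (global_lift V) (Sec V) (Sec V)"
      unfolding bij_betw_def
    proof
      show "inj_on (global_lift V) (Sec V)"
      proof (rule inj_onI)
        fix s t assume s: "s \<in> Sec V" and t: "t \<in> Sec V" and eq: "global_lift V s = global_lift V t"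
        show "s = t"
        proof (rule section_eqI[OF s t])
          fix y assume y: "y \<in> V"
          show "s y = t y"
            using fun_cong[OF eq, of y] y
            by (intro fibre_lift_inj[OF yt[OF y] section_carrier[OF s y] section_carrier[OF t y]]) (simp add: at s t)
        qed
      qed
      have "\<exists>s\<in>Sec V. global_lift V s = t" if t: "t \<in> Sec V" for t
        by (rule global_lift_surj[OF V t, of "Suc r"])
          (use ext_fibre.part_all[OF ext_fibre[OF yt] section_carrier[OF t]] in simp)
      then show "global_lift V ` Sec V = Sec V" using L by blast
    qed
    show "global_lift W (restrict s W) = restrict (global_lift V s) W" if W: "W \<in> opens X V" and s: "s \<in> Sec V" for W s
      unfolding global_lift_at[OF opens_trans[OF V W] section_restrict[OF oV W s]] at[OF s]
      using W by (auto simp: fun_eq_iff opens_def)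
  qed
  fix V s x assume V: "V \<in> opens X (topspace X)" and s: "s \<in> Sec V" and x: "x \<in> V"
  have xt: "x \<in> topspace X" by (rule opens_top[OF V x])
  show "global_lift V s x \<ominus>\<^bsub>ext_algebra E x\<^esub> s x \<in> fil x k"
    using fibre_lift_raises(1)[OF xt ext_fibre.part_all[OF ext_fibre[OF xt] section_carrier[OF s x]]] x
    by (simp add: global_lift_at[OF V s])
qed

lemma global_lift_germ:
  assumes x: "x \<in> topspace X"
  shows "a x = germ x (topspace X) global_lift"
proof -
  have oX: "openin X (topspace X)" by simp
  obtain V \<alpha> where l: "is_lift V \<alpha>" "x \<in> V" using lift_exists[OF x] by blast
  note V = liftD[OF l(1)]
  have VX: "V \<in> opens X (topspace X)" using V(1) openin_subset by (auto simp: opens_def)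
  let ?b = "restrict global_lift (opens X V)"
  have b: "?b \<in> G k V" by (rule restrict_G[OF oX VX global_lift_G])
  have at: "?b W s = (\<lambda>y\<in>W. fibre_lift y (s y))" if "W \<in> opens X V" "s \<in> Sec W" for W s
    using that global_lift_at[OF opens_trans[OF VX that(1)] that(2)] by simp
  have "\<forall>W\<in>opens X V. \<forall>s\<in>Sec W. \<forall>y\<in>W. ?b W s y \<ominus>\<^bsub>ext_algebra E y\<^esub> \<alpha> W s y \<in> fil y (k + 1)"
  proof (intro ballI)
    fix W s y assume W: "W \<in> opens X V" and s: "s \<in> Sec W" and y: "y \<in> W"
    show "?b W s y \<ominus>\<^bsub>ext_algebra E y\<^esub> \<alpha> W s y \<in> fil y (k + 1)"
    proof (rule aut_congruence[OF G_aut[OF b] G_aut[OF V(2)] _ _ W s y])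
      fix S f z assume S: "S \<in> opens X V" and f: "holo_fun M S f" and z: "z \<in> S"
      have oS: "openin X S" by (rule opens_open[OF S])
      interpret ext_fibre E z by (rule ext_fibre[OF open_sub[OF oS z]])
      note fs = fun_sec_section[OF oS f]
      have "?b S (fun_sec S f) = fun_sec S f" unfolding at[OF S fs] by (rule fun_sec_fixed[OF oS])
      then show "?b S (fun_sec S f) z \<ominus>\<^bsub>R\<^esub> \<alpha> S (fun_sec S f) z \<in> fil z (k + 1)"
        using part_diff_swap[OF section_carrier[OF aut_closed[OF G_aut[OF V(2)] S fs] z] section_carrier[OF fs z]
            aut_fun[OF V(2) odd_k S f z]] by simp
    next
      fix S u z assume S: "S \<in> opens X V" and u: "holo_section M E S u" and z: "z \<in> S"
      have oS: "openin X S" by (rule opens_open[OF S])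
      have zt: "z \<in> topspace X" by (rule open_sub[OF oS z])
      interpret ext_fibre E z by (rule ext_fibre[OF zt])
      note us = vec_sec_section[OF oS u] and uz = holo_section_fibre[OF u z]
      have "?b S (vec_sec S u) z = cl (gen_image z (u z))"
        unfolding at[OF S us] using z fibre_lift_vec[OF zt uz] by (simp add: vec_sec_def)
      then show "?b S (vec_sec S u) z \<ominus>\<^bsub>R\<^esub> \<alpha> S (vec_sec S u) z \<in> fil z (k + 1)"
        using part_diff_swap[OF section_carrier[OF aut_closed[OF G_aut[OF V(2)] S us] z] cl_closed[OF gen_image_letters[OF zt uz]]
            gen_image_lift[OF l(1) S z u]] by simp
    qed
  qed
  then have "comp_aut V (inv_aut V \<alpha>) ?b \<in> G (k + 1) V"
    using quotient_congruent[OF V(1) _ V(2) b] k2 by simp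
  moreover have "restrict \<alpha> (opens X V) = \<alpha>"
    by (rule extensional_restrict[OF aut_extensional[OF G_aut[OF V(2)]]])
  ultimately have "germ x V \<alpha> = germ x (topspace X) global_lift"
    using VX l(2) V
    by (intro GN.quot_germ_eqI[OF V(1) oX V(2) global_lift_G, of V])
      (auto simp: G_restr G_inv[OF V] G_mult opens_def)
  then show ?thesis using l by (simp add: is_lift_def)
qed

lemma connecting_map_base:
  "connecting_map X (G_sheaf M E k) (G_sheaf M E (k + 1)) a = cech_base X (G_sheaf M E (k + 1))"
  by (rule GN.connecting_map_global_lift[OF global_lift_G global_lift_germ])

end

section \<open>The boundary maps out of odd degree\<close>

theorem theorem6p5:
  fixes M :: "'x cmanifold" and E :: "('x, 'e) vbundle" and l :: nat
  assumes "complex_manifold M"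
    and "holomorphic_vector_bundle M E"
    and "l \<ge> 1"
  shows "\<delta> M E (2 * l + 2) \<in> H0_A M E (2 * l + 1) \<rightarrow> H1_G M E (2 * l + 2) \<and>
    \<delta> M E (2 * l + 2) constant_on H0_A M E (2 * l + 1) \<and>
    (\<forall>a\<in>H0_A M E (2 * l + 1). \<delta> M E (2 * l + 2) a = H1_G_base M E (2 * l + 2))"
proof -
  let ?k = "2 * l + 1"
  interpret model M E by (rule model.intro[OF assms(1,2)])
  have base: "\<delta> M E (2 * l + 2) a = H1_G_base M E (2 * l + 2)" if a: "a \<in> H0_A M E ?k" for a
  proof -
    interpret quotient_section M E ?k a
      using a assms(3) by unfold_locales (auto simp: H0_A_def)
    show ?thesis
      using connecting_map_base by (simp add: \<delta>_def H1_G_base_def)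
  qed
  moreover have "H1_G_base M E (2 * l + 2) \<in> H1_G M E (2 * l + 2)"
    unfolding H1_G_base_def H1_G_def by (rule presheaf_of_groups.cech_base_in_H1[OF presheaf_G])
  ultimately show ?thesis
    by (auto simp: constant_on_def)
qed

end
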